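(* Let $\mathcal R$ be a class of maps of simplicial sets containing all isomorphisms and let $\mathcal L$ be the class of all maps of simplicial sets having the left lifting property against all maps in $\mathcal R$. Let $\Sigma\to\Pi$ be an inclusion of complete pasting diagrams. The induced simplicial functor $\mathfrak C[\Sigma]\to\mathfrak C[\Pi]$ has the left lifting property against all local $\mathcal R$-functors if and only if the inclusion $$\mathrm N(\Sigma_{x,y}\odot\Pi_{x,y})\to\mathrm N(\Pi_{x,y})$$ belongs to $\mathcal L$ for all vertices $x,y$ of (the underlying graph of) $\Sigma$.
   Context: **Globular graphs.** Graphs are finite directed graphs (multiple edges allowed). Paths are directed and may be trivial (a single vertex); $p\cdot q$ is concatenation. A source of a graph is a vertex with a directed path to every other vertex; a target is a source of the opposite graph. An $st$-graph is a plane graph with a unique source $s$ and a unique target $t$, both incident with the exterior face. A face $\phi$ is globular if its clockwise oriented boundary is $p\cdot q^{op}$ for nontrivial directed paths $p,q$. For an interior face, $\operatorname{dom}\phi=p$, $\operatorname{cod}\phi=q$; for the exterior face the opposite convention is used, $\operatorname{dom}=q$, $\operatorname{cod}=p$ (so $\operatorname{dom}G\cdot(\operatorname{cod}G)^{op}$ runs clockwise around $G$). A globular graph is an $st$-graph all of whose faces are globular; the single-vertex graph is also allowed (trivial globular graph). $\operatorname{dom}G,\operatorname{cod}G$ are those of the exterior face. Subgraphs carry the induced embedding. For vertices $x,y$, $G_{x,y}\subseteq G$ is the subgraph of all directed paths from $x$ to $y$; it is empty or globular. A globular subgraph $H\subseteq G$ is wide if $s(H)=s(G)$ and $t(H)=t(G)$.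 **Nerve of $G$.** A glob is a globular subgraph $\gamma$ each of whose edges is incident with the exterior face of $\gamma$. On the set $PG$ of directed paths from $s(G)$ to $t(G)$, $p\le q$ iff there are a glob $\gamma\subseteq G$ and possibly trivial paths $a,b$ with $p=a\cdot\operatorname{dom}\gamma\cdot b$, $q=a\cdot\operatorname{cod}\gamma\cdot b$; $\gamma$ is then a witness for $p\le q$. $\mathrm N(G)$ is the nerve of the poset $(PG,\le)$. **Pasting diagrams.** If $H_1,H_2\subseteq G$ are globular subgraphs with $t(H_1)=s(H_2)$, their join is $H_1\vee H_2=H_1\cup H_2$. A pasting diagram $\Sigma=(G,S)$ is a globular graph $G$ with a set $S$ of globular subgraphs of $G$ containing all paths and closed under taking globular subgraphs. It is complete if $S$ is closed under joins (whenever defined). An inclusion $\Sigma\to\Pi$ of pasting diagrams $\Sigma=(G,S)$, $\Pi=(G,T)$ on the same graph means $S\subseteq T$. The restriction is $\Sigma_{x,y}=(G_{x,y},S_{x,y})$, $S_{x,y}=\{A\in S: A\subseteq G_{x,y}\}$. The nerve $\mathrm N(\Sigma)\subseteq\mathrm N(G)$ consists of the simplices $(p_0\le\dots\le p_n)$ for which there is $A\in S$ such that all relations $p_{i-1}\le p_i$ have witnesses $\gamma_i\subseteq A$. If $G_{x,y}=\emptyset$, all nerves attached to it are empty. **The operation $\odot$.** Let $\Sigma=(G,S)\to\Pi=(G,T)$ be an inclusion with $\Pi$ complete, $s=s(G)$, $t=t(G)$. Then $\Sigma\odot\Pi=(G,S\odot T)$ with $$S\odot T=S\cup\bigcup_{x\in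 G\setminus\{s,t\}}T_{s,x}\vee T_{x,t},$$ where $T_{s,x}\vee T_{x,t}$ is the set of all paths in $G_{s,x}\vee G_{x,t}$ together with all globular subgraphs of graphs $A\vee B$ with $A\in T_{s,x}$ wide in $G_{s,x}$ and $B\in T_{x,t}$ wide in $G_{x,t}$. For $\Pi$ complete one has $S\subseteq S\odot T\subseteq T$. In $\Sigma_{x,y}\odot\Pi_{x,y}$ the operation is formed on the graph $G_{x,y}$ with source $x$ and target $y$. **The category $\mathfrak C[\Sigma]$.** A simplicial category is a category enriched in simplicial sets. For complete $\Sigma$, $\mathfrak C[\Sigma]$ has objects the vertices of $G$, mapping spaces $\mathfrak C[\Sigma](x,y)=\mathrm N(\Sigma_{x,y})$, identities the trivial paths, and composition given by concatenation of paths, $((p_i)_i,(q_i)_i)\mapsto(p_i\cdot q_i)_i$. An inclusion of complete pasting diagrams induces an identity-on-objects simplicial functor. A simplicial functor $u\colon\mathcal A\to\mathcal B$ is a local $\mathcal R$-functor if $\mathcal A(a,a')\to\mathcal B(ua,ua')$ is in $\mathcal R$ for all objects $a,a'$ of $\mathcal A$. *)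

theory Defs
  imports
    "Graph_Theory.Arc_Walk"
    "Graph_Theory.Digraph_Component"
    "HOL-Combinatorics.Orbits"
    "HOL-Library.FuncSet"
begin

section \<open>Simplicial sets\<close>

definition Delta :: "nat \<Rightarrow> nat \<Rightarrow> (nat \<Rightarrow> nat) set" where
  "Delta m n = {\<theta> \<in> {..m} \<rightarrow>\<^sub>E {..n}. mono_on {..m} \<theta>}"

text \<open>\<open>act X m n \<theta>\<close> is the operator from \<open>n\<close>-simplices to \<open>m\<close>-simplices given by
  \<open>\<theta> \<in> Delta m n\<close>. Its values outside the indicated domains carry no meaning.\<close>

record 'a sset =
  simplices :: "nat \<Rightarrow> 'a set"
  act :: "nat \<Rightarrow> nat \<Rightarrow> (nat \<Rightarrow> nat) \<Rightarrow> 'a \<Rightarrow> 'a"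

definition simplicial_set :: "'a sset \<Rightarrow> bool" where
  "simplicial_set X \<longleftrightarrow>
    (\<forall>m n. \<forall>\<theta>\<in>Delta m n. act X m n \<theta> \<in> simplices X n \<rightarrow> simplices X m) \<and>
    (\<forall>n. \<forall>x\<in>simplices X n. act X n n (\<lambda>i\<in>{..n}. i) x = x) \<and>
    (\<forall>k m n. \<forall>\<eta>\<in>Delta k m. \<forall>\<theta>\<in>Delta m n. \<forall>x\<in>simplices X n.
      act X k n (compose {..k} \<theta> \<eta>) x = act X k m \<eta> (act X m n \<theta> x))"

type_synonym ('a, 'b) smap = "nat \<Rightarrow> 'a \<Rightarrow> 'b"

definition sset_map :: "'a sset \<Rightarrow> 'b sset \<Rightarrow> ('a, 'b) smap \<Rightarrow> bool" where
  "sset_map X Y f \<longleftrightarrow>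
    simplicial_set X \<and> simplicial_set Y \<and>
    (\<forall>n. f n \<in> simplices X n \<rightarrow>\<^sub>E simplices Y n) \<and>
    (\<forall>m n. \<forall>\<theta>\<in>Delta m n. \<forall>x\<in>simplices X n. f m (act X m n \<theta> x) = act Y m n \<theta> (f n x))"

definition sset_iso :: "'a sset \<Rightarrow> 'b sset \<Rightarrow> ('a, 'b) smap \<Rightarrow> bool" where
  "sset_iso X Y f \<longleftrightarrow>
    sset_map X Y f \<and>
    (\<exists>g. sset_map Y X g \<and>
      (\<forall>n. \<forall>x\<in>simplices X n. g n (f n x) = x) \<and>
      (\<forall>n. \<forall>y\<in>simplices Y n. f n (g n y) = y))"

definition sset_incl :: "'a sset \<Rightarrow> ('a, 'a) smap" where
  "sset_incl K = (\<lambda>n. \<lambda>x\<in>simplices K n. x)"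

text \<open>The map \<open>i : K \<rightarrow> K'\<close> has the left lifting property against \<open>f : X \<rightarrow> Y\<close>.\<close>

definition sset_llp ::
  "'k sset \<Rightarrow> 'l sset \<Rightarrow> ('k, 'l) smap \<Rightarrow> 'a sset \<Rightarrow> 'b sset \<Rightarrow> ('a, 'b) smap \<Rightarrow> bool" where
  "sset_llp K K' i X Y f \<longleftrightarrow>
    (\<forall>u v. sset_map K X u \<longrightarrow> sset_map K' Y v \<longrightarrow>
      (\<forall>n. \<forall>k\<in>simplices K n. f n (u n k) = v n (i n k)) \<longrightarrow>
      (\<exists>h. sset_map K' X h \<and>
        (\<forall>n. \<forall>k\<in>simplices K n. h n (i n k) = u n k) \<and>
        (\<forall>n. \<forall>k\<in>simplices K' n. f n (h n k) = v n k)))"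

text \<open>A class of maps of simplicial sets is a set of triples (domain, codomain, map); the type
  \<open>'a\<close> of simplices is the universe of small sets. \<open>llp_class R\<close> holds of the maps with the left
  lifting property against the class \<open>R\<close>; their simplices need not have type \<open>'a\<close>.\<close>

type_synonym 'a sset_class = "('a sset \<times> 'a sset \<times> ('a, 'a) smap) set"

definition llp_class ::
  "'a sset_class \<Rightarrow> 'k sset \<Rightarrow> 'l sset \<Rightarrow> ('k, 'l) smap \<Rightarrow> bool" where
  "llp_class R K K' i \<longleftrightarrow>
    sset_map K K' i \<and> (\<forall>(X, Y, f)\<in>R. sset_llp K K' i X Y f)"

text \<open>The nerve of an order \<open>le\<close> on \<open>P\<close>: an \<open>n\<close>-simplex is a list of length \<open>n + 1\<close>.\<close>

definition nerve :: "'p set \<Rightarrow> ('p \<Rightarrow> 'p \<Rightarrow> bool) \<Rightarrow> 'p list sset" where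
  "nerve P le =
    \<lparr>simplices = (\<lambda>n. {ps. length ps = Suc n \<and> set ps \<subseteq> P \<and> (\<forall>i<n. le (ps ! i) (ps ! Suc i))}),
     act = (\<lambda>m n \<theta> ps. map (\<lambda>i. ps ! \<theta> i) [0..<Suc m])\<rparr>"


section \<open>Simplicial categories\<close>

text \<open>Composition is in diagrammatic order: \<open>scomp A a b c n f g\<close> composes
  \<open>f \<in> A(a, b)\<^sub>n\<close> and \<open>g \<in> A(b, c)\<^sub>n\<close> to an element of \<open>A(a, c)\<^sub>n\<close>.\<close>

record ('o, 'u) scat =
  objs :: "'o set"
  shom :: "'o \<Rightarrow> 'o \<Rightarrow> 'u sset"
  sid :: "'o \<Rightarrow> 'u"
  scomp :: "'o \<Rightarrow> 'o \<Rightarrow> 'o \<Rightarrow> nat \<Rightarrow> 'u \<Rightarrow> 'u \<Rightarrow> 'u"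

text \<open>The identity is a vertex of \<open>A(a, a)\<close>; this is its iterated degeneracy.\<close>

definition sid_deg :: "('o, 'u) scat \<Rightarrow> 'o \<Rightarrow> nat \<Rightarrow> 'u" where
  "sid_deg A a n = act (shom A a a) n 0 (\<lambda>i\<in>{..n}. 0) (sid A a)"

definition simplicial_category :: "('o, 'u) scat \<Rightarrow> bool" where
  "simplicial_category A \<longleftrightarrow>
    (\<forall>a\<in>objs A. \<forall>b\<in>objs A. simplicial_set (shom A a b)) \<and>
    (\<forall>a\<in>objs A. sid A a \<in> simplices (shom A a a) 0) \<and>
    (\<forall>a\<in>objs A. \<forall>b\<in>objs A. \<forall>c\<in>objs A. \<forall>n.
      \<forall>f\<in>simplices (shom A a b) n. \<forall>g\<in>simplices (shom A b c) n.
        scomp A a b c n f g \<in> simplices (shom A a c) n) \<and>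
    (\<forall>a\<in>objs A. \<forall>b\<in>objs A. \<forall>c\<in>objs A. \<forall>m n. \<forall>\<theta>\<in>Delta m n.
      \<forall>f\<in>simplices (shom A a b) n. \<forall>g\<in>simplices (shom A b c) n.
        act (shom A a c) m n \<theta> (scomp A a b c n f g) =
        scomp A a b c m (act (shom A a b) m n \<theta> f) (act (shom A b c) m n \<theta> g)) \<and>
    (\<forall>a\<in>objs A. \<forall>b\<in>objs A. \<forall>n. \<forall>f\<in>simplices (shom A a b) n.
      scomp A a a b n (sid_deg A a n) f = f \<and> scomp A a b b n f (sid_deg A b n) = f) \<and>
    (\<forall>a\<in>objs A. \<forall>b\<in>objs A. \<forall>c\<in>objs A. \<forall>d\<in>objs A. \<forall>n.
      \<forall>f\<in>simplices (shom A a b) n. \<forall>g\<in>simplices (shom A b c) n. \<forall>h\<in>simplices (shom A c d) n.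
        scomp A a c d n (scomp A a b c n f g) h = scomp A a b d n f (scomp A b c d n g h))"

record ('o, 'u, 'p, 'w) sfun =
  fobj :: "'o \<Rightarrow> 'p"
  fhom :: "'o \<Rightarrow> 'o \<Rightarrow> ('u, 'w) smap"

definition simplicial_functor ::
  "('o, 'u) scat \<Rightarrow> ('p, 'w) scat \<Rightarrow> ('o, 'u, 'p, 'w) sfun \<Rightarrow> bool" where
  "simplicial_functor A B F \<longleftrightarrow>
    simplicial_category A \<and> simplicial_category B \<and>
    fobj F \<in> objs A \<rightarrow> objs B \<and>
    (\<forall>a\<in>objs A. \<forall>b\<in>objs A. sset_map (shom A a b) (shom B (fobj F a) (fobj F b)) (fhom F a b)) \<and>
    (\<forall>a\<in>objs A. fhom F a a 0 (sid A a) = sid B (fobj F a)) \<and>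
    (\<forall>a\<in>objs A. \<forall>b\<in>objs A. \<forall>c\<in>objs A. \<forall>n.
      \<forall>f\<in>simplices (shom A a b) n. \<forall>g\<in>simplices (shom A b c) n.
        fhom F a c n (scomp A a b c n f g) =
        scomp B (fobj F a) (fobj F b) (fobj F c) n (fhom F a b n f) (fhom F b c n g))"

definition local_functor ::
  "'u sset_class \<Rightarrow> ('o, 'u) scat \<Rightarrow> ('p, 'u) scat \<Rightarrow> ('o, 'u, 'p, 'u) sfun \<Rightarrow> bool" where
  "local_functor R A B F \<longleftrightarrow>
    simplicial_functor A B F \<and>
    (\<forall>a\<in>objs A. \<forall>b\<in>objs A. (shom A a b, shom B (fobj F a) (fobj F b), fhom F a b) \<in> R)"

text \<open>Equality of the composites \<open>G \<circ> F\<close> and \<open>G' \<circ> F'\<close> of functors with common domain \<open>A\<close>.\<close>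

definition comp_eq ::
  "('o, 'u) scat \<Rightarrow> ('p, 'w, 'r, 'y) sfun \<Rightarrow> ('o, 'u, 'p, 'w) sfun \<Rightarrow>
    ('q, 'x, 'r, 'y) sfun \<Rightarrow> ('o, 'u, 'q, 'x) sfun \<Rightarrow> bool" where
  "comp_eq A G F G' F' \<longleftrightarrow>
    (\<forall>a\<in>objs A. fobj G (fobj F a) = fobj G' (fobj F' a)) \<and>
    (\<forall>a\<in>objs A. \<forall>b\<in>objs A. \<forall>n. \<forall>f\<in>simplices (shom A a b) n.
      fhom G (fobj F a) (fobj F b) n (fhom F a b n f) =
      fhom G' (fobj F' a) (fobj F' b) n (fhom F' a b n f))"

definition sfun_id :: "('o, 'u) scat \<Rightarrow> ('o, 'u, 'o, 'u) sfun" where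
  "sfun_id A = \<lparr>fobj = (\<lambda>a. a), fhom = (\<lambda>a b. sset_incl (shom A a b))\<rparr>"

text \<open>The functor \<open>I : C \<rightarrow> D\<close> has the left lifting property against \<open>F : A \<rightarrow> B\<close>.\<close>

definition scat_llp ::
  "('c, 'k) scat \<Rightarrow> ('d, 'l) scat \<Rightarrow> ('c, 'k, 'd, 'l) sfun \<Rightarrow>
    ('o, 'u) scat \<Rightarrow> ('p, 'w) scat \<Rightarrow> ('o, 'u, 'p, 'w) sfun \<Rightarrow> bool" where
  "scat_llp C D I A B F \<longleftrightarrow>
    (\<forall>U V. simplicial_functor C A U \<longrightarrow> simplicial_functor D B V \<longrightarrow> comp_eq C F U V I \<longrightarrow>
      (\<exists>H. simplicial_functor D A H \<and>
        comp_eq C H I U (sfun_id C) \<and> comp_eq D F H V (sfun_id D)))"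


section \<open>Plane graphs\<close>

text \<open>A finite connected plane graph is encoded by its rotation system. A dart \<open>(e, True)\<close> is the
  edge \<open>e\<close> traversed from tail to head, \<open>(e, False)\<close> is \<open>e\<close> traversed backwards. \<open>rot\<close> sends a dart
  to the next dart with the same origin in counterclockwise order. A face is represented by the
  set of darts that have it on their right-hand side; \<open>ext\<close> is the exterior face.\<close>

type_synonym 'e dart = "'e \<times> bool"

record ('v, 'e) plane =
  ug :: "('v, 'e) pre_digraph"
  rot :: "'e dart \<Rightarrow> 'e dart"
  ext :: "'e dart set"

definition darts :: "('v, 'e) pre_digraph \<Rightarrow> 'e dart set" where
  "darts G = arcs G \<times> UNIV"

definition origin :: "('v, 'e) pre_digraph \<Rightarrow> 'e dart \<Rightarrow> 'v" where
  "origin G d = (if snd d then tail G (fst d) else head G (fst d))"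

definition rev_dart :: "'e dart \<Rightarrow> 'e dart" where
  "rev_dart d = (fst d, \<not> snd d)"

text \<open>Arriving at the end of a dart \<open>d\<close>, the boundary of the face to the right of \<open>d\<close> continues with
  the dart that follows the reverse of \<open>d\<close> in counterclockwise order. So an orbit runs clockwise
  around an interior face.\<close>

definition face_next :: "('v, 'e) plane \<Rightarrow> 'e dart \<Rightarrow> 'e dart" where
  "face_next K d = rot K (rev_dart d)"

text \<open>The only face of a single vertex has empty boundary.\<close>

definition faces :: "('v, 'e) plane \<Rightarrow> 'e dart set set" where
  "faces K = (if arcs (ug K) = {} then {{}} else orbit (face_next K) ` darts (ug K))"

text \<open>Among the connected rotation systems, the ones of plane graphs are those of genus 0,
  as expressed by Euler's formula.\<close>

definition plane_graph :: "('v, 'e) plane \<Rightarrow> bool" where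
  "plane_graph K \<longleftrightarrow>
    fin_digraph (ug K) \<and> connected (ug K) \<and>
    (\<forall>v\<in>verts (ug K). let D = {d \<in> darts (ug K). origin (ug K) d = v} in
      D = {} \<or> cyclic_on (rot K) D) \<and>
    ext K \<in> faces K \<and>
    int (card (verts (ug K))) - int (card (arcs (ug K))) + int (card (faces K)) = 2"

text \<open>The embedding of a subgraph \<open>H\<close> induced by that of \<open>G\<close>. Removing an edge merges the faces
  on its two sides, so a dart of \<open>H\<close> has the exterior face of \<open>H\<close> on its right iff the face of
  \<open>G\<close> on its right is connected to the exterior face of \<open>G\<close> by crossing edges outside \<open>H\<close>.\<close>

definition merge_step :: "('v, 'e) plane \<Rightarrow> ('v, 'e) pre_digraph \<Rightarrow> ('e dart \<times> 'e dart) set" where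
  "merge_step G H = {(d, face_next G d) | d. d \<in> darts (ug G)} \<union>
    {(d, rev_dart d) | d. d \<in> darts (ug G) - darts H}"

definition induced :: "('v, 'e) plane \<Rightarrow> ('v, 'e) pre_digraph \<Rightarrow> ('v, 'e) plane" where
  "induced G H =
    \<lparr>ug = H,
     rot = (\<lambda>d. (rot G ^^ (LEAST n. 0 < n \<and> (rot G ^^ n) d \<in> darts H)) d),
     ext = darts H \<inter> (merge_step G H)\<^sup>* `` ext G\<rparr>"


section \<open>Globular graphs\<close>

text \<open>A directed path is given by its first vertex and its list of edges.\<close>

abbreviation dpath :: "('v, 'e) pre_digraph \<Rightarrow> 'v \<Rightarrow> 'e list \<Rightarrow> 'v \<Rightarrow> bool" where
  "dpath G \<equiv> pre_digraph.apath G"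

definition is_source :: "('v, 'e) pre_digraph \<Rightarrow> 'v \<Rightarrow> bool" where
  "is_source G v \<longleftrightarrow> v \<in> verts G \<and> (\<forall>w\<in>verts G. \<exists>p. dpath G v p w)"

definition is_target :: "('v, 'e) pre_digraph \<Rightarrow> 'v \<Rightarrow> bool" where
  "is_target G v \<longleftrightarrow> v \<in> verts G \<and> (\<forall>w\<in>verts G. \<exists>p. dpath G w p v)"

definition src :: "('v, 'e) pre_digraph \<Rightarrow> 'v" where
  "src G = (THE v. is_source G v)"

definition tgt :: "('v, 'e) pre_digraph \<Rightarrow> 'v" where
  "tgt G = (THE v. is_target G v)"

definition incident_exterior :: "('v, 'e) plane \<Rightarrow> 'v \<Rightarrow> bool" where
  "incident_exterior K v \<longleftrightarrow> (\<exists>d\<in>ext K. origin (ug K) d = v)"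

definition st_graph :: "('v, 'e) plane \<Rightarrow> bool" where
  "st_graph K \<longleftrightarrow>
    (\<exists>!v. is_source (ug K) v) \<and> (\<exists>!v. is_target (ug K) v) \<and>
    incident_exterior K (src (ug K)) \<and> incident_exterior K (tgt (ug K))"

definition path_darts :: "'e list \<Rightarrow> 'e dart list" where
  "path_darts p = map (\<lambda>e. (e, True)) p"

definition op_path_darts :: "'e list \<Rightarrow> 'e dart list" where
  "op_path_darts p = rev (map (\<lambda>e. (e, False)) p)"

text \<open>The clockwise oriented boundary of the face \<open>A\<close> is the cyclic sequence \<open>ds\<close>. For the exterior
  face this is the boundary orientation with the face on the right as well, so \<open>ds\<close> runs
  counterclockwise around the graph.\<close>

definition face_boundary :: "('v, 'e) plane \<Rightarrow> 'e dart set \<Rightarrow> 'e dart list \<Rightarrow> bool" where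
  "face_boundary K A ds \<longleftrightarrow>
    set ds = A \<and> distinct ds \<and>
    (\<forall>i<length ds. face_next K (ds ! i) = ds ! (Suc i mod length ds))"

definition globular_face ::
  "('v, 'e) plane \<Rightarrow> 'e dart set \<Rightarrow> 'e list \<Rightarrow> 'e list \<Rightarrow> bool" where
  "globular_face K A p q \<longleftrightarrow>
    p \<noteq> [] \<and> q \<noteq> [] \<and>
    (\<exists>u v. dpath (ug K) u p v \<and> dpath (ug K) u q v) \<and>
    face_boundary K A (path_darts p @ op_path_darts q)"

text \<open>The conditions on an embedded graph; planarity of the embedding is added in
  \<open>globular_graph\<close>, and is automatic for embeddings induced by that of a plane graph.\<close>

definition globular :: "('v, 'e) plane \<Rightarrow> bool" where
  "globular K \<longleftrightarrow>
    (\<exists>v. verts (ug K) = {v} \<and> arcs (ug K) = {}) \<or>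
    (st_graph K \<and> (\<forall>A\<in>faces K. \<exists>p q. globular_face K A p q))"

definition globular_graph :: "('v, 'e) plane \<Rightarrow> bool" where
  "globular_graph G \<longleftrightarrow> plane_graph G \<and> globular G"

text \<open>\<open>dom_cod K p q\<close>: the paths \<open>p\<close> and \<open>q\<close> are the domain and the codomain of the globular graph
  \<open>K\<close>. Note that the roles of domain and codomain are swapped for the exterior face.\<close>

definition dom_cod :: "('v, 'e) plane \<Rightarrow> 'e list \<Rightarrow> 'e list \<Rightarrow> bool" where
  "dom_cod K p q \<longleftrightarrow>
    (if arcs (ug K) = {} then p = [] \<and> q = [] else globular_face K (ext K) q p)"

text \<open>From here on \<open>G\<close> is the ambient plane graph, and all other graphs are subgraphs of it.\<close>

definition globular_sub :: "('v, 'e) plane \<Rightarrow> ('v, 'e) pre_digraph \<Rightarrow> bool" where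
  "globular_sub G H \<longleftrightarrow> subgraph H (ug G) \<and> globular (induced G H)"

definition wide :: "('v, 'e) pre_digraph \<Rightarrow> ('v, 'e) pre_digraph \<Rightarrow> bool" where
  "wide A H \<longleftrightarrow> src A = src H \<and> tgt A = tgt H"

definition path_graph :: "('v, 'e) pre_digraph \<Rightarrow> 'v \<Rightarrow> 'e list \<Rightarrow> ('v, 'e) pre_digraph" where
  "path_graph G u p =
    \<lparr>verts = set (pre_digraph.awalk_verts G u p), arcs = set p, tail = tail G, head = head G\<rparr>"

definition path_graphs :: "('v, 'e) pre_digraph \<Rightarrow> ('v, 'e) pre_digraph set" where
  "path_graphs G = {path_graph G u p | u p v. dpath G u p v}"

definition between :: "('v, 'e) pre_digraph \<Rightarrow> 'v \<Rightarrow> 'v \<Rightarrow> ('v, 'e) pre_digraph" where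
  "between G x y = pre_digraph.Union G {path_graph G x p | p. dpath G x p y}"


section \<open>The nerve of a globular graph\<close>

definition glob :: "('v, 'e) plane \<Rightarrow> ('v, 'e) pre_digraph \<Rightarrow> bool" where
  "glob G \<gamma> \<longleftrightarrow>
    globular_sub G \<gamma> \<and>
    (\<forall>e\<in>arcs \<gamma>. (e, True) \<in> ext (induced G \<gamma>) \<or> (e, False) \<in> ext (induced G \<gamma>))"

definition st_paths :: "('v, 'e) pre_digraph \<Rightarrow> 'e list set" where
  "st_paths H = {p. dpath H (src H) p (tgt H)}"

text \<open>\<open>\<gamma>\<close> is a witness for \<open>p \<le> q\<close> in the poset of paths of \<open>H\<close> from source to target. The vertices
  \<open>u\<close> and \<open>v\<close> are the source and the target of \<open>\<gamma>\<close>.\<close>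

definition witness ::
  "('v, 'e) plane \<Rightarrow> ('v, 'e) pre_digraph \<Rightarrow> 'e list \<Rightarrow> 'e list \<Rightarrow> ('v, 'e) pre_digraph \<Rightarrow> bool" where
  "witness G H p q \<gamma> \<longleftrightarrow>
    glob G \<gamma> \<and> subgraph \<gamma> H \<and>
    (\<exists>a b c d u v.
      dpath H (src H) a u \<and> dpath \<gamma> u c v \<and> dpath \<gamma> u d v \<and> dpath H v b (tgt H) \<and>
      dom_cod (induced G \<gamma>) c d \<and>
      p = a @ c @ b \<and> q = a @ d @ b)"

definition path_le ::
  "('v, 'e) plane \<Rightarrow> ('v, 'e) pre_digraph \<Rightarrow> 'e list \<Rightarrow> 'e list \<Rightarrow> bool" where
  "path_le G H p q \<longleftrightarrow> (\<exists>\<gamma>. witness G H p q \<gamma>)"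

definition graph_nerve ::
  "('v, 'e) plane \<Rightarrow> ('v, 'e) pre_digraph \<Rightarrow> 'e list list sset" where
  "graph_nerve G H = nerve (st_paths H) (path_le G H)"


section \<open>Pasting diagrams\<close>

type_synonym ('v, 'e) pdiag = "('v, 'e) pre_digraph \<times> ('v, 'e) pre_digraph set"

definition pasting_diagram :: "('v, 'e) plane \<Rightarrow> ('v, 'e) pdiag \<Rightarrow> bool" where
  "pasting_diagram G = (\<lambda>(H, S).
    globular_sub G H \<and>
    (\<forall>A\<in>S. globular_sub G A \<and> subgraph A H) \<and>
    path_graphs H \<subseteq> S \<and>
    (\<forall>A\<in>S. \<forall>B. globular_sub G B \<longrightarrow> subgraph B A \<longrightarrow> B \<in> S))"

definition complete_diagram :: "('v, 'e) plane \<Rightarrow> ('v, 'e) pdiag \<Rightarrow> bool" where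
  "complete_diagram G = (\<lambda>(H, S).
    pasting_diagram G (H, S) \<and>
    (\<forall>A\<in>S. \<forall>B\<in>S. tgt A = src B \<longrightarrow> union A B \<in> S))"

definition restriction :: "('v, 'e) pdiag \<Rightarrow> 'v \<Rightarrow> 'v \<Rightarrow> ('v, 'e) pdiag" where
  "restriction = (\<lambda>(H, S) x y. (between H x y, {A \<in> S. subgraph A (between H x y)}))"

text \<open>If \<open>H\<close> is empty, there are no paths in \<open>H\<close> and the nerve is empty, as required.\<close>

definition diagram_nerve :: "('v, 'e) plane \<Rightarrow> ('v, 'e) pdiag \<Rightarrow> 'e list list sset" where
  "diagram_nerve G = (\<lambda>(H, S).
    \<lparr>simplices = (\<lambda>n. {ps \<in> simplices (graph_nerve G H) n.
       \<exists>A\<in>S. \<forall>i<n. \<exists>\<gamma>. witness G H (ps ! i) (ps ! Suc i) \<gamma> \<and> subgraph \<gamma> A}),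
     act = act (graph_nerve G H)\<rparr>)"

text \<open>The set written \<open>T\<^sub>s\<^sub>,\<^sub>x \<or> T\<^sub>x\<^sub>,\<^sub>t\<close> on paper, where \<open>s\<close> and \<open>t\<close> are source and target of \<open>H\<close>.\<close>

definition joins_at ::
  "('v, 'e) plane \<Rightarrow> ('v, 'e) pdiag \<Rightarrow> 'v \<Rightarrow> ('v, 'e) pre_digraph set" where
  "joins_at G = (\<lambda>(H, T) x.
    let (Hl, Tl) = restriction (H, T) (src H) x; (Hr, Tr) = restriction (H, T) x (tgt H) in
    path_graphs (union Hl Hr) \<union>
    {C. globular_sub G C \<and>
      (\<exists>A\<in>Tl. \<exists>B\<in>Tr. wide A Hl \<and> wide B Hr \<and> subgraph C (union A B))})"

text \<open>Both arguments are diagrams on the same graph.\<close>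

definition odot ::
  "('v, 'e) plane \<Rightarrow> ('v, 'e) pdiag \<Rightarrow> ('v, 'e) pdiag \<Rightarrow> ('v, 'e) pdiag" where
  "odot G = (\<lambda>(H, S) (_, T).
    (H, S \<union> (\<Union>x \<in> verts H - {src H, tgt H}. joins_at G (H, T) x)))"

text \<open>The simplicial category of a complete diagram. The identity at a vertex is the \<open>0\<close>-simplex
  consisting of the trivial path, whose list of edges is empty.\<close>

definition CC :: "('v, 'e) plane \<Rightarrow> ('v, 'e) pdiag \<Rightarrow> ('v, 'e list list) scat" where
  "CC G \<Sigma> =
    \<lparr>objs = verts (fst \<Sigma>),
     shom = (\<lambda>x y. diagram_nerve G (restriction \<Sigma> x y)),
     sid = (\<lambda>x. [[]]),
     scomp = (\<lambda>x y z n ps qs. map2 (@) ps qs)\<rparr>"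

definition CC_incl ::
  "('v, 'e) plane \<Rightarrow> ('v, 'e) pdiag \<Rightarrow> ('v, 'e list list, 'v, 'e list list) sfun" where
  "CC_incl G \<Sigma> = sfun_id (CC G \<Sigma>)"

end

theory Submission
  imports Defs
begin

text \<open>
  Both conditions are about extending maps from \<open>N(\<Sigma>\<^sub>x\<^sub>y \<odot> \<Pi>\<^sub>x\<^sub>y)\<close> to \<open>N(\<Pi>\<^sub>x\<^sub>y)\<close>. The simplices of the former
  are the simplices of \<open>N(\<Sigma>\<^sub>x\<^sub>y)\<close> and the composites of simplices of \<open>N(\<Pi>\<^sub>x\<^sub>z)\<close> and \<open>N(\<Pi>\<^sub>z\<^sub>y)\<close> for vertices \<open>z\<close>
  strictly between \<open>x\<close> and \<open>y\<close> (lemma \<open>odot_nerve\<close>); these are the simplices on which a lift of functors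
  has no freedom once it is known on shorter mapping spaces.

  If the maps of nerves have the lifting property, then a lift of a functor is built by induction on the
  distance from \<open>x\<close> to \<open>y\<close>. The values forced by the given functor on \<open>\<Sigma>\<close> and by compatibility with
  composition form a simplicial map on \<open>N(\<Sigma>\<^sub>x\<^sub>y \<odot> \<Pi>\<^sub>x\<^sub>y)\<close>: when a chain of paths splits at two vertices,
  these are comparable, and associativity shows that both splittings force the same value
  (\<open>forced_unique\<close>, \<open>lift_functor\<close>). Conversely, a lifting problem for the map of nerves at \<open>x\<close> and \<open>y\<close>
  becomes a lifting problem for categories if the mapping space from \<open>x\<close> to \<open>y\<close> is replaced by a prescribed
  simplicial set, the mapping spaces that enclose it are replaced by points, and all others are kept
  (locale \<open>prescribed\<close>, lemma \<open>mapping_space_llp\<close>).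

  This presupposes that nerves of complete diagrams are simplicial sets and that paths compose, which is a
  matter of plane topology. Completeness excludes nontrivial closed walks (\<open>complete_diagram_acyclic\<close>). In an acyclic
  graph, every nonempty union \<open>H\<close> of paths from \<open>x\<close> to \<open>y\<close> is globular: each pair of consecutive edge ends around a
  vertex is a change of direction either at the vertex or along the face, every inner vertex and every
  face has at least two changes, and by Euler's formula these numbers are exhausted, so that every face
  has exactly two (\<open>two_switches\<close>). Euler's formula passes from \<open>G\<close> to \<open>H\<close> by counting cycles modulo \<open>2\<close>:
  the cycles of \<open>H\<close> bound sets of faces of \<open>G\<close> (\<open>cycles_bound\<close>), and these are unions of the faces merged
  in \<open>H\<close> (\<open>euler_subgraph\<close>).

  The relation \<open>p \<le> q\<close> is expressed by nonnegative winding numbers (\<open>left_of\<close>), which add up; so it is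
  transitive and compatible with concatenation, and the union of \<open>p\<close> and \<open>q\<close> itself is a witness
  (\<open>left_of_witness\<close>). For a complete diagram \<open>\<Sigma> = (G, S)\<close>, a chain of paths has witnesses in a common
  member of \<open>S\<close> if and only if the union of its paths belongs to \<open>S\<close> (\<open>S_paths_union\<close>,
  \<open>diagram_nerve_restriction\<close>). In this form, the nerves are manifestly closed under all simplicial
  operators and under composition; that chains can be cut at common vertices follows from \<open>left_of_parts\<close>.
\<close>

section \<open>Cyclic permutations\<close>

text \<open>An injective self-map of a finite orbit is onto, so the orbit, which starts with \<open>f x\<close>, returns to \<open>x\<close>.\<close>

lemma orbit_self:
  assumes "bij_betw f D D" "finite D" "x \<in> D"
  shows "x \<in> orbit f x" "orbit f x \<subseteq> D"
proof -
  show sub: "orbit f x \<subseteq> D"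
  proof
    fix y assume "y \<in> orbit f x"
    then show "y \<in> D"
      by induction (use assms in \<open>auto simp: bij_betw_def\<close>)
  qed
  have "f ` orbit f x = orbit f x"
  proof (rule endo_inj_surj)
    show "finite (orbit f x)" using sub assms(2) by (rule finite_subset)
    show "f ` orbit f x \<subseteq> orbit f x" by (auto intro: orbit.step)
    show "inj_on f (orbit f x)" using sub assms(1) by (auto simp: bij_betw_def intro: inj_on_subset)
  qed
  then obtain y where y: "y \<in> orbit f x" "f x = f y"
    using orbit.base[of f x] by (metis imageE)
  then have "x = y" using assms sub by (auto simp: bij_betw_def inj_on_def)
  then show "x \<in> orbit f x" using y by simp
qed

lemma cyclic_on_orbit_bij:
  assumes "bij_betw f D D" "finite D" "x \<in> D"
  shows "cyclic_on f (orbit f x)"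
  using orbit_self[OF assms] unfolding cyclic_on_def by blast

lemma cyclic_on_invariant:
  assumes "cyclic_on f A" "a \<in> A" "P a" "\<And>x. x \<in> A \<Longrightarrow> P x \<Longrightarrow> P (f x)" "b \<in> A"
  shows "P b"
proof -
  have "b \<in> orbit f a" using assms orbit_cyclic_eq3 by fast
  then have "b \<in> A \<and> P b"
    by induction (use assms cyclic_on_inI in \<open>fast+\<close>)
  then show ?thesis ..
qed

lemma cyclic_on_bij:
  assumes "cyclic_on f A"
  shows "bij_betw f A A"
proof -
  have fin: "finite A" using finite_cyclic_on[OF assms] .
  have "A \<subseteq> f ` A"
  proof
    fix x assume x: "x \<in> A"
    then have "x \<in> orbit f x" using assms by (auto simp: cyclic_on_alldef)
    then show "x \<in> f ` A"
      by cases (use x assms orbit_cyclic_eq3 in \<open>fast+\<close>)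
  qed
  then have "f ` A = A" using assms by (auto intro: cyclic_on_inI)
  then show ?thesis using fin by (simp add: bij_betw_def eq_card_imp_inj_on)
qed

text \<open>A property that is never lost along a cycle spreads to the whole cycle; likewise for its negation.\<close>

lemma cyclic_on_ascent_descent:
  assumes "cyclic_on f A" "a \<in> A" "P a" "b \<in> A" "\<not> P b"
  obtains c d where "c \<in> A" "P c" "\<not> P (f c)" "d \<in> A" "\<not> P d" "P (f d)"
  using cyclic_on_invariant[of f A a P b] cyclic_on_invariant[of f A b "\<lambda>x. \<not> P x" a] assms by blast

lemma cyclic_on_switches:
  assumes "cyclic_on f A" "a \<in> A" "P a" "b \<in> A" "\<not> P b"
  shows "2 \<le> card {x \<in> A. P x \<noteq> P (f x)}"
proof -
  obtain c d where cd: "c \<in> A" "P c" "\<not> P (f c)" "d \<in> A" "\<not> P d" "P (f d)"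
    using cyclic_on_ascent_descent[OF assms] .
  then have "card {c, d} \<le> card {x \<in> A. P x \<noteq> P (f x)}"
    by (intro card_mono) (use finite_cyclic_on[OF assms(1)] in auto)
  moreover have "card {c, d} = 2" using cd by (auto simp: card_insert_if)
  ultimately show ?thesis by simp
qed

text \<open>The cycle is read from the place where the property is regained. Once it is lost again, it could
  return only by a third change.\<close>

lemma cyclic_on_two_switches:
  assumes cyc: "cyclic_on f A" and a: "a \<in> A" "P a" and b: "b \<in> A" "\<not> P b"
    and two: "card {x \<in> A. P x \<noteq> P (f x)} = 2"
  obtains xs ys where "xs \<noteq> []" "ys \<noteq> []" "set (xs @ ys) = A" "distinct (xs @ ys)"
    "\<forall>i<length (xs @ ys). f ((xs @ ys) ! i) = (xs @ ys) ! (Suc i mod length (xs @ ys))"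
    "\<forall>x\<in>set xs. P x" "\<forall>y\<in>set ys. \<not> P y"
proof -
  obtain c d where cd: "c \<in> A" "P c" "\<not> P (f c)" "d \<in> A" "\<not> P d" "P (f d)"
    using cyclic_on_ascent_descent[OF cyc a b] .
  have fin: "finite {x \<in> A. P x \<noteq> P (f x)}" using finite_cyclic_on[OF cyc] by simp
  have uniq: "x = d" if x: "x \<in> A" "\<not> P x" "P (f x)" for x
  proof (rule ccontr)
    assume "x \<noteq> d"
    then have "card {c, d, x} = 3" using cd x by (auto simp: card_insert_if)
    moreover have "card {c, d, x} \<le> 2" unfolding two[symmetric] by (rule card_mono[OF fin]) (use cd x in blast)
    ultimately show False by simp
  qed
  define n where "n = funpow_dist1 f d d"
  have self: "d \<in> orbit f d" and A: "A = orbit f d" using cyc cd by (auto simp: cyclic_on_alldef)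
  have n: "n > 0" "(f ^^ n) d = d" using funpow_dist1_prop[OF self] by (auto simp: n_def)
  have inj: "inj_on (\<lambda>i. (f ^^ i) d) {0..<n}" using inj_on_funpow_dist1[OF self] by (simp add: n_def)
  have img: "A = (\<lambda>i. (f ^^ i) d) ` {0..<n}"
    using orbit_conv_funpow_dist1[OF self] A by (simp add: n_def)
  define zs where "zs = map (\<lambda>i. (f ^^ Suc i) d) [0..<n]"
  have len: "length zs = n" by (simp add: zs_def)
  have nth: "zs ! i = (f ^^ Suc i) d" if "i < n" for i using that by (simp add: zs_def)
  have nth': "zs ! i = (f ^^ (Suc i mod n)) d" if "i < n" for i
    using that n nth[OF that] by (cases "Suc i = n") auto
  have dist: "distinct zs"
  proof -
    have "i = j" if "i < n" "j < n" "zs ! i = zs ! j" for i j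
    proof -
      have "Suc i mod n = Suc j mod n"
        using inj that nth' n by (auto simp: inj_on_def)
      then show "i = j" using that by (metis mod_Suc Suc_inject Zero_not_Suc mod_less)
    qed
    then show ?thesis using len by (auto simp: distinct_conv_nth)
  qed
  have set: "set zs = A"
  proof -
    have "set zs \<subseteq> A" using A nth len self by (auto simp: in_set_conv_nth intro!: orbit.step funpow_in_orbit)
    moreover have "card (set zs) = card A" using distinct_card[OF dist] len img card_image[OF inj] by simp
    ultimately show ?thesis using card_subset_eq finite_cyclic_on[OF cyc] by metis
  qed
  have succ: "f (zs ! i) = zs ! (Suc i mod n)" if "i < n" for i
    using that n nth[OF that] nth[of "Suc i mod n"] by (cases "Suc i = n") auto
  have inA: "zs ! i \<in> A" if "i < n" for i using that set len by force
  have last: "zs ! (n - 1) = d" using n nth[of "n - 1"] by simp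
  define k where "k = (LEAST i. i < n \<and> \<not> P (zs ! i))"
  have k: "k < n" "\<not> P (zs ! k)"
    using LeastI[of "\<lambda>i. i < n \<and> \<not> P (zs ! i)" "n - 1"] last n cd by (auto simp: k_def)
  have before: "P (zs ! i)" if "i < k" for i
    using not_less_Least[of i "\<lambda>i. i < n \<and> \<not> P (zs ! i)"] that k by (auto simp: k_def)
  have after: "k \<le> i \<Longrightarrow> i < n \<Longrightarrow> \<not> P (zs ! i)" for i
  proof (induction i rule: dec_induct)
    case base then show ?case using k by simp
  next
    case (step i)
    then have i: "i < n" "\<not> P (zs ! i)" "f (zs ! i) = zs ! Suc i" using succ[of i] by auto
    show ?case
    proof
      assume "P (zs ! Suc i)"
      then have "zs ! i = zs ! (n - 1)" using uniq inA i last by auto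
      then show False using dist len i step.prems by (auto simp: nth_eq_iff_index_eq)
    qed
  qed
  have k0: "k \<noteq> 0"
  proof
    assume "k = 0"
    then show False using k cd nth[of 0] n by simp
  qed
  show ?thesis
  proof (rule that[of "take k zs" "drop k zs"])
    show "\<forall>x\<in>set (take k zs). P x" using before len by (auto simp: in_set_conv_nth)
    show "\<forall>x\<in>set (drop k zs). \<not> P x" using after len by (auto simp: in_set_conv_nth)
    show "take k zs \<noteq> []" "drop k zs \<noteq> []" using k(1) k0 len n(1) by auto
    show "set (take k zs @ drop k zs) = A" "distinct (take k zs @ drop k zs)" using set dist by simp_all
    show "\<forall>i<length (take k zs @ drop k zs). f ((take k zs @ drop k zs) ! i)
        = (take k zs @ drop k zs) ! (Suc i mod length (take k zs @ drop k zs))"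
      unfolding append_take_drop_id len using succ by blast
  qed
qed

text \<open>The first return map is what remains of a cyclic order when elements are deleted. The rotations of an
  induced embedding are of this form.\<close>

lemma cyclic_on_first_return:
  assumes cyc: "cyclic_on f A" and B: "B \<subseteq> A" "B \<noteq> {}"
  shows "cyclic_on (\<lambda>x. (f ^^ (LEAST n. 0 < n \<and> (f ^^ n) x \<in> B)) x) B"
proof -
  define g where "g = (\<lambda>x. (f ^^ (LEAST n. 0 < n \<and> (f ^^ n) x \<in> B)) x)"
  have ret: "\<exists>n. 0 < n \<and> (f ^^ n) x = y" if "x \<in> B" "y \<in> B" for x y
  proof -
    have "y \<in> orbit f x" using that B cyc by (auto simp: cyclic_on_alldef)
    then show ?thesis by (auto simp: orbit_altdef)
  qed
  have gB: "g x \<in> B" if "x \<in> B" for x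
  proof -
    have "\<exists>n. 0 < n \<and> (f ^^ n) x \<in> B" using ret[OF that that] that by auto
    from LeastI_ex[OF this] show ?thesis unfolding g_def by simp
  qed
  have reach: "(f ^^ n) x \<in> orbit g x" if "0 < n" "x \<in> B" "(f ^^ n) x \<in> B" for n x
    using that
  proof (induction n arbitrary: x rule: less_induct)
    case (less n)
    define m where "m = (LEAST n. 0 < n \<and> (f ^^ n) x \<in> B)"
    have m: "0 < m" "m \<le> n" "g x = (f ^^ m) x"
      using LeastI[of "\<lambda>n. 0 < n \<and> (f ^^ n) x \<in> B" n] Least_le[of "\<lambda>n. 0 < n \<and> (f ^^ n) x \<in> B" n] less.prems
      by (auto simp: m_def g_def)
    show ?case
    proof (cases "m = n")
      case True
      then show ?thesis using m orbit.base[of g x] by simp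
    next
      case False
      have "(f ^^ n) x = (f ^^ (n - m)) (g x)"
        using m funpow_add[of "n - m" m f] by simp
      moreover have "(f ^^ (n - m)) (g x) \<in> orbit g (g x)"
        using less.IH[of "n - m" "g x"] False m(1,2) less.prems gB[OF less.prems(2)] calculation by simp
      ultimately show ?thesis by (simp add: orbit_subset)
    qed
  qed
  have "orbit g x = B" if x: "x \<in> B" for x
  proof
    show "orbit g x \<subseteq> B"
    proof
      fix y assume "y \<in> orbit g x" then show "y \<in> B" by induction (use x gB in auto)
    qed
    show "B \<subseteq> orbit g x"
    proof
      fix y assume y: "y \<in> B"
      then obtain n where "0 < n" "(f ^^ n) x = y" using ret[OF x] by blast
      then show "y \<in> orbit g x" using reach[of n x] x y by simp
    qed
  qed
  then show ?thesis using B(2) by (auto simp: cyclic_on_alldef simp flip: g_def)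
qed

section \<open>Rotation systems\<close>

text \<open>Darts are pairs; quantifiers over them are better left alone by the simplifier.\<close>

declare split_paired_All [simp del] split_paired_Ex [simp del]

lemma rev_dart_simps [simp]:
  "rev_dart (rev_dart d) = d" "fst (rev_dart d) = fst d" "snd (rev_dart d) = (\<not> snd d)"
  "rev_dart (e, b) = (e, \<not> b)"
  by (simp_all add: rev_dart_def)

lemma in_darts [simp]: "d \<in> darts H \<longleftrightarrow> fst d \<in> arcs H"
  by (cases d) (simp add: darts_def)

lemma finite_darts: "finite (arcs H) \<Longrightarrow> finite (darts H)"
  by (simp add: darts_def)

lemma card_darts: "finite (arcs H) \<Longrightarrow> card (darts H) = 2 * card (arcs H)"
  by (simp add: darts_def card_cartesian_product)

locale rotation_system =
  fixes K :: "('v, 'e) plane"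
  assumes fin: "fin_digraph (ug K)"
    and cyc: "\<And>v. {d \<in> darts (ug K). origin (ug K) d = v} \<noteq> {} \<Longrightarrow>
      cyclic_on (rot K) {d \<in> darts (ug K). origin (ug K) d = v}"
begin

sublocale fin_digraph "ug K" by (rule fin)

abbreviation "D \<equiv> darts (ug K)"

definition darts_at :: "'v \<Rightarrow> 'e dart set" where
  "darts_at v = {d \<in> D. origin (ug K) d = v}"

lemma finite_D: "finite D"
  by (simp add: finite_darts)

lemma origin_in_verts: "d \<in> D \<Longrightarrow> origin (ug K) d \<in> verts (ug K)"
  by (auto simp: origin_def)

lemma cyclic_darts_at: "d \<in> D \<Longrightarrow> cyclic_on (rot K) (darts_at (origin (ug K) d))"
  unfolding darts_at_def by (rule cyc) auto

lemma rot_in: "d \<in> D \<Longrightarrow> rot K d \<in> D"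
  and origin_rot: "d \<in> D \<Longrightarrow> origin (ug K) (rot K d) = origin (ug K) d"
  using cyclic_on_inI[OF cyclic_darts_at, of d d] by (auto simp: darts_at_def)

lemma bij_rot: "bij_betw (rot K) D D"
  unfolding bij_betw_def
proof
  show inj: "inj_on (rot K) D"
  proof (rule inj_onI)
    fix d d' assume d: "d \<in> D" "d' \<in> D" "rot K d = rot K d'"
    then have "origin (ug K) d = origin (ug K) d'" using origin_rot by metis
    then show "d = d'"
      using d cyclic_on_bij[OF cyclic_darts_at[OF d(1)]]
      by (auto simp: bij_betw_def inj_on_def darts_at_def)
  qed
  show "rot K ` D = D"
    by (rule endo_inj_surj[OF finite_D _ inj]) (use rot_in in blast)
qed

lemma bij_rev: "bij_betw rev_dart D D"
  by (rule bij_betwI[where g = rev_dart]) auto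

lemma bij_face_next: "bij_betw (face_next K) D D"
  using bij_betw_trans[OF bij_rev bij_rot] by (simp add: face_next_def comp_def cong: bij_betw_cong)

lemma face_next_in: "d \<in> D \<Longrightarrow> face_next K d \<in> D"
  using bij_face_next by (auto simp: bij_betw_def)

lemma origin_face_next: "d \<in> D \<Longrightarrow> origin (ug K) (face_next K d) = origin (ug K) (rev_dart d)"
  by (simp add: face_next_def origin_rot)

lemma rot_conv_face_next: "rot K d = face_next K (rev_dart d)"
  by (simp add: face_next_def)

lemma faces_nonempty: "arcs (ug K) \<noteq> {} \<Longrightarrow> faces K = orbit (face_next K) ` D"
  by (simp add: faces_def)

lemma face_cyclic: "arcs (ug K) \<noteq> {} \<Longrightarrow> A \<in> faces K \<Longrightarrow> cyclic_on (face_next K) A"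
  using cyclic_on_orbit_bij[OF bij_face_next finite_D] by (auto simp: faces_nonempty)

lemma face_subset: "A \<in> faces K \<Longrightarrow> A \<subseteq> D"
  using orbit_self(2)[OF bij_face_next finite_D] by (force simp: faces_def split: if_splits)

lemma faces_disjoint:
  assumes "arcs (ug K) \<noteq> {}" "A \<in> faces K" "B \<in> faces K" "d \<in> A" "d \<in> B"
  shows "A = B"
  using face_cyclic[OF assms(1,2)] face_cyclic[OF assms(1,3)] assms(4,5) orbit_cyclic_eq3 by metis

lemma Union_faces: "\<Union> (faces K) = D"
proof
  show "\<Union> (faces K) \<subseteq> D" using face_subset by blast
  show "D \<subseteq> \<Union> (faces K)"
    using orbit_self(1)[OF bij_face_next finite_D] by (auto simp: faces_def)
qed

lemma finite_faces: "finite (faces K)"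
  by (simp add: faces_def finite_D)

text \<open>A set of faces is encoded by the union of its members, a set of darts closed under following the
  boundaries of faces. This allows to compare sets of faces of different embeddings.\<close>

definition face_sets :: "'e dart set set" where
  "face_sets = {X. X \<subseteq> D \<and> (\<forall>d\<in>D. face_next K d \<in> X \<longleftrightarrow> d \<in> X)}"

lemma finite_face_sets: "finite face_sets"
  by (rule finite_subset[of _ "Pow D"]) (auto simp: face_sets_def finite_darts)

lemma face_in_face_set:
  assumes "X \<in> face_sets" "A \<in> faces K" "d \<in> A" "d \<in> X" "arcs (ug K) \<noteq> {}"
  shows "A \<subseteq> X"
proof
  fix a assume "a \<in> A"
  show "a \<in> X"
    by (rule cyclic_on_invariant[OF face_cyclic[OF assms(5,2)] assms(3), of "\<lambda>x. x \<in> X"])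
      (use assms face_subset \<open>a \<in> A\<close> in \<open>auto simp: face_sets_def\<close>)
qed

lemma card_face_sets:
  assumes "arcs (ug K) \<noteq> {}"
  shows "card face_sets = 2 ^ card (faces K)"
proof -
  have ne: "A \<noteq> {}" if "A \<in> faces K" for A
    using face_cyclic[OF assms that] by (auto simp: cyclic_on_alldef)
  have "bij_betw (\<lambda>F. \<Union> F) (Pow (faces K)) face_sets"
  proof (rule bij_betw_byWitness[where f' = "\<lambda>X. {A \<in> faces K. A \<subseteq> X}"])
    show "\<forall>F\<in>Pow (faces K). {A \<in> faces K. A \<subseteq> \<Union> F} = F"
    proof
      fix F assume F: "F \<in> Pow (faces K)"
      have "A \<in> F" if A: "A \<in> faces K" "A \<subseteq> \<Union> F" for A
      proof -
        obtain d where d: "d \<in> A" using ne[OF A(1)] by blast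
        then obtain B where "B \<in> F" "d \<in> B" using A by blast
        then show ?thesis using faces_disjoint[OF assms A(1) _ d] F by auto
      qed
      then show "{A \<in> faces K. A \<subseteq> \<Union> F} = F" using F by blast
    qed
    show "\<forall>X\<in>face_sets. \<Union> {A \<in> faces K. A \<subseteq> X} = X"
    proof
      fix X assume X: "X \<in> face_sets"
      have "\<exists>A\<in>faces K. A \<subseteq> X \<and> d \<in> A" if d: "d \<in> X" for d
      proof -
        have "d \<in> \<Union> (faces K)" using d X Union_faces by (auto simp: face_sets_def)
        then show ?thesis using face_in_face_set[OF X _ _ d assms] by blast
      qed
      then show "\<Union> {A \<in> faces K. A \<subseteq> X} = X" by blast
    qed
    show "(\<lambda>F. \<Union> F) ` Pow (faces K) \<subseteq> face_sets"
    proof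
      fix X assume "X \<in> (\<lambda>F. \<Union> F) ` Pow (faces K)"
      then obtain F where F: "F \<subseteq> faces K" "X = \<Union> F" by auto
      have "face_next K d \<in> X \<longleftrightarrow> d \<in> X" if d: "d \<in> D" for d
      proof
        assume "d \<in> X"
        then show "face_next K d \<in> X" using F face_cyclic[OF assms] cyclic_on_inI by fastforce
      next
        assume "face_next K d \<in> X"
        then obtain B where B: "B \<in> F" "face_next K d \<in> B" using F by blast
        obtain A where A: "A \<in> faces K" "d \<in> A" using Union_faces d by blast
        then have "face_next K d \<in> A" using face_cyclic[OF assms] cyclic_on_inI by metis
        then have "A = B" using faces_disjoint[OF assms A(1)] B F by blast
        then show "d \<in> X" using A B F by blast
      qed
      moreover have "X \<subseteq> D" using F face_subset by blast
      ultimately show "X \<in> face_sets" by (simp add: face_sets_def)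
    qed
    show "(\<lambda>X. {A \<in> faces K. A \<subseteq> X}) ` face_sets \<subseteq> Pow (faces K)" by blast
  qed
  then show ?thesis using bij_betw_same_card card_Pow[OF finite_faces] by metis
qed

end

lemma subgraph_fields:
  assumes "subgraph H G"
  shows "tail H = tail G" "head H = head G" "origin H = origin G"
  using assms by (auto simp: subgraph_def compatible_def origin_def fun_eq_iff)

lemma ug_induced [simp]: "ug (induced G H) = H"
  by (simp add: induced_def)

context rotation_system
begin

lemma induced_rotation_system:
  assumes H: "subgraph H (ug K)"
  shows "rotation_system (induced K H)"
proof (rule rotation_system.intro)
  show "fin_digraph (ug (induced K H))"
    using fin_digraph_subgraph[OF H] by (simp add: induced_def)
next
  fix v
  let ?Dv = "{d \<in> darts H. origin H d = v}"
  assume "{d \<in> darts (ug (induced K H)). origin (ug (induced K H)) d = v} \<noteq> {}"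
  then have ne: "?Dv \<noteq> {}" by (simp add: induced_def)
  have sub: "?Dv \<subseteq> darts_at v" using H by (auto simp: darts_at_def subgraph_fields[OF H] subgraph_def)
  then have c: "cyclic_on (rot K) (darts_at v)" using ne cyc unfolding darts_at_def by blast
  have eq: "(rot K ^^ n) d \<in> ?Dv \<longleftrightarrow> (rot K ^^ n) d \<in> darts H" if "d \<in> ?Dv" for d n
  proof -
    have "(rot K ^^ n) d \<in> darts_at v" using cyclic_on_funpow_in[OF c] that sub by blast
    then show ?thesis using H by (auto simp: darts_at_def subgraph_fields[OF H])
  qed
  have "cyclic_on (\<lambda>d. (rot K ^^ (LEAST n. 0 < n \<and> (rot K ^^ n) d \<in> ?Dv)) d) ?Dv"
    by (rule cyclic_on_first_return[OF c sub ne])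
  then have "cyclic_on (rot (induced K H)) ?Dv"
    by (rule back_subst[of "\<lambda>x. x", OF _ cyclic_cong])
      (use eq in \<open>simp add: induced_def\<close>)
  then show "cyclic_on (rot (induced K H)) {d \<in> darts (ug (induced K H)). origin (ug (induced K H)) d = v}"
    by (simp add: induced_def)
qed

text \<open>The induced rotation skips the deleted darts, hence it stays within every set of darts that is
  closed under rotating past deleted darts.\<close>

lemma induced_rot_invariant:
  assumes H: "subgraph H (ug K)" and d: "d \<in> darts H"
    and first: "P (rot K d)"
    and skip: "\<And>c. c \<in> D - darts H \<Longrightarrow> P c \<Longrightarrow> P (rot K c)"
  shows "P (rot (induced K H) d)"
proof -
  let ?v = "origin (ug K) d"
  define m where "m = (LEAST n. 0 < n \<and> (rot K ^^ n) d \<in> darts H)"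
  have dD: "d \<in> D" using d H by auto
  have c: "cyclic_on (rot K) (darts_at ?v)" by (rule cyclic_darts_at[OF dD])
  have self: "d \<in> orbit (rot K) d" using c dD by (auto simp: cyclic_on_alldef darts_at_def)
  then obtain n where "0 < n" "(rot K ^^ n) d = d" by (auto simp: orbit_altdef)
  then have m: "0 < m" using LeastI[of "\<lambda>n. 0 < n \<and> (rot K ^^ n) d \<in> darts H" n] d
    by (simp add: m_def del: in_darts)
  have below: "(rot K ^^ i) d \<notin> darts H" if "0 < i" "i < m" for i
    using not_less_Least[of i "\<lambda>n. 0 < n \<and> (rot K ^^ n) d \<in> darts H"] that by (simp add: m_def)
  have inD: "(rot K ^^ i) d \<in> D" for i by (induction i) (use dD rot_in in auto)
  have "0 < i \<Longrightarrow> i \<le> m \<Longrightarrow> P ((rot K ^^ i) d)" for i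
  proof (induction i)
    case (Suc i)
    show ?case
    proof (cases "i = 0")
      case False
      then have "(rot K ^^ i) d \<in> D - darts H" "P ((rot K ^^ i) d)" using Suc below inD by auto
      then show ?thesis using skip by simp
    qed (use first in simp)
  qed simp
  then show ?thesis using m by (simp add: induced_def m_def)
qed

end

section \<open>Subgraphs of plane graphs satisfy Euler's inequality\<close>

lemma odd_card_sym_diff:
  assumes "finite A" "finite B"
  shows "odd (card (sym_diff A B)) \<longleftrightarrow> odd (card A) \<noteq> odd (card B)"
proof -
  have "card A = card (A - B) + card (A \<inter> B)" "card B = card (B - A) + card (A \<inter> B)"
    using assms by (metis Int_commute add.commute card_Int_Diff)+
  moreover have "card (sym_diff A B) = card (A - B) + card (B - A)"
    using assms by (intro card_Un_disjoint) auto
  ultimately show ?thesis by presburger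
qed

lemma card_eq_sum_fibres:
  assumes "finite A"
  shows "card A = (\<Sum>y\<in>f ` A. card {x \<in> A. f x = y})"
  using sum.image_gen[OF assms, of "\<lambda>_. 1 :: nat" f] by simp

lemma connected_invariant:
  assumes "connected G" "\<And>e. e \<in> arcs G \<Longrightarrow> Q (tail G e) = Q (head G e)" "u \<in> verts G" "v \<in> verts G"
  shows "Q u = Q v"
proof -
  have "u \<rightarrow>\<^sup>*\<^bsub>mk_symmetric G\<^esub> v"
    using assms(1,3,4) by (auto simp: connected_def strongly_connected_def)
  then have "(u, v) \<in> rtrancl_on (verts G) (parcs (mk_symmetric G))"
    by (simp add: reachable_def)
  then show ?thesis
    by induction (use assms(2) in \<open>auto simp: parcs_mk_symmetric\<close>)
qed

locale plane_map =
  fixes G :: "('v, 'e) plane"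
  assumes plane: "plane_graph G"
begin

lemma plane_map_rotation_system: "rotation_system G"
proof (rule rotation_system.intro)
  show "fin_digraph (ug G)" using plane by (simp add: plane_graph_def)
  then interpret fin_digraph "ug G" .
  fix v assume "{d \<in> darts (ug G). origin (ug G) d = v} \<noteq> {}"
  moreover from this have "v \<in> verts (ug G)" by (auto simp: origin_def)
  ultimately show "cyclic_on (rot G) {d \<in> darts (ug G). origin (ug G) d = v}"
    using plane unfolding plane_graph_def Let_def by blast
qed

sublocale rotation_system G by (rule plane_map_rotation_system)

lemma conn: "connected (ug G)"
  using plane by (simp add: plane_graph_def)

text \<open>\<open>odd_verts r\<close> is the boundary map from \<open>1\<close>-chains to \<open>0\<close>-chains with coefficients in the field with
  two elements, except that the coefficient of the root \<open>r\<close> is dropped; this makes the map surjective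
  for a connected graph. \<open>sides\<close> is the boundary map from \<open>2\<close>-chains to \<open>1\<close>-chains.\<close>

definition odd_verts :: "'v \<Rightarrow> 'e set \<Rightarrow> 'v set" where
  "odd_verts r Z = {v \<in> verts (ug G) - {r}. odd (card {d \<in> D. fst d \<in> Z \<and> origin (ug G) d = v})}"

definition sides :: "'e dart set \<Rightarrow> 'e set" where
  "sides X = {e \<in> arcs (ug G). ((e, True) \<in> X) \<noteq> ((e, False) \<in> X)}"

lemma odd_verts_sym_diff: "odd_verts r (sym_diff Z W) = sym_diff (odd_verts r Z) (odd_verts r W)"
proof -
  have "odd (card {d \<in> D. fst d \<in> sym_diff Z W \<and> origin (ug G) d = v}) \<longleftrightarrow>
      odd (card {d \<in> D. fst d \<in> Z \<and> origin (ug G) d = v}) \<noteq>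
      odd (card {d \<in> D. fst d \<in> W \<and> origin (ug G) d = v})" for v
  proof -
    have "{d \<in> D. fst d \<in> sym_diff Z W \<and> origin (ug G) d = v} =
        sym_diff {d \<in> D. fst d \<in> Z \<and> origin (ug G) d = v} {d \<in> D. fst d \<in> W \<and> origin (ug G) d = v}"
      by blast
    then show ?thesis by (simp only:) (rule odd_card_sym_diff; rule finite_subset[OF _ finite_D]; blast)
  qed
  then show ?thesis unfolding odd_verts_def by blast
qed

lemma odd_verts_empty: "odd_verts r {} = {}"
  by (simp add: odd_verts_def)

text \<open>All fibres of a homomorphism have the same size.\<close>

lemma card_cycles:
  assumes "E \<subseteq> arcs (ug G)"
  shows "2 ^ card E = card (odd_verts r ` Pow E) * card {Z \<in> Pow E. odd_verts r Z = {}}"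
proof -
  have finE: "finite E" by (rule finite_subset[OF assms]) simp
  have "card {Z \<in> Pow E. odd_verts r Z = W} = card {Z \<in> Pow E. odd_verts r Z = {}}"
    if W: "W \<in> odd_verts r ` Pow E" for W
  proof -
    obtain Z0 where Z0: "Z0 \<subseteq> E" "odd_verts r Z0 = W" using W by auto
    have inv: "sym_diff (sym_diff Z Z0) Z0 = Z" for Z by blast
    have "bij_betw (\<lambda>Z. sym_diff Z Z0) {Z \<in> Pow E. odd_verts r Z = W} {Z \<in> Pow E. odd_verts r Z = {}}"
      by (rule bij_betw_byWitness[where f' = "\<lambda>Z. sym_diff Z Z0"])
        (use Z0 inv in \<open>auto simp: odd_verts_sym_diff\<close>)
    then show ?thesis by (rule bij_betw_same_card)
  qed
  then have "(\<Sum>W\<in>odd_verts r ` Pow E. card {Z \<in> Pow E. odd_verts r Z = W}) =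
      card (odd_verts r ` Pow E) * card {Z \<in> Pow E. odd_verts r Z = {}}" by simp
  then show ?thesis using card_eq_sum_fibres[of "Pow E" "odd_verts r"] finE by (simp add: card_Pow)
qed

lemma odd_verts_single:
  assumes "e \<in> arcs (ug G)"
  shows "odd_verts r {e} = sym_diff ({tail (ug G) e} - {r}) ({head (ug G) e} - {r})"
proof -
  have "{d \<in> D. fst d \<in> {e} \<and> origin (ug G) d = v} =
      (if tail (ug G) e = v then {(e, True)} else {}) \<union> (if head (ug G) e = v then {(e, False)} else {})" for v
    using assms by (auto simp: origin_def)
  then show ?thesis using assms by (auto simp: odd_verts_def)
qed

text \<open>From the root, every vertex can be reached by crossing edges one at a time; each crossing changes the
  boundary by moving it to the next vertex.\<close>

lemma odd_verts_surj:
  assumes "r \<in> verts (ug G)"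
  shows "odd_verts r ` Pow (arcs (ug G)) = Pow (verts (ug G) - {r})"
proof
  show "odd_verts r ` Pow (arcs (ug G)) \<subseteq> Pow (verts (ug G) - {r})" by (auto simp: odd_verts_def)
  define hit where "hit v \<longleftrightarrow> (\<exists>Z\<subseteq>arcs (ug G). odd_verts r Z = {v} - {r})" for v
  have step: "hit v" if "hit u" "e \<in> arcs (ug G)" "{u, v} = {tail (ug G) e, head (ug G) e}" for u v e
  proof -
    obtain Z where Z: "Z \<subseteq> arcs (ug G)" "odd_verts r Z = {u} - {r}" using \<open>hit u\<close> hit_def by auto
    have "odd_verts r (sym_diff Z {e}) = {v} - {r}"
      unfolding odd_verts_sym_diff odd_verts_single[OF that(2)] Z(2) using that(3) by (auto simp: doubleton_eq_iff)
    moreover have "sym_diff Z {e} \<subseteq> arcs (ug G)" using Z that by auto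
    ultimately show ?thesis using hit_def by blast
  qed
  have "hit r" unfolding hit_def by (rule exI[of _ "{}"]) (simp add: odd_verts_empty)
  then have hit: "hit v" if "v \<in> verts (ug G)" for v
    using connected_invariant[OF conn, of hit r v] step assms that by (metis insert_commute)
  show "Pow (verts (ug G) - {r}) \<subseteq> odd_verts r ` Pow (arcs (ug G))"
  proof
    fix W assume W: "W \<in> Pow (verts (ug G) - {r})"
    then have "finite W" using finite_subset[of W "verts (ug G)"] by auto
    then have "\<exists>Z\<subseteq>arcs (ug G). odd_verts r Z = W" using W
    proof (induction W)
      case empty
      show ?case by (rule exI[of _ "{}"]) (simp add: odd_verts_empty)
    next
      case (insert v W)
      then obtain Z where Z: "Z \<subseteq> arcs (ug G)" "odd_verts r Z = W" by auto
      have "hit v" using hit insert.prems by blast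
      then obtain Y where Y: "Y \<subseteq> arcs (ug G)" "odd_verts r Y = {v} - {r}" unfolding hit_def by blast
      have "odd_verts r (sym_diff Z Y) = insert v W"
        unfolding odd_verts_sym_diff Z Y using insert by auto
      then show ?case using Y Z by (intro exI[of _ "sym_diff Z Y"]) auto
    qed
    then show "W \<in> odd_verts r ` Pow (arcs (ug G))" by auto
  qed
qed

text \<open>The boundary of a set of faces is a cycle: turning once around a vertex, one enters the set as often
  as one leaves it.\<close>

lemma odd_verts_sides:
  assumes X: "X \<in> face_sets"
  shows "odd_verts r (sides X) = {}"
proof -
  have "even (card {d \<in> D. fst d \<in> sides X \<and> origin (ug G) d = v})" for v
  proof -
    let ?P = "{d \<in> darts_at v. d \<in> X}" and ?Q = "{d \<in> darts_at v. rot G d \<in> X}"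
    have fin: "finite (darts_at v)" by (rule finite_subset[OF _ finite_D]) (auto simp: darts_at_def)
    have "bij_betw (rot G) (darts_at v) (darts_at v)"
    proof (cases "darts_at v = {}")
      case False
      then show ?thesis using cyclic_on_bij cyc unfolding darts_at_def by blast
    qed (simp add: bij_betw_def)
    then have inj: "inj_on (rot G) (darts_at v)" and img: "rot G ` darts_at v = darts_at v"
      by (simp_all add: bij_betw_def)
    have "rot G ` ?Q = ?P"
    proof
      show "rot G ` ?Q \<subseteq> ?P" using img by auto
      show "?P \<subseteq> rot G ` ?Q"
      proof
        fix d assume d: "d \<in> ?P"
        then have "d \<in> rot G ` darts_at v" using img by simp
        then obtain c where "c \<in> darts_at v" "d = rot G c" by blast
        then show "d \<in> rot G ` ?Q" using d by auto
      qed
    qed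
    then have "bij_betw (rot G) ?Q ?P" using inj by (auto simp: bij_betw_def inj_on_def)
    then have "card ?Q = card ?P" by (rule bij_betw_same_card)
    moreover have "{d \<in> D. fst d \<in> sides X \<and> origin (ug G) d = v} = sym_diff ?P ?Q"
    proof -
      have "fst d \<in> sides X \<longleftrightarrow> (d \<in> X) \<noteq> (rot G d \<in> X)" if "d \<in> D" for d
      proof -
        have "rot G d \<in> X \<longleftrightarrow> rev_dart d \<in> X"
          using X that unfolding rot_conv_face_next by (simp add: face_sets_def)
        then show ?thesis using that by (cases d; cases "snd d") (auto simp: sides_def)
      qed
      then show ?thesis by (auto simp: darts_at_def)
    qed
    ultimately show ?thesis using odd_card_sym_diff[of ?P ?Q] fin by simp
  qed
  then show ?thesis by (simp add: odd_verts_def)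
qed

text \<open>Such a set is closed under crossing edges and under rotating around vertices, and the graph is
  connected.\<close>

lemma sides_empty:
  assumes X: "X \<in> face_sets" and s: "sides X = {}"
  shows "X = {} \<or> X = D"
proof (cases "X = {}")
  case False
  have rev: "rev_dart d \<in> X \<longleftrightarrow> d \<in> X" if "d \<in> D" for d
    using s that by (cases d; cases "snd d") (auto simp: sides_def)
  have rot: "rot G d \<in> X" if "d \<in> D" "d \<in> X" for d
    using X that rev unfolding rot_conv_face_next by (simp add: face_sets_def)
  define Q where "Q v \<longleftrightarrow> (\<exists>d\<in>X. origin (ug G) d = v)" for v
  have XD: "X \<subseteq> D" using X by (simp add: face_sets_def)
  have all: "d \<in> X" if d: "d \<in> D" "Q (origin (ug G) d)" for d
  proof -
    obtain c where c: "c \<in> X" "origin (ug G) c = origin (ug G) d" using d(2) Q_def by auto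
    show ?thesis
      by (rule cyclic_on_invariant[OF cyclic_darts_at[OF d(1)], of c "\<lambda>x. x \<in> X"])
        (use c d rot XD in \<open>auto simp: darts_at_def\<close>)
  qed
  have "Q (tail (ug G) e) = Q (head (ug G) e)" if e: "e \<in> arcs (ug G)" for e
  proof -
    have "Q (tail (ug G) e) \<longleftrightarrow> (e, True) \<in> X"
      using all[of "(e, True)"] e by (force simp: origin_def Q_def)
    moreover have "Q (head (ug G) e) \<longleftrightarrow> (e, False) \<in> X"
      using all[of "(e, False)"] e by (force simp: origin_def Q_def)
    ultimately show ?thesis using rev[of "(e, True)"] e by simp
  qed
  moreover obtain c where c: "c \<in> X" using False by auto
  then have "origin (ug G) c \<in> verts (ug G)" "Q (origin (ug G) c)" using XD origin_in_verts[of c] c by (auto simp: Q_def)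
  ultimately have "Q v" if "v \<in> verts (ug G)" for v
    using connected_invariant[OF conn, of Q "origin (ug G) c" v] that by blast
  then show ?thesis using all XD origin_in_verts by auto
qed simp

lemma sym_diff_face_sets:
  "X \<in> face_sets \<Longrightarrow> Y \<in> face_sets \<Longrightarrow> sym_diff X Y \<in> face_sets"
  by (auto simp: face_sets_def)

lemma sides_sym_diff: "sides (sym_diff X Y) = sym_diff (sides X) (sides Y)"
  by (auto simp: sides_def)

lemma D_face_set: "D \<in> face_sets"
  using face_next_in by (auto simp: face_sets_def)

lemma sides_eqD:
  assumes "X \<in> face_sets" "Y \<in> face_sets" "sides X = sides Y"
  shows "Y = X \<or> Y = D - X"
proof -
  have "sym_diff X Y = {} \<or> sym_diff X Y = D"
    by (rule sides_empty[OF sym_diff_face_sets[OF assms(1,2)]]) (simp add: sides_sym_diff assms)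
  moreover have "X \<subseteq> D" "Y \<subseteq> D" using assms by (auto simp: face_sets_def)
  ultimately show ?thesis by auto
qed

text \<open>The first homology with coefficients in the field with two elements vanishes: by Euler's formula there
  are as many cycles as pairs of complementary sets of faces.\<close>

lemma cycles_bound:
  assumes ne: "arcs (ug G) \<noteq> {}" and r: "r \<in> verts (ug G)"
  shows "sides ` face_sets = {Z \<in> Pow (arcs (ug G)). odd_verts r Z = {}}" (is "?I = ?K")
proof -
  have "?I \<subseteq> ?K" using odd_verts_sides by (auto simp: sides_def)
  moreover have "card ?K \<le> card ?I"
  proof -
    have "2 ^ card (arcs (ug G)) = 2 ^ (card (verts (ug G)) - 1) * card ?K"
      using card_cycles[of "arcs (ug G)" r] unfolding odd_verts_surj[OF r] by (simp add: card_Pow r)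
    moreover have "2 ^ card (faces G) \<le> 2 * card ?I"
    proof -
      have "card {X \<in> face_sets. sides X = Z} \<le> 2" if Z: "Z \<in> ?I" for Z
      proof -
        obtain X where X: "X \<in> face_sets" "sides X = Z" using Z by blast
        have "{X \<in> face_sets. sides X = Z} \<subseteq> {X, D - X}" using sides_eqD X by blast
        then have "card {X \<in> face_sets. sides X = Z} \<le> card {X, D - X}" by (intro card_mono) auto
        also have "\<dots> \<le> 2" by (simp add: card_insert_if)
        finally show ?thesis .
      qed
      then have "(\<Sum>Z\<in>?I. card {X \<in> face_sets. sides X = Z}) \<le> (\<Sum>Z\<in>?I. 2)" by (rule sum_mono)
      then show ?thesis
        using card_eq_sum_fibres[OF finite_face_sets, of sides] card_face_sets[OF ne] by simp
    qed
    moreover have "card (faces G) + (card (verts (ug G)) - 1) = card (arcs (ug G)) + 1"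
    proof -
      have "card (verts (ug G)) > 0" using r by (auto simp: card_gt_0_iff)
      moreover have "int (card (verts (ug G))) - int (card (arcs (ug G))) + int (card (faces G)) = 2"
        using plane unfolding plane_graph_def by blast
      ultimately show ?thesis by linarith
    qed
    ultimately have k: "2 ^ card (arcs (ug G)) = 2 ^ (card (verts (ug G)) - 1) * card ?K"
      and i: "2 ^ card (faces G) \<le> 2 * card ?I"
      and f: "card (faces G) + (card (verts (ug G)) - 1) = card (arcs (ug G)) + 1" by blast+
    have "2 ^ (card (verts (ug G)) - 1) * (2 * card ?K) = 2 ^ (card (arcs (ug G)) + 1)"
      using k by simp
    also have "\<dots> = 2 ^ (card (verts (ug G)) - 1) * 2 ^ card (faces G)"
      unfolding f[symmetric] by (simp add: power_add)
    also have "\<dots> \<le> 2 ^ (card (verts (ug G)) - 1) * (2 * card ?I)"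
      using i by simp
    finally have "(2::nat) ^ (card (verts (ug G)) - 1) * (2 * card ?K) \<le> 2 ^ (card (verts (ug G)) - 1) * (2 * card ?I)" .
    then show ?thesis by simp
  qed
  moreover have "finite ?K" by simp
  ultimately show ?thesis by (intro card_seteq)
qed

text \<open>The sets of faces of \<open>G\<close> that contain with a face all the faces merged with it when the edges outside
  \<open>H\<close> are deleted.\<close>

definition merged_sets :: "('v, 'e) pre_digraph \<Rightarrow> 'e dart set set" where
  "merged_sets H = {X \<in> face_sets. \<forall>d\<in>D - darts H. rev_dart d \<in> X \<longleftrightarrow> d \<in> X}"

lemma finite_merged_sets: "finite (merged_sets H)"
  using finite_face_sets by (simp add: merged_sets_def)

text \<open>Every cycle of \<open>H\<close> bounds two complementary sets of faces of \<open>G\<close>, and these sets are merged ones,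
  because their boundaries contain no edge outside \<open>H\<close>.\<close>

lemma card_merged_sets:
  assumes H: "subgraph H (ug G)" and ne: "arcs H \<noteq> {}"
  shows "2 ^ (card (arcs H) + 2) \<le> 2 ^ card (verts H) * card (merged_sets H)"
proof -
  have sub: "verts H \<subseteq> verts (ug G)" "arcs H \<subseteq> arcs (ug G)" "wf_digraph H"
    using H by (auto simp: subgraph_def)
  have fin: "finite (verts H)" "finite (arcs H)"
    using finite_subset[OF sub(1)] finite_subset[OF sub(2)] by auto
  obtain e where e: "e \<in> arcs H" using ne by auto
  define r where "r = tail (ug G) e"
  have rH: "r \<in> verts H" using wf_digraph.tail_in_verts[OF sub(3) e] subgraph_fields[OF H] by (simp add: r_def)
  have rG: "r \<in> verts (ug G)" using rH sub by auto
  have neG: "arcs (ug G) \<noteq> {}" using sub ne by auto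
  define K where "K = {Z \<in> Pow (arcs H). odd_verts r Z = {}}"
  define M where "M = merged_sets H"
  have "odd_verts r ` Pow (arcs H) \<subseteq> Pow (verts H - {r})"
  proof -
    have "v \<in> verts H" if v: "Z \<subseteq> arcs H" "v \<in> odd_verts r Z" for Z v
    proof -
      have "card {d \<in> D. fst d \<in> Z \<and> origin (ug G) d = v} \<noteq> 0"
        using v(2) unfolding odd_verts_def by (intro notI) simp
      then obtain d where "d \<in> D" "fst d \<in> Z" "origin (ug G) d = v"
        by (metis (mono_tags, lifting) card.empty empty_Collect_eq)
      then have d: "fst d \<in> arcs H" "origin H d = v" using v subgraph_fields[OF H] by auto
      then show ?thesis using wf_digraph.tail_in_verts[OF sub(3)] wf_digraph.head_in_verts[OF sub(3)]
        by (auto simp: origin_def split: if_splits)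
    qed
    then show ?thesis by (auto simp: odd_verts_def)
  qed
  then have "card (odd_verts r ` Pow (arcs H)) \<le> 2 ^ (card (verts H) - 1)"
    using card_mono[of "Pow (verts H - {r})"] fin rH by (simp add: card_Pow)
  then have 1: "2 ^ card (arcs H) \<le> 2 ^ (card (verts H) - 1) * card K"
    using card_cycles[OF sub(2), of r] by (simp add: K_def)
  have "K \<subseteq> sides ` M"
  proof
    fix Z assume Z: "Z \<in> K"
    then have "Z \<in> sides ` face_sets" unfolding cycles_bound[OF neG rG] using sub by (auto simp: K_def)
    then obtain X where X: "X \<in> face_sets" "Z = sides X" by auto
    have "rev_dart d \<in> X \<longleftrightarrow> d \<in> X" if "d \<in> D - darts H" for d
    proof -
      have "fst d \<notin> sides X" using that Z X by (auto simp: K_def)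
      then show ?thesis using that by (cases d; cases "snd d") (auto simp: sides_def)
    qed
    then show "Z \<in> sides ` M" using X by (auto simp: M_def merged_sets_def)
  qed
  have finM: "finite M" using finite_merged_sets by (simp add: M_def)
  have "2 * card (sides ` M) \<le> card M"
  proof -
    have "2 \<le> card {X \<in> M. sides X = Z}" if Z: "Z \<in> sides ` M" for Z
    proof -
      obtain X where X: "X \<in> M" "sides X = Z" using Z by blast
      have "X \<subseteq> D" using X by (auto simp: M_def merged_sets_def face_sets_def)
      have "D - X = sym_diff D X" using \<open>X \<subseteq> D\<close> by auto
      then have "D - X \<in> face_sets"
        using sym_diff_face_sets[OF D_face_set, of X] X by (simp add: M_def merged_sets_def)
      moreover have "sides (D - X) = Z" using X by (auto simp: sides_def)
      ultimately have "{X, D - X} \<subseteq> {X \<in> M. sides X = Z}" using X by (auto simp: M_def merged_sets_def)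
      then have "card {X, D - X} \<le> card {X \<in> M. sides X = Z}" by (rule card_mono[rotated]) (use finM in auto)
      moreover have "X \<noteq> D - X" using e sub \<open>X \<subseteq> D\<close> by (metis Diff_disjoint Diff_eq_empty_iff Int_absorb
            Diff_empty empty_iff fst_conv in_darts subsetD)
      ultimately show ?thesis by simp
    qed
    then have "(\<Sum>Z\<in>sides ` M. 2) \<le> (\<Sum>Z\<in>sides ` M. card {X \<in> M. sides X = Z})" by (rule sum_mono)
    then show ?thesis using card_eq_sum_fibres[OF finM, of sides] by simp
  qed
  moreover have "card K \<le> card (sides ` M)" using \<open>K \<subseteq> sides ` M\<close> finM by (intro card_mono) auto
  ultimately have 2: "2 * card K \<le> card M" by linarith
  have "card (verts H) > 0" using rH fin by (auto simp: card_gt_0_iff)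
  then have V: "2 ^ card (verts H) = 2 * (2::nat) ^ (card (verts H) - 1)"
    by (metis Suc_diff_1 power_Suc)
  have "2 ^ (card (arcs H) + 2) = 4 * (2::nat) ^ card (arcs H)" by simp
  also have "\<dots> \<le> 4 * (2 ^ (card (verts H) - 1) * card K)" using 1 by simp
  also have "\<dots> = 2 ^ card (verts H) * (2 * card K)" unfolding V by simp
  also have "\<dots> \<le> 2 ^ card (verts H) * card M" using 2 by simp
  finally show ?thesis by (simp add: M_def)
qed

text \<open>If two merged sets agree along \<open>H\<close>, then their difference has no boundary, so it is empty or
  everything; it is not everything because \<open>H\<close> has an edge.\<close>

lemma merged_sets_restrict:
  assumes H: "subgraph H (ug G)" and ne: "arcs H \<noteq> {}"
  shows "inj_on (\<lambda>X. X \<inter> darts H) (merged_sets H)"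
    "(\<lambda>X. X \<inter> darts H) ` merged_sets H \<subseteq> rotation_system.face_sets (induced G H)"
proof -
  interpret H: rotation_system "induced G H" by (rule induced_rotation_system[OF H])
  have ugH: "ug (induced G H) = H" by (simp add: induced_def)
  have sub: "verts H \<subseteq> verts (ug G)" "arcs H \<subseteq> arcs (ug G)"
    using H by (auto simp: subgraph_def)
  obtain e where e: "e \<in> arcs H" using ne by auto
  define M where "M = merged_sets H"
  have skip: "rot G d \<in> X \<longleftrightarrow> rev_dart d \<in> X" if "X \<in> M" "d \<in> D" for X d
    using that unfolding rot_conv_face_next by (simp add: M_def merged_sets_def face_sets_def)
  show "inj_on (\<lambda>X. X \<inter> darts H) (merged_sets H)"
    unfolding M_def[symmetric]
  proof (rule inj_onI)
    fix X Y assume XY: "X \<in> M" "Y \<in> M" "X \<inter> darts H = Y \<inter> darts H"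
    have "(a, True) \<in> sym_diff X Y \<longleftrightarrow> (a, False) \<in> sym_diff X Y" if a: "a \<in> arcs (ug G)" for a
    proof (cases "a \<in> arcs H")
      case True
      have "(a, b) \<in> X \<inter> darts H \<longleftrightarrow> (a, b) \<in> Y \<inter> darts H" for b by (simp only: XY(3))
      then have "(a, b) \<in> X \<longleftrightarrow> (a, b) \<in> Y" for b using True by simp
      then show ?thesis by simp
    next
      case False
      then have "(a, True) \<in> D - darts H" using a by simp
      then have "(a, False) \<in> X \<longleftrightarrow> (a, True) \<in> X" "(a, False) \<in> Y \<longleftrightarrow> (a, True) \<in> Y"
        using XY(1,2) by (fastforce simp: M_def merged_sets_def)+
      then show ?thesis by simp
    qed
    then have "sides (sym_diff X Y) = {}" unfolding sides_def by blast
    then have cases: "sym_diff X Y = {} \<or> sym_diff X Y = D"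
      using XY(1,2) by (intro sides_empty sym_diff_face_sets) (auto simp: M_def merged_sets_def)
    have "(e, True) \<in> X \<inter> darts H \<longleftrightarrow> (e, True) \<in> Y \<inter> darts H" by (simp only: XY(3))
    then have "(e, True) \<in> D" "(e, True) \<notin> sym_diff X Y" using e sub by auto
    then have "sym_diff X Y = {}" using cases by metis
    then show "X = Y" by blast
  qed
  show "(\<lambda>X. X \<inter> darts H) ` merged_sets H \<subseteq> H.face_sets"
    unfolding M_def[symmetric]
  proof
    fix Y assume "Y \<in> (\<lambda>X. X \<inter> darts H) ` M"
    then obtain X where X: "X \<in> M" "Y = X \<inter> darts H" by auto
    have "face_next (induced G H) d \<in> X \<longleftrightarrow> d \<in> X" if d: "d \<in> darts H" for d
    proof -
      have "(rot (induced G H) (rev_dart d) \<in> X) = (d \<in> X)"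
      proof (rule induced_rot_invariant[OF H, of _ "\<lambda>c. (c \<in> X) = (d \<in> X)"])
        show "rev_dart d \<in> darts H" using d by simp
        show "(rot G (rev_dart d) \<in> X) = (d \<in> X)" using skip[OF X(1), of "rev_dart d"] d sub by auto
        fix c assume "c \<in> D - darts H" "(c \<in> X) = (d \<in> X)"
        then show "(rot G c \<in> X) = (d \<in> X)" using skip[OF X(1), of c] X(1) by (simp add: M_def merged_sets_def)
      qed
      then show ?thesis by (simp add: face_next_def)
    qed
    then show "Y \<in> H.face_sets"
      using X H.face_next_in by (auto simp: H.face_sets_def ugH)
  qed
qed

text \<open>Restriction embeds the merged sets into the sets of faces of \<open>H\<close>. In the case of equality in Euler's
  formula there are as many of the former as of the latter.\<close>

lemma euler_subgraph:
  assumes H: "subgraph H (ug G)" and ne: "arcs H \<noteq> {}"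
  shows "card (arcs H) + 2 \<le> card (verts H) + card (faces (induced G H))"
    "card (arcs H) + 2 = card (verts H) + card (faces (induced G H)) \<Longrightarrow>
      (\<lambda>X. X \<inter> darts H) ` merged_sets H = rotation_system.face_sets (induced G H)"
proof -
  interpret H: rotation_system "induced G H" by (rule induced_rotation_system[OF H])
  have c: "card H.face_sets = 2 ^ card (faces (induced G H))"
    by (rule H.card_face_sets) (simp add: induced_def ne)
  note r = merged_sets_restrict[OF H ne] and m = card_merged_sets[OF H ne]
  have le: "card (merged_sets H) \<le> 2 ^ card (faces (induced G H))"
    using card_inj_on_le[OF r H.finite_face_sets] c by simp
  then have "2 ^ card (verts H) * card (merged_sets H) \<le> 2 ^ card (verts H) * 2 ^ card (faces (induced G H))"
    by simp
  then have "2 ^ (card (arcs H) + 2) \<le> (2::nat) ^ (card (verts H) + card (faces (induced G H)))"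
    using m by (simp only: power_add)
  then show "card (arcs H) + 2 \<le> card (verts H) + card (faces (induced G H))"
    by (rule power_le_imp_le_exp[rotated]) simp
  assume eq: "card (arcs H) + 2 = card (verts H) + card (faces (induced G H))"
  have "2 ^ card (verts H) * 2 ^ card (faces (induced G H)) \<le> 2 ^ card (verts H) * card (merged_sets H)"
    using m unfolding eq by (simp only: power_add)
  then have "card H.face_sets \<le> card (merged_sets H)" using c by simp
  then show "(\<lambda>X. X \<inter> darts H) ` merged_sets H = H.face_sets"
    using r card_image[OF r(1)] by (intro card_seteq[OF H.finite_face_sets]) auto
qed

end

section \<open>Directed paths in acyclic plane graphs\<close>

locale acyclic_plane = plane_map G for G :: "('v, 'e) plane" +
  assumes st: "arcs (ug G) \<noteq> {} \<Longrightarrow> st_graph G"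
    and acyclic: "\<And>u p. awalk u p u \<Longrightarrow> p = []"
begin

text \<open>The number of ancestors increases along every edge. Comparing ranks replaces all further arguments
  with closed walks.\<close>

definition rank :: "'v \<Rightarrow> nat" where
  "rank v = card {w. \<exists>p. awalk w p v}"

lemma rank_less:
  assumes e: "e \<in> arcs (ug G)"
  shows "rank (tail (ug G) e) < rank (head (ug G) e)"
  unfolding rank_def
proof (rule psubset_card_mono)
  have "{w. \<exists>p. awalk w p (head (ug G) e)} \<subseteq> verts (ug G)" by auto
  then show "finite {w. \<exists>p. awalk w p (head (ug G) e)}" by (rule finite_subset) simp
  have "awalk w (p @ [e]) (head (ug G) e)" if "awalk w p (tail (ug G) e)" for w p
    using awalk_appendI[OF that arc_implies_awalk[OF e]] .
  moreover have "\<not> awalk (head (ug G) e) p (tail (ug G) e)" for p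
    using awalk_appendI[of "head (ug G) e" p "tail (ug G) e" "[e]", OF _ arc_implies_awalk[OF e]]
      acyclic[of "head (ug G) e" "p @ [e]"] by auto
  moreover have "awalk (head (ug G) e) [] (head (ug G) e)" using e by (simp add: awalk_Nil_iff)
  ultimately show "{w. \<exists>p. awalk w p (tail (ug G) e)} \<subset> {w. \<exists>p. awalk w p (head (ug G) e)}"
    by blast
qed

lemma awalk_rank: "awalk x p y \<Longrightarrow> rank x + length p \<le> rank y"
proof (induction p arbitrary: x)
  case (Cons e p)
  then show ?case using rank_less[of e] by (fastforce simp: awalk_Cons_iff)
qed (simp add: awalk_Nil_iff)

definition paths :: "'v \<Rightarrow> 'v \<Rightarrow> 'e list set" where
  "paths x y = {p. awalk x p y}"

lemma awalk_distinct: "awalk x p y \<Longrightarrow> distinct (awalk_verts x p)"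
proof (induction p arbitrary: x)
  case (Cons e p)
  then have p: "awalk (head (ug G) e) p y" and e: "e \<in> arcs (ug G)" "tail (ug G) e = x"
    by (auto simp: awalk_Cons_iff)
  have "x \<notin> set (awalk_verts (head (ug G) e) p)"
  proof
    assume "x \<in> set (awalk_verts (head (ug G) e) p)"
    then obtain q where "awalk (head (ug G) e) q x" using awalk_decomp[OF p] by blast
    then show False using awalk_rank rank_less[OF e(1)] e(2) by fastforce
  qed
  then show ?case using Cons.IH[OF p] e by simp
qed simp

text \<open>Walks are paths automatically, because their vertices have increasing ranks.\<close>

lemma dpath_iff: "dpath (ug G) x p y \<longleftrightarrow> p \<in> paths x y"
  using awalk_distinct by (auto simp: apath_def paths_def)

lemma dpath_subgraph_iff:
  assumes "subgraph H (ug G)"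
  shows "dpath H x p y \<longleftrightarrow> x \<in> verts H \<and> set p \<subseteq> arcs H \<and> p \<in> paths x y"
proof -
  have c: "compatible (ug G) H" "verts H \<subseteq> verts (ug G)" "arcs H \<subseteq> arcs (ug G)"
    using assms by (auto simp: subgraph_def)
  show ?thesis
    using c awalk_distinct[of x p y] compatible_cas[OF c(1)] compatible_awalk_verts[OF c(1)]
    by (auto simp: pre_digraph.apath_def pre_digraph.awalk_def paths_def)
qed

lemma Nil_in_paths [simp]: "[] \<in> paths x y \<longleftrightarrow> x = y \<and> x \<in> verts (ug G)"
  by (auto simp: paths_def awalk_Nil_iff)

lemma Cons_in_paths: "e # p \<in> paths x y \<longleftrightarrow> e \<in> arcs (ug G) \<and> tail (ug G) e = x \<and> p \<in> paths (head (ug G) e) y"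
  by (auto simp: paths_def awalk_Cons_iff)

lemma append_in_paths: "p \<in> paths x y \<Longrightarrow> q \<in> paths y z \<Longrightarrow> p @ q \<in> paths x z"
  unfolding paths_def using awalk_appendI by simp

lemma paths_appendE:
  assumes "p @ q \<in> paths x z"
  obtains y where "p \<in> paths x y" "q \<in> paths y z"
  using assms by (auto simp: paths_def)

lemma paths_verts: "p \<in> paths x y \<Longrightarrow> x \<in> verts (ug G)" "p \<in> paths x y \<Longrightarrow> y \<in> verts (ug G)"
  by (auto simp: paths_def)

lemma paths_arcs: "p \<in> paths x y \<Longrightarrow> set p \<subseteq> arcs (ug G)"
  by (auto simp: paths_def)

lemma paths_rank: "p \<in> paths x y \<Longrightarrow> rank x + length p \<le> rank y"
  by (simp add: paths_def awalk_rank)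

lemma paths_rank_less: "p \<in> paths x y \<Longrightarrow> x \<noteq> y \<Longrightarrow> rank x < rank y"
  using paths_rank[of p x y] by (cases p) auto

lemma paths_refl: "paths x x = (if x \<in> verts (ug G) then {[]} else {})"
proof -
  have 1: "p = [] \<and> x \<in> verts (ug G)" if "p \<in> paths x x" for p
    using paths_rank[OF that] paths_verts(1)[OF that] by simp
  have 2: "[] \<in> paths x x \<longleftrightarrow> x \<in> verts (ug G)" by simp
  show ?thesis
  proof (cases "x \<in> verts (ug G)")
    case True
    then show ?thesis unfolding if_P[OF True] using 2 by (intro equalityI subsetI) (simp_all add: 1)
  next
    case False
    then show ?thesis unfolding if_not_P[OF False] using 1 by (intro equals0I) blast
  qed
qed

lemma paths_antisym: "p \<in> paths x y \<Longrightarrow> q \<in> paths y x \<Longrightarrow> x = y"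
  using paths_rank_less[of p x y] paths_rank_less[of q y x] by (cases "x = y") auto

lemma paths_ends_unique: "p \<in> paths x y \<Longrightarrow> p \<in> paths x z \<Longrightarrow> y = z"
  unfolding paths_def using awalk_ends[of x p y x z] by auto

lemma paths_split_at:
  assumes "p \<in> paths x y" "z \<in> set (awalk_verts x p)"
  obtains q r where "p = q @ r" "q \<in> paths x z" "r \<in> paths z y"
  using assms awalk_decomp[of x p y z] unfolding paths_def by blast

lemma append_on_path:
  assumes "p \<in> paths x y" "q \<in> paths y z"
  shows "set (awalk_verts x (p @ q)) = set (awalk_verts x p) \<union> set (awalk_verts y q)"
  using assms set_awalk_verts_append unfolding paths_def by blast

lemma ends_on_path:
  assumes "p \<in> paths x y"
  shows "x \<in> set (awalk_verts x p)" "y \<in> set (awalk_verts x p)"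
proof -
  have "awalk x p y" using assms by (simp add: paths_def)
  then show "x \<in> set (awalk_verts x p)" by (rule hd_in_awalk_verts)
  have "last (awalk_verts x p) \<in> set (awalk_verts x p)" by (rule last_in_set) simp
  then show "y \<in> set (awalk_verts x p)" using \<open>awalk x p y\<close> by simp
qed

lemma edge_split:
  assumes "p \<in> paths x y" "e \<in> set p"
  obtains q r where "p = q @ e # r" "q \<in> paths x (tail (ug G) e)" "r \<in> paths (head (ug G) e) y"
proof -
  obtain q r where qr: "p = q @ e # r" using split_list[OF assms(2)] by auto
  then obtain z where "q \<in> paths x z" "e # r \<in> paths z y" using assms(1) paths_appendE by metis
  then show ?thesis using that qr by (auto simp: Cons_in_paths)
qed

lemma paths_distinct: "p \<in> paths x y \<Longrightarrow> distinct p"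
  using awalk_distinct[of x p y] unfolding paths_def by (auto simp: awalk_verts_conv distinct_map split: if_splits)

text \<open>The middle vertex determines where a path is cut, because no path meets a vertex twice.\<close>

lemma paths_append_eq:
  assumes "p \<in> paths x z" "p' \<in> paths x z" "p @ q = p' @ q'"
  shows "p = p' \<and> q = q'"
proof -
  have nil: "r = []" if r: "s \<in> paths x z" "s @ r \<in> paths x z" for s r
  proof -
    obtain w where w: "s \<in> paths x w" "r \<in> paths w z" using paths_appendE[OF r(2)] .
    then have "w = z" using paths_ends_unique r(1) by blast
    then show ?thesis using w(2) paths_refl[of z] by (auto split: if_splits)
  qed
  obtain us where "p = p' @ us \<and> us @ q = q' \<or> p @ us = p' \<and> q = us @ q'"
    using assms(3) by (auto simp: append_eq_append_conv2)
  then show ?thesis using nil[of p' us] nil[of p us] assms(1,2) by auto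
qed

text \<open>The first edge of \<open>p\<close> starts at \<open>x\<close>, and the only edge of \<open>q\<close> that can do so is its first one.\<close>

lemma paths_subset_eq:
  "p \<in> paths x y \<Longrightarrow> q \<in> paths x y \<Longrightarrow> set p \<subseteq> set q \<Longrightarrow> p = q"
proof (induction p arbitrary: x q)
  case Nil
  then show ?case using paths_refl by (auto split: if_splits)
next
  case (Cons e p)
  have e: "tail (ug G) e = x" "p \<in> paths (head (ug G) e) y" "e \<in> arcs (ug G)"
    using Cons.prems by (auto simp: Cons_in_paths)
  obtain q1 q2 where q: "q = q1 @ e # q2" "q1 \<in> paths x (tail (ug G) e)" "q2 \<in> paths (head (ug G) e) y"
    using edge_split[OF Cons.prems(2), of e] Cons.prems(3) by auto
  then have q1: "q1 = []" using e paths_refl[of x] by (auto split: if_splits)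
  have "e \<notin> set p" using paths_distinct[OF Cons.prems(1)] by simp
  then have "set p \<subseteq> set q2" using Cons.prems(3) q q1 by auto
  then show ?case using Cons.IH[OF e(2) q(3)] q q1 by simp
qed

definition paths_union :: "'v \<Rightarrow> 'e list set \<Rightarrow> ('v, 'e) pre_digraph" where
  "paths_union x P = pre_digraph.Union (ug G) (path_graph (ug G) x ` P)"

lemma paths_union_simps:
  "verts (paths_union x P) = (\<Union>p\<in>P. set (awalk_verts x p))"
  "arcs (paths_union x P) = (\<Union>p\<in>P. set p)"
  "tail (paths_union x P) = tail (ug G)" "head (paths_union x P) = head (ug G)"
  by (simp_all add: paths_union_def pre_digraph.Union_def path_graph_def)

lemma between_conv: "between (ug G) x y = paths_union x (paths x y)"
  by (simp add: between_def paths_union_def dpath_iff setcompr_eq_image)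

lemma path_graph_conv: "path_graph (ug G) x p = paths_union x {p}"
  by (simp add: paths_union_def pre_digraph.Union_def path_graph_def)

lemma paths_union_subgraph:
  assumes "P \<subseteq> paths x y"
  shows "subgraph (paths_union x P) (ug G)"
proof (rule subgraphI)
  have aw: "awalk x p y" if "p \<in> P" for p using that assms by (auto simp: paths_def)
  then show "verts (paths_union x P) \<subseteq> verts (ug G)" "arcs (paths_union x P) \<subseteq> arcs (ug G)"
    by (fastforce simp: paths_union_simps)+
  show "compatible (ug G) (paths_union x P)" by (simp add: compatible_def paths_union_simps)
  show "wf_digraph (paths_union x P)"
  proof (rule wf_digraph.intro)
    fix e assume "e \<in> arcs (paths_union x P)"
    then obtain p where p: "p \<in> P" "e \<in> set p" by (auto simp: paths_union_simps)
    then show "tail (paths_union x P) e \<in> verts (paths_union x P)" "head (paths_union x P) e \<in> verts (paths_union x P)"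
      using awalk_verts_arc1[OF p(2)] awalk_verts_arc2[OF aw[OF p(1)] p(2)] by (auto simp: paths_union_simps)
  qed
  show "wf_digraph (ug G)" by (rule wf_digraph_axioms)
qed

lemma paths_union_mono:
  assumes "P \<subseteq> Q" "Q \<subseteq> paths x y"
  shows "subgraph (paths_union x P) (paths_union x Q)"
  using assms paths_union_subgraph[of P x y] paths_union_subgraph[of Q x y]
  by (auto simp: subgraph_def compatible_def paths_union_simps)

lemma dpath_paths_union:
  assumes "P \<subseteq> paths x y" "p \<in> P" "p = q @ r" "q \<in> paths x z" "r \<in> paths z y"
  shows "dpath (paths_union x P) x q z" "dpath (paths_union x P) z r y" "z \<in> verts (paths_union x P)"
proof -
  have "set (awalk_verts x q) \<union> set (awalk_verts z r) \<subseteq> verts (paths_union x P)"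
    using assms append_on_path by (auto simp: paths_union_simps)
  then show z: "z \<in> verts (paths_union x P)" and "dpath (paths_union x P) x q z" "dpath (paths_union x P) z r y"
    using ends_on_path[OF assms(4)] assms
    unfolding dpath_subgraph_iff[OF paths_union_subgraph[OF assms(1)]] by (auto simp: paths_union_simps)
qed

lemma paths_union_vertexE:
  assumes "P \<subseteq> paths x y" "v \<in> verts (paths_union x P)"
  obtains p q where "p @ q \<in> P" "p \<in> paths x v" "q \<in> paths v y"
proof -
  obtain p where p: "p \<in> P" "v \<in> set (awalk_verts x p)" using assms(2) by (auto simp: paths_union_simps)
  then show ?thesis using that paths_split_at[of p x y v] assms(1) by blast
qed

text \<open>Two sources would reach each other, and so would two targets.\<close>

lemma source_unique:
  assumes "subgraph H (ug G)" "is_source H a" "is_source H b"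
  shows "a = b"
  using assms paths_antisym unfolding is_source_def dpath_subgraph_iff[OF assms(1)] by blast

lemma target_unique:
  assumes "subgraph H (ug G)" "is_target H a" "is_target H b"
  shows "a = b"
  using assms paths_antisym unfolding is_target_def dpath_subgraph_iff[OF assms(1)] by blast

lemma src_eqI: "subgraph H (ug G) \<Longrightarrow> is_source H a \<Longrightarrow> src H = a"
  unfolding src_def using source_unique by blast

lemma tgt_eqI: "subgraph H (ug G) \<Longrightarrow> is_target H a \<Longrightarrow> tgt H = a"
  unfolding tgt_def using target_unique by blast

lemma paths_union_ends:
  assumes "P \<subseteq> paths x y" "P \<noteq> {}"
  shows "is_source (paths_union x P) x" "is_target (paths_union x P) y"
    "src (paths_union x P) = x" "tgt (paths_union x P) = y"
proof -
  obtain p where p: "p \<in> P" "p \<in> paths x y" using assms by auto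
  then have v: "x \<in> verts (paths_union x P)" "y \<in> verts (paths_union x P)"
    using ends_on_path[OF p(2)] by (auto simp: paths_union_simps)
  show s: "is_source (paths_union x P) x"
    unfolding is_source_def using v paths_union_vertexE[OF assms(1)] dpath_paths_union(1)[OF assms(1)] by metis
  show t: "is_target (paths_union x P) y"
    unfolding is_target_def using v paths_union_vertexE[OF assms(1)] dpath_paths_union(2)[OF assms(1)] by metis
  show "src (paths_union x P) = x" "tgt (paths_union x P) = y"
    using src_eqI[OF paths_union_subgraph[OF assms(1)] s] tgt_eqI[OF paths_union_subgraph[OF assms(1)] t] by auto
qed

lemma ext_in_faces: "ext G \<in> faces G"
  using plane unfolding plane_graph_def by blast

end

section \<open>Unions of parallel paths are globular\<close>

context acyclic_plane
begin

text \<open>The darts whose right-hand face is merged with the exterior one when the edges outside \<open>H\<close> are deleted.\<close>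

abbreviation reach :: "('v, 'e) pre_digraph \<Rightarrow> 'e dart set" where
  "reach H \<equiv> (merge_step G H)\<^sup>* `` ext G"

lemma reach_face_next: "d \<in> D \<Longrightarrow> d \<in> reach H \<Longrightarrow> face_next G d \<in> reach H"
  by (auto simp: merge_step_def intro: rtrancl_into_rtrancl)

lemma reach_rev: "d \<in> D - darts H \<Longrightarrow> d \<in> reach H \<Longrightarrow> rev_dart d \<in> reach H"
  by (auto simp: merge_step_def intro: rtrancl_into_rtrancl)

lemma reach_rot: "d \<in> D - darts H \<Longrightarrow> d \<in> reach H \<Longrightarrow> rot G d \<in> reach H"
  using reach_face_next[OF _ reach_rev, of d H] by (simp add: rot_conv_face_next)

lemma ext_reach: "d \<in> ext G \<Longrightarrow> d \<in> reach H"
  by auto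

definition exterior_at :: "('v, 'e) pre_digraph \<Rightarrow> 'v \<Rightarrow> bool" where
  "exterior_at H v \<longleftrightarrow> (\<exists>d\<in>darts_at v. d \<in> reach H)"

lemma exterior_at_corner:
  assumes "exterior_at H v" "c \<in> darts_at v" "c \<notin> reach H"
  shows "\<exists>d\<in>darts_at v. d \<in> darts H \<and> d \<in> reach H"
proof (rule ccontr)
  assume no: "\<not> ?thesis"
  obtain d where d: "d \<in> darts_at v" "d \<in> reach H" using assms(1) by (auto simp: exterior_at_def)
  have "c \<in> reach H"
  proof (rule cyclic_on_invariant[of "rot G" "darts_at v" d "\<lambda>x. x \<in> reach H" c])
    show "cyclic_on (rot G) (darts_at v)" using cyc d(1) unfolding darts_at_def by blast
    show "rot G x \<in> reach H" if "x \<in> darts_at v" "x \<in> reach H" for x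
      using reach_rot[of x H] no that by (auto simp: darts_at_def)
  qed (use d assms in auto)
  then show False using assms by simp
qed

lemma exterior_at_edge:
  assumes "exterior_at H v" "v \<notin> verts H" "wf_digraph H" "subgraph H (ug G)" "c \<in> darts_at v"
  shows "exterior_at H (origin (ug G) (rev_dart c))"
proof -
  have notin: "d \<notin> darts H" if "d \<in> darts_at v" for d
    using that assms wf_digraph.tail_in_verts[OF assms(3)] wf_digraph.head_in_verts[OF assms(3)]
    by (auto simp: darts_at_def origin_def subgraph_fields[OF assms(4)] split: if_splits)
  then have "c \<in> reach H" using exterior_at_corner assms by blast
  then have "rev_dart c \<in> reach H" using reach_rev[of c H] notin assms by (auto simp: darts_at_def)
  then show ?thesis using assms(5) unfolding exterior_at_def darts_at_def
    by (intro bexI[of _ "rev_dart c"]) simp_all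
qed

text \<open>A path that meets \<open>H\<close> only in its last vertex connects the exterior face to a corner there, since its
  edges can be crossed. This applies to paths from the source of \<open>G\<close>, and dually to paths to the target.\<close>

lemma exterior_at_forward:
  assumes H: "subgraph H (ug G)" and low: "\<And>v. v \<in> verts H \<Longrightarrow> rank x \<le> rank v"
  shows "p \<in> paths u x \<Longrightarrow> exterior_at H u \<Longrightarrow> exterior_at H x"
proof (induction p arbitrary: u)
  case (Cons e p)
  then have e: "e \<in> arcs (ug G)" "tail (ug G) e = u" "p \<in> paths (head (ug G) e) x" by (auto simp: Cons_in_paths)
  have "rank u < rank x" using paths_rank[OF e(3)] rank_less[OF e(1)] e(2) by simp
  then have "u \<notin> verts H" using low by force
  then have "exterior_at H (head (ug G) e)"
    using exterior_at_edge[of H u "(e, True)"] Cons.prems e H by (auto simp: darts_at_def origin_def subgraph_def)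
  then show ?case using Cons.IH e by blast
qed (auto simp: paths_refl)

lemma exterior_at_backward:
  assumes H: "subgraph H (ug G)" and high: "\<And>v. v \<in> verts H \<Longrightarrow> rank v \<le> rank y"
  shows "p \<in> paths y u \<Longrightarrow> exterior_at H u \<Longrightarrow> exterior_at H y"
proof (induction p arbitrary: u rule: rev_induct)
  case (snoc e p)
  then obtain w where "p \<in> paths y w" "[e] \<in> paths w u" by (auto elim: paths_appendE)
  then have e: "e \<in> arcs (ug G)" "head (ug G) e = u" "p \<in> paths y (tail (ug G) e)" by (auto simp: Cons_in_paths)
  have "rank y < rank u" using paths_rank[OF e(3)] rank_less[OF e(1)] e(2) by simp
  then have "u \<notin> verts H" using high by force
  then have "exterior_at H (tail (ug G) e)"
    using exterior_at_edge[of H u "(e, False)"] snoc.prems e H by (auto simp: darts_at_def origin_def subgraph_def)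
  then show ?case using snoc.IH e by blast
qed (auto simp: paths_refl)

lemma source_target:
  assumes "arcs (ug G) \<noteq> {}"
  obtains s t where "is_source (ug G) s" "exterior_at H s" "is_target (ug G) t" "exterior_at H t"
proof -
  have "\<exists>!v. is_source (ug G) v" "\<exists>!v. is_target (ug G) v"
    "incident_exterior G (src (ug G))" "incident_exterior G (tgt (ug G))"
    using st[OF assms] by (simp_all add: st_graph_def)
  moreover have "exterior_at H v" if v: "incident_exterior G v" for v
  proof -
    obtain d where "d \<in> ext G" "origin (ug G) d = v" using v by (auto simp: incident_exterior_def)
    then show ?thesis using ext_reach face_subset[OF ext_in_faces]
      unfolding exterior_at_def darts_at_def by blast
  qed
  ultimately show ?thesis using that[of "src (ug G)" "tgt (ug G)"] theI'[of "is_source (ug G)"] theI'[of "is_target (ug G)"]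
    unfolding src_def tgt_def by blast
qed

end

text \<open>A nonempty set of parallel paths without edges consists of one trivial path; its union has no darts and
  is left aside here.\<close>

locale union_of_paths = acyclic_plane G for G :: "('v, 'e) plane" +
  fixes P :: "'e list set" and x y :: 'v
  assumes P: "P \<subseteq> paths x y" and edge: "arcs (paths_union x P) \<noteq> {}"
begin

definition "H = paths_union x P"

lemma H_sub: "subgraph H (ug G)"
  unfolding H_def by (rule paths_union_subgraph[OF P])

lemma H_simps [simp]: "tail H = tail (ug G)" "head H = head (ug G)" "origin H = origin (ug G)" "arcs H \<noteq> {}"
  using subgraph_fields[OF H_sub] edge by (auto simp: H_def)

lemma P_ne: "P \<noteq> {}"
  using edge by (auto simp: paths_union_simps)

lemma H_vertexE:
  assumes "v \<in> verts H"
  obtains p q where "p @ q \<in> P" "p \<in> paths x v" "q \<in> paths v y"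
  using paths_union_vertexE[OF P] assms unfolding H_def by blast

lemma H_arcs_sub: "arcs H \<subseteq> arcs (ug G)"
  using H_sub by (simp add: subgraph_def)

lemma H_ends: "e \<in> arcs H \<Longrightarrow> tail (ug G) e \<in> verts H" "e \<in> arcs H \<Longrightarrow> head (ug G) e \<in> verts H"
  using H_sub wf_digraph.tail_in_verts[of H e] wf_digraph.head_in_verts[of H e] by (auto simp: subgraph_def)

lemma H_rank:
  assumes "v \<in> verts H" shows "rank x \<le> rank v" "rank v \<le> rank y"
  using H_vertexE[OF assms] paths_rank by (metis add_leD1)+

lemma x_neq_y: "x \<noteq> y"
  using edge P paths_refl[of x] by (auto simp: paths_union_simps split: if_splits)

sublocale Hr: rotation_system "induced G H"
  by (rule induced_rotation_system[OF H_sub])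

abbreviation "rotH \<equiv> rot (induced G H)"
abbreviation "nextH \<equiv> face_next (induced G H)"

lemma finite_DH: "finite (darts H)"
  using Hr.finite_D by simp

text \<open>At an inner vertex, incoming and outgoing darts occur; along a face, edges are traversed in both
  directions, because the graph is acyclic.\<close>

lemma inner_switches:
  assumes "v \<in> verts H - {x, y}"
  shows "2 \<le> card {d \<in> Hr.darts_at v. snd d \<noteq> snd (rotH d)}"
proof -
  obtain p q where pq: "p @ q \<in> P" "p \<in> paths x v" "q \<in> paths v y" using H_vertexE assms by blast
  have "p \<noteq> []" "q \<noteq> []" using pq assms by auto
  then obtain a p' b q' where ab: "p = p' @ [a]" "q = b # q'" by (metis neq_Nil_conv rev_exhaust)
  have "p' @ [a] \<in> paths x v" using pq ab by simp
  then have "head (ug G) a = v" by (elim paths_appendE) (simp add: Cons_in_paths)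
  moreover have "tail (ug G) b = v" using pq ab by (simp add: Cons_in_paths)
  moreover have "a \<in> arcs H" "b \<in> arcs H" using pq ab by (force simp: H_def paths_union_simps)+
  ultimately have d: "(b, True) \<in> Hr.darts_at v" "(a, False) \<in> Hr.darts_at v"
    by (auto simp: Hr.darts_at_def origin_def)
  then have "cyclic_on rotH (Hr.darts_at v)" using Hr.cyc unfolding Hr.darts_at_def by blast
  then show ?thesis by (rule cyclic_on_switches[OF _ d(1) _ d(2)]) simp_all
qed

lemma face_both_directions:
  assumes "A \<in> faces (induced G H)"
  shows "\<exists>d\<in>A. snd d" "\<exists>d\<in>A. \<not> snd d"
proof -
  have cyc: "cyclic_on nextH A" using Hr.face_cyclic assms by simp
  have A: "finite A" "A \<noteq> {}" "A \<subseteq> darts H"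
    using finite_cyclic_on[OF cyc] cyc Hr.face_subset[OF assms] by (auto simp: cyclic_on_alldef)
  have next_in: "nextH d \<in> A" if "d \<in> A" for d using cyclic_on_inI[OF cyc that] .
  have origin_next: "origin (ug G) (nextH d) = origin (ug G) (rev_dart d)" if "d \<in> A" for d
    using Hr.origin_face_next[of d] A that by auto
  let ?r = "\<lambda>d. rank (origin (ug G) d)"
  show "\<exists>d\<in>A. snd d"
  proof (rule ccontr)
    assume no: "\<not> ?thesis"
    have "Min (?r ` A) \<in> ?r ` A" using A by (intro Min_in) auto
    then obtain d where "Min (?r ` A) = ?r d" "d \<in> A" by (rule imageE)
    then have d: "d \<in> A" "\<forall>c\<in>A. ?r d \<le> ?r c"
      using Min_le[OF finite_imageI[OF A(1)] imageI, of _ ?r] by simp_all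
    have "fst d \<in> arcs (ug G)" "\<not> snd d" using subsetD[OF A(3) d(1)] d(1) H_arcs_sub no by auto
    then have "?r (nextH d) < ?r d"
      unfolding origin_next[OF d(1)] using rank_less[of "fst d"] by (simp add: origin_def)
    then show False using d next_in by fastforce
  qed
  show "\<exists>d\<in>A. \<not> snd d"
  proof (rule ccontr)
    assume no: "\<not> ?thesis"
    have "Max (?r ` A) \<in> ?r ` A" using A by (intro Max_in) auto
    then obtain d where "Max (?r ` A) = ?r d" "d \<in> A" by (rule imageE)
    then have d: "d \<in> A" "\<forall>c\<in>A. ?r c \<le> ?r d"
      using Max_ge[OF finite_imageI[OF A(1)] imageI, of _ ?r] by simp_all
    have "fst d \<in> arcs (ug G)" "snd d" using subsetD[OF A(3) d(1)] d(1) H_arcs_sub no by auto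
    then have "?r d < ?r (nextH d)"
      unfolding origin_next[OF d(1)] using rank_less[of "fst d"] by (simp add: origin_def)
    then show False using d next_in by fastforce
  qed
qed

abbreviation face_switches :: "'e dart set \<Rightarrow> nat" where
  "face_switches A \<equiv> card {d \<in> A. snd d \<noteq> snd (nextH d)}"

lemma face_switches_ge:
  assumes "A \<in> faces (induced G H)"
  shows "2 \<le> face_switches A"
proof -
  obtain c d where "c \<in> A" "snd c" "d \<in> A" "\<not> snd d" using face_both_directions[OF assms] by blast
  then show ?thesis using cyclic_on_switches[OF Hr.face_cyclic[OF _ assms], of c snd d] by simp
qed

text \<open>Each corner is a change of direction either for its vertex or for its face, and there are twice as many
  corners as edges.\<close>

lemma total_switches:
  "card {d \<in> darts H. snd d \<noteq> snd (rotH d)} + (\<Sum>A\<in>faces (induced G H). face_switches A) = 2 * card (arcs H)"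
proof -
  let ?S = "{d \<in> darts H. snd d \<noteq> snd (rotH d)}" and ?F = "{d \<in> darts H. snd d \<noteq> snd (nextH d)}"
  have "?F = rev_dart ` (darts H - ?S)"
  proof
    show "?F \<subseteq> rev_dart ` (darts H - ?S)"
    proof
      fix d assume "d \<in> ?F"
      then have "rev_dart d \<in> darts H - ?S" by (simp add: face_next_def)
      then show "d \<in> rev_dart ` (darts H - ?S)" by (rule image_eqI[rotated]) simp
    qed
    show "rev_dart ` (darts H - ?S) \<subseteq> ?F" by (auto simp: face_next_def)
  qed
  moreover have "inj_on rev_dart (darts H - ?S)" by (rule inj_on_inverseI[of _ rev_dart]) simp
  ultimately have "card ?F = card (darts H - ?S)" by (simp add: card_image)
  also have "\<dots> = card (darts H) - card ?S" by (intro card_Diff_subset finite_subset[OF _ finite_DH]) auto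
  finally have 1: "card ?S + card ?F = card (darts H)"
    using card_mono[of "darts H" ?S] finite_DH by fastforce
  have DH: "darts H = \<Union> (faces (induced G H))" using Hr.Union_faces by simp
  have "?F = (\<Union>A\<in>faces (induced G H). {d \<in> A. snd d \<noteq> snd (nextH d)})"
    unfolding DH by blast
  also have "card \<dots> = (\<Sum>A\<in>faces (induced G H). face_switches A)"
  proof (rule card_UN_disjoint)
    show "\<forall>A\<in>faces (induced G H). finite {d \<in> A. snd d \<noteq> snd (nextH d)}"
    proof
      fix A assume "A \<in> faces (induced G H)"
      then have "finite A" using finite_subset[OF Hr.face_subset] finite_DH by simp
      then show "finite {d \<in> A. snd d \<noteq> snd (nextH d)}" by simp
    qed
    show "\<forall>A\<in>faces (induced G H). \<forall>B\<in>faces (induced G H). A \<noteq> B \<longrightarrow>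
        {d \<in> A. snd d \<noteq> snd (nextH d)} \<inter> {d \<in> B. snd d \<noteq> snd (nextH d)} = {}"
      using Hr.faces_disjoint by (metis (no_types, lifting) H_simps(4) disjoint_iff mem_Collect_eq ug_induced)
  qed (rule Hr.finite_faces)
  finally show ?thesis using 1 card_darts[of H] Hr.finite_arcs by simp
qed

lemma vertex_switches: "2 * card (verts H) \<le> card {d \<in> darts H. snd d \<noteq> snd (rotH d)} + 4"
proof -
  let ?V = "verts H - {x, y}"
  have fin: "finite (Hr.darts_at v)" for v
    by (rule finite_subset[OF _ finite_DH]) (auto simp: Hr.darts_at_def)
  have "2 * card ?V = (\<Sum>v\<in>?V. 2)" by simp
  also have "\<dots> \<le> (\<Sum>v\<in>?V. card {d \<in> Hr.darts_at v. snd d \<noteq> snd (rotH d)})"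
    using inner_switches by (intro sum_mono) blast
  also have "\<dots> = card (\<Union>v\<in>?V. {d \<in> Hr.darts_at v. snd d \<noteq> snd (rotH d)})"
    using Hr.finite_verts fin by (intro card_UN_disjoint[symmetric]) (simp, simp, fastforce simp: Hr.darts_at_def)
  also have "\<dots> \<le> card {d \<in> darts H. snd d \<noteq> snd (rotH d)}"
    by (intro card_mono finite_subset[OF _ finite_DH]) (auto simp: Hr.darts_at_def)
  finally have "2 * card ?V \<le> card {d \<in> darts H. snd d \<noteq> snd (rotH d)}" .
  moreover have "card (verts H) \<le> card (?V \<union> {x, y})"
    using Hr.finite_verts by (intro card_mono) auto
  moreover have "card (?V \<union> {x, y}) \<le> card ?V + card {x, y}" by (rule card_Un_le)
  ultimately show ?thesis using x_neq_y by simp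
qed

text \<open>There are at least two changes of direction at each inner vertex and along each face. By Euler's
  inequality there is no room for more.\<close>

lemma euler_H: "card (arcs H) + 2 = card (verts H) + card (faces (induced G H))"
  and two_switches: "A \<in> faces (induced G H) \<Longrightarrow> face_switches A = 2"
proof -
  have ge: "card (arcs H) + 2 \<le> card (verts H) + card (faces (induced G H))"
    by (rule euler_subgraph(1)[OF H_sub]) simp
  have "(\<Sum>A\<in>faces (induced G H). 2) \<le> (\<Sum>A\<in>faces (induced G H). face_switches A)"
    using face_switches_ge by (rule sum_mono)
  then have le: "2 * card (faces (induced G H)) \<le> (\<Sum>A\<in>faces (induced G H). face_switches A)" by simp
  show "card (arcs H) + 2 = card (verts H) + card (faces (induced G H))"
    using ge le total_switches vertex_switches by linarith
  have eq: "(\<Sum>A\<in>faces (induced G H). face_switches A) = (\<Sum>A\<in>faces (induced G H). 2)"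
    using ge le total_switches vertex_switches by simp
  assume A: "A \<in> faces (induced G H)"
  show "face_switches A = 2"
  proof (rule ccontr)
    assume "face_switches A \<noteq> 2"
    then have "2 < face_switches A" using face_switches_ge[OF A] by simp
    then have "(\<Sum>A\<in>faces (induced G H). 2) < (\<Sum>A\<in>faces (induced G H). face_switches A)"
      using A face_switches_ge by (intro sum_strict_mono_ex1[OF Hr.finite_faces]) auto
    then show False using eq by simp
  qed
qed

end

context acyclic_plane
begin

text \<open>The third assumption is what holds for consecutive darts along a face.\<close>

lemma forward_darts_path:
  assumes "xs \<noteq> []" "\<And>d. d \<in> set xs \<Longrightarrow> snd d \<and> fst d \<in> arcs (ug G)"
    "\<And>i. Suc i < length xs \<Longrightarrow> origin (ug G) (xs ! Suc i) = origin (ug G) (rev_dart (xs ! i))"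
  shows "map fst xs \<in> paths (origin (ug G) (hd xs)) (origin (ug G) (rev_dart (last xs)))"
  using assms
proof (induction xs)
  case (Cons d xs)
  have d: "snd d" "fst d \<in> arcs (ug G)" using Cons.prems(2)[of d] by auto
  show ?case
  proof (cases "xs = []")
    case True
    then show ?thesis using d by (simp add: Cons_in_paths origin_def)
  next
    case False
    have "map fst xs \<in> paths (origin (ug G) (hd xs)) (origin (ug G) (rev_dart (last xs)))"
      using False Cons.prems(2) Cons.prems(3)[of "Suc i" for i] by (intro Cons.IH) auto
    moreover have "origin (ug G) (hd xs) = head (ug G) (fst d)"
      using Cons.prems(3)[of 0] False d by (auto simp: hd_conv_nth origin_def)
    ultimately show ?thesis using False d by (simp add: Cons_in_paths origin_def)
  qed
qed simp

end

context union_of_paths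
begin

text \<open>The source and the target of \<open>G\<close> lie on the exterior face, and paths from the source to \<open>x\<close> and from \<open>y\<close>
  to the target meet \<open>H\<close> only in \<open>x\<close> and \<open>y\<close>.\<close>

lemma exterior_ends:
  shows "\<exists>d\<in>ext (induced G H). origin (ug G) d = x" "\<exists>d\<in>ext (induced G H). origin (ug G) d = y"
proof -
  have "arcs (ug G) \<noteq> {}" using H_arcs_sub H_simps(4) by blast
  then obtain s t where st: "is_source (ug G) s" "exterior_at H s" "is_target (ug G) t" "exterior_at H t"
    using source_target by blast
  obtain p where p: "p \<in> P" "p \<in> paths x y" using P P_ne by auto
  have "\<exists>a. a \<in> paths s x" "\<exists>b. b \<in> paths y t"
    using st(1,3) paths_verts[OF p(2)] by (auto simp: is_source_def is_target_def dpath_iff)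
  then have ext: "exterior_at H x" "exterior_at H y"
    using exterior_at_forward[OF H_sub, of x] exterior_at_backward[OF H_sub, of y] H_rank st by blast+
  have "p \<noteq> []" using p x_neq_y by auto
  then obtain a p' b q' where ab: "p = a # p'" "p = q' @ [b]" by (metis neq_Nil_conv rev_exhaust)
  have "q' @ [b] \<in> paths x y" using p ab by simp
  then have "head (ug G) b = y" by (elim paths_appendE) (simp add: Cons_in_paths)
  moreover have "tail (ug G) a = x" using p ab by (simp add: Cons_in_paths)
  moreover have "a \<in> set p" unfolding ab(1) by simp
  moreover have "b \<in> set p" unfolding ab(2) by simp
  ultimately have corner: "(a, True) \<in> darts_at x \<inter> darts H" "(b, False) \<in> darts_at y \<inter> darts H"
    using p(1) H_arcs_sub by (auto simp: darts_at_def origin_def H_def paths_union_simps)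
  have "\<exists>d\<in>darts_at x. d \<in> darts H \<and> d \<in> reach H"
    using exterior_at_corner[OF ext(1)] corner(1) by blast
  then show "\<exists>d\<in>ext (induced G H). origin (ug G) d = x"
    unfolding induced_def darts_at_def by auto
  have "\<exists>d\<in>darts_at y. d \<in> darts H \<and> d \<in> reach H"
    using exterior_at_corner[OF ext(2)] corner(2) by blast
  then show "\<exists>d\<in>ext (induced G H). origin (ug G) d = y"
    unfolding induced_def darts_at_def by auto
qed

lemma ext_induced: "ext (induced G H) = darts H \<inter> reach H"
  by (simp add: induced_def)

text \<open>The darts declared exterior in the induced embedding form a single face: by Euler's formula, the faces
  of \<open>H\<close> are exactly the classes of faces of \<open>G\<close> merged by deleting edges.\<close>

lemma ext_face: "ext (induced G H) \<in> faces (induced G H)"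
proof -
  obtain d0 where d0: "d0 \<in> darts H" "d0 \<in> reach H" using exterior_ends(1) unfolding ext_induced by blast
  obtain A where A: "A \<in> faces (induced G H)" "d0 \<in> A" using Hr.Union_faces d0 by fastforce
  have cyc: "cyclic_on nextH A" using Hr.face_cyclic A by simp
  have "A \<in> Hr.face_sets" unfolding Hr.face_sets_def
  proof (intro CollectI conjI ballI)
    show "A \<subseteq> darts (ug (induced G H))" by (rule Hr.face_subset[OF A(1)])
    fix d assume "d \<in> darts (ug (induced G H))"
    then obtain B where B: "B \<in> faces (induced G H)" "d \<in> B" using Hr.Union_faces by blast
    have "nextH d \<in> B" using cyclic_on_inI[OF Hr.face_cyclic[OF _ B(1)] B(2)] by simp
    then show "nextH d \<in> A \<longleftrightarrow> d \<in> A"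
      using Hr.faces_disjoint[OF _ A(1) B(1)] B(2) cyclic_on_inI[OF cyc] by fastforce
  qed
  then obtain X where X: "X \<in> merged_sets H" "A = X \<inter> darts H"
    using euler_subgraph(2)[OF H_sub _ euler_H] by auto
  have X': "X \<in> face_sets" using X by (simp add: merged_sets_def)
  have step: "a \<in> X \<longleftrightarrow> b \<in> X" if "(a, b) \<in> merge_step G H" for a b
    using that X(1) by (auto simp: merge_step_def merged_sets_def face_sets_def)
  have steps: "a \<in> X \<longleftrightarrow> b \<in> X" if "(a, b) \<in> (merge_step G H)\<^sup>*" for a b
    using that by induction (use step in auto)
  have "\<exists>c\<in>ext G. c \<in> X" using d0 A(2) X(2) steps by blast
  then have "ext G \<subseteq> X" using face_in_face_set[OF X' ext_in_faces] H_arcs_sub H_simps(4) by blast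
  then have "reach H \<subseteq> X" using steps by blast
  then have "ext (induced G H) \<subseteq> A" unfolding ext_induced using X by blast
  moreover have "A \<subseteq> ext (induced G H)"
  proof
    fix a assume a: "a \<in> A"
    have "a \<in> reach H"
    proof (rule cyclic_on_invariant[OF cyc A(2), of "\<lambda>d. d \<in> reach H"])
      fix d assume d: "d \<in> A" "d \<in> reach H"
      then have dH: "d \<in> darts H" using X by blast
      have "face_next G d \<in> reach H" using reach_face_next[of d H] d(2) dH H_arcs_sub by auto
      then show "nextH d \<in> reach H" unfolding face_next_def
        by (rule induced_rot_invariant[OF H_sub, rotated]) (use dH reach_rot in auto)
    qed (use a d0 in auto)
    then show "a \<in> ext (induced G H)" unfolding ext_induced using a X by blast
  qed
  ultimately show ?thesis using A(1) by simp
qed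

text \<open>With exactly two changes of direction, the boundary is a forward walk followed by a backward one.\<close>

lemma face_globular:
  assumes A: "A \<in> faces (induced G H)"
  obtains p q where "globular_face (induced G H) A p q"
proof -
  have cyc: "cyclic_on nextH A" using Hr.face_cyclic A by simp
  obtain a b where "a \<in> A" "snd a" "b \<in> A" "\<not> snd b" using face_both_directions[OF A] by blast
  from cyclic_on_two_switches[of nextH A a snd b, OF cyc this two_switches[OF A]]
  obtain xs ys where xy: "xs \<noteq> []" "ys \<noteq> []" "set (xs @ ys) = A" "distinct (xs @ ys)"
    "\<forall>i<length (xs @ ys). nextH ((xs @ ys) ! i) = (xs @ ys) ! (Suc i mod length (xs @ ys))"
    "\<forall>d\<in>set xs. snd d" "\<forall>d\<in>set ys. \<not> snd d" .
  have A_sub: "A \<subseteq> darts H" using Hr.face_subset[OF A] by simp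
  have orig: "origin (ug G) (nextH d) = origin (ug G) (rev_dart d)" if "d \<in> A" for d
    using Hr.origin_face_next[of d] A_sub that by auto
  have in_H: "fst d \<in> arcs H" if "d \<in> set (xs @ ys)" for d
    using subsetD[OF A_sub, of d] that unfolding xy(3) by simp
  let ?zs = "xs @ ys"
  have succ: "origin (ug G) (?zs ! (Suc i mod length ?zs)) = origin (ug G) (rev_dart (?zs ! i))"
    if "i < length ?zs" for i
  proof -
    have "?zs ! i \<in> A" using that xy(3) nth_mem by blast
    then show ?thesis using orig xy(5) that by metis
  qed
  define p where "p = map fst xs"
  define q where "q = rev (map fst ys)"
  define zs where "zs = rev (map rev_dart ys)"
  have p: "p \<in> paths (origin (ug G) (hd xs)) (origin (ug G) (rev_dart (last xs)))"
    unfolding p_def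
  proof (rule forward_darts_path)
    show "snd d \<and> fst d \<in> arcs (ug G)" if "d \<in> set xs" for d
      using in_H[of d] that xy(6) H_arcs_sub by auto
    show "origin (ug G) (xs ! Suc i) = origin (ug G) (rev_dart (xs ! i))" if "Suc i < length xs" for i
      using succ[of i] that by (simp add: nth_append)
  qed (rule xy)
  have "map fst zs \<in> paths (origin (ug G) (hd zs)) (origin (ug G) (rev_dart (last zs)))"
  proof (rule forward_darts_path)
    show "zs \<noteq> []" using xy(2) by (simp add: zs_def)
    show "snd d \<and> fst d \<in> arcs (ug G)" if "d \<in> set zs" for d
      using in_H[of "rev_dart d"] that xy(7) H_arcs_sub by (auto simp: zs_def)
    show "origin (ug G) (zs ! Suc i) = origin (ug G) (rev_dart (zs ! i))" if i: "Suc i < length zs" for i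
    proof -
      define j where "j = length ys - Suc (Suc i)"
      have j: "Suc j < length ys" "length ys - Suc i = Suc j" using i by (auto simp: j_def zs_def)
      have "origin (ug G) (ys ! Suc j) = origin (ug G) (rev_dart (ys ! j))"
        using succ[of "length xs + j"] j by (simp add: nth_append)
      moreover have "zs ! Suc i = rev_dart (ys ! j)" "zs ! i = rev_dart (ys ! Suc j)"
        using i j by (simp_all add: zs_def rev_nth j_def)
      ultimately show ?thesis by simp
    qed
  qed
  moreover have "map fst zs = q" by (simp add: zs_def q_def rev_map comp_def)
  moreover have "hd zs = rev_dart (last ys)" "last zs = rev_dart (hd ys)"
    using xy(2) by (simp_all add: zs_def hd_rev last_rev last_map hd_map)
  ultimately have q: "q \<in> paths (origin (ug G) (rev_dart (last ys))) (origin (ug G) (hd ys))" by simp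
  have "0 < length xs" using xy(1) by simp
  then have lt: "length xs - 1 < length ?zs" "length xs + length ys - 1 < length ?zs"
    unfolding length_append by linarith+
  have "origin (ug G) (hd ys) = origin (ug G) (rev_dart (last xs))"
    using succ[OF lt(1)] xy(1,2) by (simp add: nth_append last_conv_nth hd_conv_nth)
  moreover have "origin (ug G) (hd xs) = origin (ug G) (rev_dart (last ys))"
  proof -
    have "?zs ! (length xs + length ys - 1) = last ys"
      using xy(1,2) last_conv_nth[of ?zs] by simp
    moreover have "Suc (length xs + length ys - 1) mod length ?zs = 0" using \<open>0 < length xs\<close> by simp
    moreover have "?zs ! 0 = hd xs" using xy(1) by (simp add: nth_append hd_conv_nth)
    ultimately show ?thesis using succ[OF lt(2)] by simp
  qed
  ultimately have pq: "p \<in> paths (origin (ug G) (hd xs)) (origin (ug G) (hd ys))"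
      "q \<in> paths (origin (ug G) (hd xs)) (origin (ug G) (hd ys))"
    using p q by auto
  have "hd xs \<in> set (xs @ ys)" using xy(1) by simp
  then have "origin (ug G) (hd xs) \<in> verts H"
    using in_H H_ends by (auto simp: origin_def)
  then have dp: "dpath (ug (induced G H)) (origin (ug G) (hd xs)) p (origin (ug G) (hd ys))"
      "dpath (ug (induced G H)) (origin (ug G) (hd xs)) q (origin (ug G) (hd ys))"
    using pq in_H unfolding ug_induced dpath_subgraph_iff[OF H_sub] by (auto simp: p_def q_def)
  have "path_darts p = xs"
    using xy(6) by (auto simp: path_darts_def p_def comp_def intro!: map_idI)
  moreover have "op_path_darts q = ys"
    using xy(7) by (auto simp: op_path_darts_def q_def comp_def rev_map intro!: map_idI)
  ultimately have "face_boundary (induced G H) A (path_darts p @ op_path_darts q)"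
    using xy by (simp add: face_boundary_def)
  then have "globular_face (induced G H) A p q"
    unfolding globular_face_def using dp xy by (auto simp: p_def q_def)
  then show ?thesis by (rule that)
qed

lemma H_globular: "globular (induced G H)"
proof -
  note ends = paths_union_ends[OF P P_ne, folded H_def]
  have "\<exists>!v. is_source H v" "\<exists>!v. is_target H v"
    using ends source_unique[OF H_sub] target_unique[OF H_sub] by blast+
  moreover have "incident_exterior (induced G H) x" "incident_exterior (induced G H) y"
    using exterior_ends by (auto simp: incident_exterior_def)
  ultimately have "st_graph (induced G H)" using ends by (simp add: st_graph_def)
  then show ?thesis unfolding globular_def using face_globular by metis
qed

text \<open>Both \<open>x\<close> and \<open>y\<close> lie on the exterior face. As no edge of \<open>H\<close> ends at \<open>x\<close> or starts at \<open>y\<close>, they are the ends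
  of the two paths that bound it.\<close>

lemma exterior_paths:
  obtains p q where "p \<in> paths x y" "q \<in> paths x y" "set p \<subseteq> arcs H" "set q \<subseteq> arcs H"
    "globular_face (induced G H) (ext (induced G H)) q p"
proof -
  obtain p q where g: "globular_face (induced G H) (ext (induced G H)) q p"
    using face_globular[OF ext_face] .
  obtain u v where "dpath H u q v" "dpath H u p v" using g by (auto simp: globular_face_def)
  then have pq: "q \<in> paths u v" "p \<in> paths u v" "u \<in> verts H" "set p \<subseteq> arcs H" "set q \<subseteq> arcs H"
    unfolding dpath_subgraph_iff[OF H_sub] by auto
  have ext: "ext (induced G H) = (\<lambda>e. (e, True)) ` set q \<union> (\<lambda>e. (e, False)) ` set p"
    using g by (auto simp: globular_face_def face_boundary_def path_darts_def op_path_darts_def)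
  have "\<exists>e\<in>set q. tail (ug G) e = x"
  proof -
    obtain d where d: "d \<in> ext (induced G H)" "origin (ug G) d = x" using exterior_ends(1) by blast
    show ?thesis
    proof (cases "snd d")
      case True
      then show ?thesis using d ext by (auto simp: origin_def)
    next
      case False
      then have e: "fst d \<in> arcs H" "head (ug G) (fst d) = x" using d ext pq by (auto simp: origin_def)
      then have "rank (tail (ug G) (fst d)) < rank x" using rank_less[of "fst d"] H_arcs_sub by auto
      then show ?thesis using H_rank(1)[OF H_ends(1)[OF e(1)]] by simp
    qed
  qed
  then obtain r where r: "r \<in> paths u x" using edge_split[OF pq(1)] by metis
  then have u: "u = x" using paths_rank_less[OF r] H_rank(1)[OF pq(3)] by (cases "u = x") auto
  have "\<exists>e\<in>set p. head (ug G) e = y"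
  proof -
    obtain d where d: "d \<in> ext (induced G H)" "origin (ug G) d = y" using exterior_ends(2) by blast
    show ?thesis
    proof (cases "snd d")
      case False
      then show ?thesis using d ext by (auto simp: origin_def)
    next
      case True
      then have e: "fst d \<in> arcs H" "tail (ug G) (fst d) = y" using d ext pq by (auto simp: origin_def)
      then have "rank y < rank (head (ug G) (fst d))" using rank_less[of "fst d"] H_arcs_sub by auto
      then show ?thesis using H_rank(2)[OF H_ends(2)[OF e(1)]] by simp
    qed
  qed
  then obtain r' where r': "r' \<in> paths y v" using edge_split[OF pq(2)] by metis
  have "v = y"
  proof (rule ccontr)
    assume "v \<noteq> y"
    have "p \<noteq> []" using g by (simp add: globular_face_def)
    then obtain p' b where b: "p = p' @ [b]" by (metis rev_exhaust)
    then have "p' @ [b] \<in> paths u v" using pq by simp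
    then have "head (ug G) b = v" by (elim paths_appendE) (simp add: Cons_in_paths)
    then have "v \<in> verts H" using H_ends(2)[of b] pq b by auto
    then show False using H_rank(2) paths_rank_less[OF r'] \<open>v \<noteq> y\<close> by fastforce
  qed
  then show ?thesis using that[of p q] pq u g by simp
qed

end

section \<open>The order on parallel paths\<close>

context acyclic_plane
begin

lemma paths_union_globular:
  assumes "P \<subseteq> paths x y" "P \<noteq> {}"
  shows "globular_sub G (paths_union x P)"
proof (cases "arcs (paths_union x P) = {}")
  case True
  then have nil: "p = []" if "p \<in> P" for p using that by (auto simp: paths_union_simps)
  then have "P = {[]}" using assms(2) by blast
  then have "verts (paths_union x P) = {x}" by (simp add: paths_union_simps)
  then have "globular (induced G (paths_union x P))" using True by (simp add: globular_def)
  then show ?thesis using paths_union_subgraph[OF assms(1)] by (simp add: globular_sub_def)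
next
  case False
  interpret union_of_paths G P x y by unfold_locales (use assms False in auto)
  show ?thesis using H_globular H_sub unfolding H_def globular_sub_def by simp
qed

text \<open>\<open>p \<sqsubseteq> q\<close> means that the closed walk \<open>p q\<^sup>o\<^sup>p\<close> has nonnegative winding number around every face;
  \<open>w d\<close> is the winding number around the face to the right of the dart \<open>d\<close>. Unlike the existence of a
  witness, this condition is visibly transitive and compatible with concatenation.\<close>

definition left_of :: "'e list \<Rightarrow> 'e list \<Rightarrow> bool" (infix "\<sqsubseteq>" 50) where
  "p \<sqsubseteq> q \<longleftrightarrow> (\<exists>w :: 'e dart \<Rightarrow> int.
    (\<forall>d\<in>D. w (face_next G d) = w d) \<and> (\<forall>d\<in>ext G. w d = 0) \<and> (\<forall>d\<in>D. 0 \<le> w d) \<and>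
    (\<forall>e\<in>arcs (ug G). w (e, True) - w (e, False) = of_bool (e \<in> set p) - of_bool (e \<in> set q)))"

lemma left_of_refl: "p \<sqsubseteq> p"
  unfolding left_of_def by (rule exI[of _ "\<lambda>_. 0"]) simp

text \<open>Winding numbers of different closed walks add up.\<close>

lemma left_of_add:
  assumes "p \<sqsubseteq> q" "p' \<sqsubseteq> q'"
    and "\<And>e. e \<in> arcs (ug G) \<Longrightarrow> (of_bool (e \<in> set r) :: int) - of_bool (e \<in> set r') =
      (of_bool (e \<in> set p) - of_bool (e \<in> set q)) + (of_bool (e \<in> set p') - of_bool (e \<in> set q'))"
  shows "r \<sqsubseteq> r'"
proof -
  obtain w where w: "\<forall>d\<in>D. w (face_next G d) = w d" "\<forall>d\<in>ext G. w d = 0" "\<forall>d\<in>D. 0 \<le> w d"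
    "\<forall>e\<in>arcs (ug G). w (e, True) - w (e, False) = (of_bool (e \<in> set p) - of_bool (e \<in> set q) :: int)"
    using assms(1) unfolding left_of_def by blast
  obtain w' where w': "\<forall>d\<in>D. w' (face_next G d) = w' d" "\<forall>d\<in>ext G. w' d = 0" "\<forall>d\<in>D. 0 \<le> w' d"
    "\<forall>e\<in>arcs (ug G). w' (e, True) - w' (e, False) = (of_bool (e \<in> set p') - of_bool (e \<in> set q') :: int)"
    using assms(2) unfolding left_of_def by blast
  have "(w (e, True) + w' (e, True)) - (w (e, False) + w' (e, False)) = of_bool (e \<in> set r) - of_bool (e \<in> set r')"
    if e: "e \<in> arcs (ug G)" for e
    using bspec[OF w(4) e] bspec[OF w'(4) e] assms(3)[OF e] by linarith
  then show ?thesis unfolding left_of_def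
    by (intro exI[of _ "\<lambda>d. w d + w' d"]) (use w w' in auto)
qed

lemma left_of_trans: "p \<sqsubseteq> q \<Longrightarrow> q \<sqsubseteq> r \<Longrightarrow> p \<sqsubseteq> r"
  by (rule left_of_add[of p q q r]) simp_all

lemma append_disjoint:
  assumes "p \<in> paths x y" "q \<in> paths y z"
  shows "set p \<inter> set q = {}"
  using paths_distinct[OF append_in_paths[OF assms]] by simp

lemma of_bool_append:
  assumes "p \<in> paths x y" "q \<in> paths y z"
  shows "(of_bool (e \<in> set (p @ q)) :: int) = of_bool (e \<in> set p) + of_bool (e \<in> set q)"
  using append_disjoint[OF assms] by (cases "e \<in> set p") auto

lemma left_of_append:
  assumes "p \<sqsubseteq> p'" "q \<sqsubseteq> q'" "p \<in> paths x y" "p' \<in> paths x y" "q \<in> paths y z" "q' \<in> paths y z"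
  shows "p @ q \<sqsubseteq> p' @ q'"
  by (rule left_of_add[OF assms(1,2)])
    (simp only: of_bool_append[OF assms(3,5)] of_bool_append[OF assms(4,6)])

text \<open>If the exterior boundary of a subgraph is \<open>q p\<^sup>o\<^sup>p\<close>, then the closed walk \<open>p q\<^sup>o\<^sup>p\<close> winds once around
  each face that is not merged with the exterior one.\<close>

lemma left_of_exterior:
  assumes H: "subgraph H (ug G)" and pq: "set p \<subseteq> arcs H" "set q \<subseteq> arcs H"
    and ext: "ext (induced G H) = (\<lambda>e. (e, True)) ` set q \<union> (\<lambda>e. (e, False)) ` set p"
  shows "p \<sqsubseteq> q"
proof -
  define w :: "'e dart \<Rightarrow> int" where "w d = of_bool (d \<notin> reach H)" for d
  have next_reach: "face_next G d \<in> reach H \<longleftrightarrow> d \<in> reach H" if d: "d \<in> D" for d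
  proof
    assume next_in: "face_next G d \<in> reach H"
    have o: "d \<in> orbit (face_next G) d" "orbit (face_next G) d \<subseteq> D"
      using orbit_self[OF bij_face_next finite_D d] .
    have "face_next G c \<in> reach H" if "c \<in> orbit (face_next G) d" "c \<in> reach H" for c
      using reach_face_next[OF subsetD[OF o(2) that(1)] that(2)] .
    then show "d \<in> reach H"
      by (rule cyclic_on_invariant[OF cyclic_on_orbit_bij[OF bij_face_next finite_D d] orbit.base,
            of "\<lambda>d. d \<in> reach H", OF next_in _ o(1)])
  qed (rule reach_face_next[OF d])
  have "w (e, True) - w (e, False) = of_bool (e \<in> set p) - of_bool (e \<in> set q)" if e: "e \<in> arcs (ug G)" for e
  proof (cases "e \<in> arcs H")
    case True
    then have "(e, b) \<in> reach H \<longleftrightarrow> (e, b) \<in> ext (induced G H)" for b by (simp add: induced_def)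
    then have "(e, True) \<in> reach H \<longleftrightarrow> e \<in> set q" "(e, False) \<in> reach H \<longleftrightarrow> e \<in> set p"
      unfolding ext by auto
    then show ?thesis unfolding w_def by simp
  next
    case False
    then have "(e, True) \<in> reach H \<longleftrightarrow> (e, False) \<in> reach H"
      using reach_rev[of "(e, True)" H] reach_rev[of "(e, False)" H] e by auto
    then show ?thesis using False pq unfolding w_def by auto
  qed
  moreover have "w d = 0" if "d \<in> ext G" for d using ext_reach[OF that] unfolding w_def by simp
  ultimately show ?thesis unfolding left_of_def
    by (intro exI[of _ w]) (use next_reach in \<open>simp add: w_def\<close>)
qed

lemma globular_face_darts:
  "globular_face K A q p \<Longrightarrow> A = (\<lambda>e. (e, True)) ` set q \<union> (\<lambda>e. (e, False)) ` set p"
  by (auto simp: globular_face_def face_boundary_def path_darts_def op_path_darts_def)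

text \<open>Conversely, in the union of \<open>p\<close> and \<open>q\<close>, an edge on the exterior face that has it on its right cannot
  belong to \<open>p\<close> alone, because the winding number to its left would be negative. So the exterior
  boundary is \<open>q p\<^sup>o\<^sup>p\<close>.\<close>

lemma left_of_dom_cod:
  assumes pq: "p \<in> paths x y" "q \<in> paths x y" and le: "p \<sqsubseteq> q"
  shows "dom_cod (induced G (paths_union x {p, q})) p q"
proof (cases "arcs (paths_union x {p, q}) = {}")
  case True
  then show ?thesis by (auto simp: dom_cod_def paths_union_simps)
next
  case False
  interpret union_of_paths G "{p, q}" x y by unfold_locales (use pq False in auto)
  obtain w where w: "\<forall>d\<in>D. w (face_next G d) = w d" "\<forall>d\<in>ext G. w d = 0" "\<forall>d\<in>D. 0 \<le> w d"
    "\<forall>e\<in>arcs (ug G). w (e, True) - w (e, False) = (of_bool (e \<in> set p) - of_bool (e \<in> set q) :: int)"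
    using le unfolding left_of_def by blast
  have arcsH: "arcs H = set p \<union> set q" by (simp add: H_def paths_union_simps)
  have w0: "w d = 0" if "d \<in> reach H" for d
  proof -
    obtain c where c: "(c, d) \<in> (merge_step G H)\<^sup>*" "c \<in> ext G" using \<open>d \<in> reach H\<close> by blast
    from c(1) show ?thesis
    proof induction
      case base
      then show ?case using w(2) c(2) by blast
    next
      case (step a b)
      from step(2) consider "a \<in> D" "b = face_next G a" | "a \<in> D - darts H" "b = rev_dart a"
        by (auto simp: merge_step_def)
      then show ?case
      proof cases
        case 1
        then show ?thesis using w(1) step.IH by simp
      next
        case 2
        then have "w (fst a, True) = w (fst a, False)" using w(4) by (auto simp: arcsH)
        then have "w (rev_dart a) = w a" by (cases a; cases "snd a") auto
        then show ?thesis using 2 step.IH by simp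
      qed
    qed
  qed
  obtain p' q' where pq': "p' \<in> paths x y" "q' \<in> paths x y" "set p' \<subseteq> arcs H" "set q' \<subseteq> arcs H"
    "globular_face (induced G H) (ext (induced G H)) q' p'" using exterior_paths .
  have sub: "ext (induced G H) \<subseteq> reach H" by (auto simp: induced_def)
  have "set q' \<subseteq> set q"
  proof
    fix e assume e: "e \<in> set q'"
    then have "w (e, True) = 0" using globular_face_darts[OF pq'(5)] sub by (intro w0) blast
    moreover have "0 \<le> w (e, False)" using w(3) e pq'(4) H_arcs_sub by auto
    moreover have "w (e, True) - w (e, False) = of_bool (e \<in> set p) - of_bool (e \<in> set q)"
      using w(4) e pq'(4) H_arcs_sub by blast
    ultimately show "e \<in> set q" using e pq'(4) arcsH by (cases "e \<in> set q") auto
  qed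
  then have "q' = q" using paths_subset_eq pq'(2) pq(2) by blast
  have "set p' \<subseteq> set p"
  proof
    fix e assume e: "e \<in> set p'"
    then have "w (e, False) = 0" using globular_face_darts[OF pq'(5)] sub by (intro w0) blast
    moreover have "0 \<le> w (e, True)" using w(3) e pq'(3) H_arcs_sub by auto
    moreover have "w (e, True) - w (e, False) = of_bool (e \<in> set p) - of_bool (e \<in> set q)"
      using w(4) e pq'(3) H_arcs_sub by blast
    ultimately show "e \<in> set p" using e pq'(3) arcsH by (cases "e \<in> set p") auto
  qed
  then have "p' = p" using paths_subset_eq pq'(1) pq(1) by blast
  then show ?thesis using pq'(5) \<open>q' = q\<close> False unfolding H_def by (simp add: dom_cod_def)
qed

lemma st_paths_between: "st_paths (between (ug G) x y) = paths x y"
proof (cases "paths x y = {}")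
  case True
  then have "verts (between (ug G) x y) = {}" by (simp add: between_conv paths_union_simps)
  then have "st_paths (between (ug G) x y) = {}"
    by (auto simp: st_paths_def pre_digraph.apath_def pre_digraph.awalk_def)
  then show ?thesis using True by simp
next
  case False
  let ?H = "paths_union x (paths x y)"
  have "st_paths ?H = {p. dpath ?H x p y}"
    using paths_union_ends[OF order_refl False] by (simp add: st_paths_def)
  also have "\<dots> = paths x y"
    using ends_on_path(1) False
    by (auto simp: dpath_subgraph_iff[OF paths_union_subgraph[OF order_refl]] paths_union_simps)
  finally show ?thesis by (simp add: between_conv)
qed

text \<open>The union of both paths can serve as a witness with trivial \<open>a\<close> and \<open>b\<close>: it is a glob because all of its
  edges lie on its exterior boundary.\<close>

lemma left_of_witness:
  assumes pq: "p \<in> paths x y" "q \<in> paths x y" and le: "p \<sqsubseteq> q"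
  shows "witness G (between (ug G) x y) p q (paths_union x {p, q})"
proof -
  let ?U = "paths_union x {p, q}" and ?B = "paths_union x (paths x y)"
  have sub: "{p, q} \<subseteq> paths x y" using pq by simp
  note dc = left_of_dom_cod[OF assms]
  have "glob G ?U"
  proof -
    have "(e, True) \<in> ext (induced G ?U) \<or> (e, False) \<in> ext (induced G ?U)" if e: "e \<in> arcs ?U" for e
    proof -
      have "arcs ?U \<noteq> {}" using e by blast
      then have "globular_face (induced G ?U) (ext (induced G ?U)) q p"
        using dc by (simp add: dom_cod_def)
      moreover have "e \<in> set p \<or> e \<in> set q" using e by (simp add: paths_union_simps)
      ultimately show ?thesis using globular_face_darts by fastforce
    qed
    then show ?thesis using paths_union_globular[OF sub] by (simp add: glob_def)
  qed
  moreover have "subgraph ?U ?B" by (rule paths_union_mono[OF sub order_refl])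
  moreover have "dpath ?U x p y" "dpath ?U x q y"
    using dpath_paths_union(1)[OF sub, of p p "[]" y] dpath_paths_union(1)[OF sub, of q q "[]" y] pq
      paths_verts(2)[OF pq(1)] by auto
  moreover have ne: "paths x y \<noteq> {}" using pq by auto
  have "dpath ?B x [] x" "dpath ?B y [] y"
    using dpath_paths_union(1)[OF order_refl pq(1), of "[]" p x] dpath_paths_union(2)[OF order_refl pq(1), of p "[]" y]
      pq paths_verts[OF pq(1)] by auto
  moreover have "src ?B = x" "tgt ?B = y" using paths_union_ends[OF order_refl ne] by auto
  ultimately show ?thesis
    unfolding witness_def between_conv using dc
    by (intro conjI exI[of _ x] exI[of _ y]
        exI[of "\<lambda>a. \<exists>b c d u v. P a b c d u v" "[]" for P] exI[of "\<lambda>b. \<exists>c d u v. P b c d u v" "[]" for P]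
        exI[of "\<lambda>c. \<exists>d u v. P c d u v" p for P] exI[of "\<lambda>d. \<exists>u v. P d u v" q for P]) simp_all
qed

text \<open>The common parts \<open>a\<close> and \<open>b\<close> of both paths cancel in the closed walk.\<close>

lemma witness_left_of:
  assumes wit: "witness G (between (ug G) x y) p q \<gamma>"
  shows "p \<sqsubseteq> q" "e \<notin> arcs \<gamma> \<Longrightarrow> e \<in> set p \<longleftrightarrow> e \<in> set q"
proof -
  let ?B = "between (ug G) x y"
  obtain a b c d u v where w: "dpath ?B (src ?B) a u" "dpath \<gamma> u c v" "dpath \<gamma> u d v" "dpath ?B v b (tgt ?B)"
    "dom_cod (induced G \<gamma>) c d" "p = a @ c @ b" "q = a @ d @ b" and gl: "glob G \<gamma>"
    using wit unfolding witness_def by blast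
  have sub: "subgraph \<gamma> (ug G)" using gl by (simp add: glob_def globular_sub_def)
  have B: "subgraph ?B (ug G)" unfolding between_conv by (rule paths_union_subgraph[OF order_refl])
  have ab: "a \<in> paths (src ?B) u" "b \<in> paths v (tgt ?B)"
    using w(1,4) by (simp_all add: dpath_subgraph_iff[OF B])
  have cd: "c \<in> paths u v" "d \<in> paths u v" "set c \<subseteq> arcs \<gamma>" "set d \<subseteq> arcs \<gamma>"
    using w(2,3) by (simp_all add: dpath_subgraph_iff[OF sub])
  show "e \<notin> arcs \<gamma> \<Longrightarrow> e \<in> set p \<longleftrightarrow> e \<in> set q" using w(6,7) cd(3,4) by auto
  have "c \<sqsubseteq> d"
  proof (cases "arcs \<gamma> = {}")
    case True
    then show ?thesis using cd left_of_refl by auto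
  next
    case False
    then have "globular_face (induced G \<gamma>) (ext (induced G \<gamma>)) d c" using w(5) by (simp add: dom_cod_def)
    then show ?thesis using left_of_exterior[OF sub cd(3,4)] globular_face_darts by blast
  qed
  then show "p \<sqsubseteq> q" unfolding w(6,7)
    using left_of_append[OF left_of_refl left_of_append[OF _ left_of_refl cd(1,2) ab(2,2)] ab(1,1)]
      append_in_paths[OF cd(1) ab(2)] append_in_paths[OF cd(2) ab(2)] by blast
qed

lemma path_le_iff:
  assumes "p \<in> paths x y" "q \<in> paths x y"
  shows "path_le G (between (ug G) x y) p q \<longleftrightarrow> p \<sqsubseteq> q"
  unfolding path_le_def using witness_left_of(1) left_of_witness[OF assms] by blast

text \<open>Passing from the union of the whole paths to the union of the parts deletes edges, so a dart on the
  exterior face stays on the exterior face.\<close>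

lemma left_of_parts:
  assumes pq: "p \<in> paths x y" "q \<in> paths x y" and le: "p \<sqsubseteq> q"
    and rs: "r \<in> paths u v" "s \<in> paths u v" and sub: "set r \<subseteq> set p" "set s \<subseteq> set q"
  shows "r \<sqsubseteq> s"
proof (cases "arcs (paths_union u {r, s}) = {}")
  case True
  then have "r = []" "s = []" by (auto simp: paths_union_simps)
  then show ?thesis using left_of_refl by simp
next
  case False
  interpret union_of_paths G "{r, s}" u v by unfold_locales (use rs False in auto)
  let ?U = "paths_union x {p, q}"
  have "arcs ?U \<noteq> {}" using False sub by (auto simp: paths_union_simps)
  then have "globular_face (induced G ?U) (ext (induced G ?U)) q p"
    using left_of_dom_cod[OF pq le] by (simp add: dom_cod_def)
  note ext = globular_face_darts[OF this]
  have arcsH: "arcs H = set r \<union> set s" by (simp add: H_def paths_union_simps)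
  have "arcs H \<subseteq> arcs ?U" unfolding arcsH using sub by (auto simp: paths_union_simps)
  then have "merge_step G ?U \<subseteq> merge_step G H" by (auto simp: merge_step_def)
  then have "reach ?U \<subseteq> reach H" using rtrancl_mono by blast
  then have mono: "d \<in> ext (induced G H)" if "d \<in> ext (induced G ?U)" "d \<in> darts H" for d
    using that by (auto simp: induced_def)
  obtain r' s' where rs': "r' \<in> paths u v" "s' \<in> paths u v" "set r' \<subseteq> arcs H" "set s' \<subseteq> arcs H"
    "globular_face (induced G H) (ext (induced G H)) s' r'" using exterior_paths .
  note ext' = globular_face_darts[OF rs'(5)]
  have "set s \<subseteq> set s'"
  proof
    fix e assume "e \<in> set s"
    then have "(e, True) \<in> ext (induced G H)" using sub ext arcsH by (intro mono) auto
    then show "e \<in> set s'" unfolding ext' by auto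
  qed
  moreover have "set r \<subseteq> set r'"
  proof
    fix e assume "e \<in> set r"
    then have "(e, False) \<in> ext (induced G H)" using sub ext arcsH by (intro mono) auto
    then show "e \<in> set r'" unfolding ext' by auto
  qed
  ultimately have "s = s'" "r = r'" using paths_subset_eq rs rs' by blast+
  then show ?thesis using left_of_exterior[OF H_sub rs'(3,4) ext'] by simp
qed

end

section \<open>Chains of paths\<close>

lemma subgraph_union:
  assumes "subgraph A K" "subgraph B K"
  shows "subgraph (union A B) K"
proof (rule subgraphI)
  show "verts (union A B) \<subseteq> verts K" "arcs (union A B) \<subseteq> arcs K" "compatible K (union A B)"
    using assms by (auto simp: subgraph_def union_def compatible_def)
  show "wf_digraph (union A B)"
  proof (rule wf_digraph.intro)
    fix e assume "e \<in> arcs (union A B)"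
    then show "tail (union A B) e \<in> verts (union A B)" "head (union A B) e \<in> verts (union A B)"
      using assms wf_digraph.tail_in_verts[of A e] wf_digraph.tail_in_verts[of B e]
        wf_digraph.head_in_verts[of A e] wf_digraph.head_in_verts[of B e]
      by (auto simp: subgraph_def union_def compatible_def)
  qed
  show "wf_digraph K" using assms by (simp add: subgraph_def)
qed

context acyclic_plane
begin

text \<open>The pairs \<open>(f i, g i)\<close> need not exhaust all combinations; nevertheless the union is the join of two
  unions of paths.\<close>

lemma paths_union_append:
  assumes "I \<noteq> {}" "\<And>i. i \<in> I \<Longrightarrow> f i \<in> paths x z" "\<And>i. i \<in> I \<Longrightarrow> g i \<in> paths z y"
  shows "paths_union x ((\<lambda>i. f i @ g i) ` I) = union (paths_union x (f ` I)) (paths_union z (g ` I))"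
proof -
  have "set (awalk_verts x (f i @ g i)) = set (awalk_verts x (f i)) \<union> set (awalk_verts z (g i))" if "i \<in> I" for i
    using append_on_path assms that by blast
  then have "verts (paths_union x ((\<lambda>i. f i @ g i) ` I)) =
      verts (union (paths_union x (f ` I)) (paths_union z (g ` I)))"
    by (auto simp: paths_union_simps union_def)
  moreover have "arcs (paths_union x ((\<lambda>i. f i @ g i) ` I)) =
      arcs (union (paths_union x (f ` I)) (paths_union z (g ` I)))"
    by (auto simp: paths_union_simps union_def)
  ultimately show ?thesis
    by (intro pre_digraph.equality) (simp_all add: paths_union_simps union_def)
qed

lemma subgraph_iff:
  assumes "subgraph A (ug G)" "subgraph B (ug G)"
  shows "subgraph A B \<longleftrightarrow> verts A \<subseteq> verts B \<and> arcs A \<subseteq> arcs B"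
  using assms by (auto simp: subgraph_def compatible_def)

text \<open>For a complete diagram, these are the simplices of the nerve between \<open>x\<close> and \<open>y\<close>.\<close>

definition chains :: "('v, 'e) pre_digraph set \<Rightarrow> 'v \<Rightarrow> 'v \<Rightarrow> nat \<Rightarrow> 'e list list set" where
  "chains S x y n = {ps. length ps = Suc n \<and> set ps \<subseteq> paths x y \<and> (\<forall>i<n. ps ! i \<sqsubseteq> ps ! Suc i) \<and>
    paths_union x (set ps) \<in> S}"

lemma chains_length: "ps \<in> chains S x y n \<Longrightarrow> length ps = Suc n"
  by (simp add: chains_def)

lemma chains_paths: "ps \<in> chains S x y n \<Longrightarrow> i \<le> n \<Longrightarrow> ps ! i \<in> paths x y"
  by (auto simp: chains_def)

lemma chains_mono: "S \<subseteq> T \<Longrightarrow> chains S x y n \<subseteq> chains T x y n"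
  by (auto simp: chains_def)

lemma chain_left_of:
  assumes "ps \<in> chains S x y n" "i \<le> j" "j \<le> n"
  shows "ps ! i \<sqsubseteq> ps ! j"
  using assms(2,3)
proof (induction j rule: dec_induct)
  case (step j)
  then have "ps ! j \<sqsubseteq> ps ! Suc j" using assms(1) by (simp add: chains_def)
  then show ?case using step left_of_trans by simp
qed (rule left_of_refl)

end

locale complete_family = acyclic_plane G for G :: "('v, 'e) plane" +
  fixes S :: "('v, 'e) pre_digraph set"
  assumes complete: "complete_diagram G (ug G, S)"
begin

lemma S_sub: "A \<in> S \<Longrightarrow> globular_sub G B \<Longrightarrow> subgraph B A \<Longrightarrow> B \<in> S"
  and S_join: "A \<in> S \<Longrightarrow> B \<in> S \<Longrightarrow> tgt A = src B \<Longrightarrow> union A B \<in> S"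
  and S_subgraph: "A \<in> S \<Longrightarrow> subgraph A (ug G)"
  and S_path_graphs: "path_graphs (ug G) \<subseteq> S"
  using complete unfolding complete_diagram_def pasting_diagram_def by blast+

lemma S_path:
  assumes "p \<in> paths x y"
  shows "paths_union x {p} \<in> S"
proof -
  have "path_graph (ug G) x p \<in> path_graphs (ug G)" unfolding path_graphs_def using assms dpath_iff by blast
  then show ?thesis using S_path_graphs by (auto simp: path_graph_conv)
qed

lemma S_paths_union_join:
  assumes "P \<subseteq> paths x z" "P \<noteq> {}" "Q \<subseteq> paths z y" "Q \<noteq> {}" "paths_union x P \<in> S" "paths_union z Q \<in> S"
  shows "union (paths_union x P) (paths_union z Q) \<in> S"
  using S_join paths_union_ends assms by metis

lemma S_paths_union_sub:
  assumes A: "A \<in> S" and P: "P \<subseteq> paths x y" "P \<noteq> {}" and sub: "\<And>p. p \<in> P \<Longrightarrow> set p \<subseteq> arcs A"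
  shows "paths_union x P \<in> S"
proof (cases "[] \<in> P")
  case True
  then have "x = y" using P by auto
  then have "P = {[]}" using P paths_refl[of y] by (auto split: if_splits)
  then show ?thesis using S_path[of "[]" x y] P by auto
next
  case False
  have A': "subgraph A (ug G)" by (rule S_subgraph[OF A])
  have "set (awalk_verts x p) \<subseteq> verts A" if p: "p \<in> P" for p
  proof -
    have "p \<noteq> []" "awalk x p y" using p P False by (auto simp: paths_def)
    then have "set (awalk_verts x p) = set (map (tail (ug G)) p) \<union> set (map (head (ug G)) p)"
      using set_awalk_verts_not_Nil by blast
    then show ?thesis
      using sub[OF p] A' wf_digraph.tail_in_verts[of A] wf_digraph.head_in_verts[of A]
      by (auto simp: subgraph_def compatible_def)
  qed
  then have "subgraph (paths_union x P) A"
    using sub by (auto simp: subgraph_iff[OF paths_union_subgraph[OF P(1)] A'] paths_union_simps)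
  then show ?thesis using S_sub[OF A paths_union_globular[OF P]] by blast
qed

text \<open>Here completeness enters: if the given paths differ only inside a member \<open>A\<close> of \<open>S\<close>, then cutting
  them at the edges outside \<open>A\<close>, which all of them share, displays their union as a join of subgraphs
  of \<open>A\<close> and of single edges.\<close>

lemma S_paths_union:
  assumes A: "A \<in> S" and P: "P \<subseteq> paths x y" "P \<noteq> {}"
    and common: "\<And>p q e. p \<in> P \<Longrightarrow> q \<in> P \<Longrightarrow> e \<in> set p \<Longrightarrow> e \<notin> arcs A \<Longrightarrow> e \<in> set q"
  shows "paths_union x P \<in> S"
  using P common
proof (induction "rank y - rank x" arbitrary: x P y rule: less_induct)
  case less
  show ?case
  proof (cases "\<forall>p\<in>P. set p \<subseteq> arcs A")
    case True
    then show ?thesis using S_paths_union_sub[OF A less.prems(1,2)] by blast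
  next
    case False
    then obtain p0 e where e: "p0 \<in> P" "e \<in> set p0" "e \<notin> arcs A" by blast
    have all: "e \<in> set p" if "p \<in> P" for p using less.prems(3)[OF e(1) that e(2,3)] .
    have eG: "e \<in> arcs (ug G)" using e less.prems(1) paths_arcs by blast
    let ?a = "tail (ug G) e" and ?b = "head (ug G) e"
    have "\<exists>q r. p = q @ e # r \<and> q \<in> paths x ?a \<and> r \<in> paths ?b y" if "p \<in> P" for p
      using edge_split[of p x y e] all[OF that] less.prems(1) that by blast
    then obtain f g where fg: "\<And>p. p \<in> P \<Longrightarrow> p = f p @ e # g p" "\<And>p. p \<in> P \<Longrightarrow> f p \<in> paths x ?a"
      "\<And>p. p \<in> P \<Longrightarrow> g p \<in> paths ?b y" by metis
    have ranks: "rank x \<le> rank ?a" "rank ?a < rank ?b" "rank ?b \<le> rank y"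
      using paths_rank[OF fg(2)[OF e(1)]] paths_rank[OF fg(3)[OF e(1)]] rank_less[OF eG] by auto
    have edge: "[e] \<in> paths ?a ?b" using eG by (simp add: Cons_in_paths)
    have low: "rank (head (ug G) d) \<le> rank ?a" if "d \<in> set (f p)" "p \<in> P" for d p
      using edge_split[OF fg(2)[OF that(2)] that(1)] paths_rank by (metis add_leD1)
    have high: "rank ?b \<le> rank (tail (ug G) d)" if "d \<in> set (g p)" "p \<in> P" for d p
      using edge_split[OF fg(3)[OF that(2)] that(1)] paths_rank by (metis add_leD1)
    have mem: "d \<in> set p \<longleftrightarrow> d \<in> set (f p) \<or> d = e \<or> d \<in> set (g p)" if "p \<in> P" for d p
      using arg_cong[OF fg(1)[OF that], of set] by auto
    have darcs: "d \<in> arcs (ug G)" if "d \<in> set p" "p \<in> P" for d p using that less.prems(1) paths_arcs by blast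
    have no_cross: "\<not> (d \<in> set (f p) \<and> d \<in> set (g q))" "\<not> (d \<in> set (f p) \<and> d = e)" "\<not> (d \<in> set (g p) \<and> d = e)"
      if "p \<in> P" "q \<in> P" for d p q
      using low[OF _ that(1), of d] high[OF _ that(2), of d] high[OF _ that(1), of d] mem[OF that(1), of d]
        darcs[OF _ that(1), of d] rank_less[of d] ranks by fastforce+
    have 1: "paths_union x (f ` P) \<in> S"
    proof (rule less.hyps)
      show "rank ?a - rank x < rank y - rank x" using ranks by linarith
      show "f ` P \<subseteq> paths x ?a" "f ` P \<noteq> {}" using fg(2) less.prems(2) by auto
      fix p q d assume "p \<in> f ` P" "q \<in> f ` P" "d \<in> set p" "d \<notin> arcs A"
      then obtain p' q' where pq: "p' \<in> P" "q' \<in> P" "d \<in> set (f p')" "q = f q'" by blast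
      then have "d \<in> set q'" using less.prems(3)[OF pq(1,2)] mem[OF pq(1)] \<open>d \<notin> arcs A\<close> by blast
      then show "d \<in> set q" using mem[OF pq(2)] no_cross[OF pq(1,2)] pq(3,4) by blast
    qed
    have 2: "paths_union ?b (g ` P) \<in> S"
    proof (rule less.hyps)
      show "rank y - rank ?b < rank y - rank x" using ranks by linarith
      show "g ` P \<subseteq> paths ?b y" "g ` P \<noteq> {}" using fg(3) less.prems(2) by auto
      fix p q d assume "p \<in> g ` P" "q \<in> g ` P" "d \<in> set p" "d \<notin> arcs A"
      then obtain p' q' where pq: "p' \<in> P" "q' \<in> P" "d \<in> set (g p')" "q = g q'" by blast
      then have "d \<in> set q'" using less.prems(3)[OF pq(1,2)] mem[OF pq(1)] \<open>d \<notin> arcs A\<close> by blast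
      then show "d \<in> set q" using mem[OF pq(2)] no_cross[OF pq(2,1)] no_cross[OF pq(1,2)] pq(3,4) by blast
    qed
    have "P = (\<lambda>p. f p @ ([e] @ g p)) ` P" using fg(1) by force
    then have "paths_union x P = union (paths_union x (f ` P)) (paths_union ?a ((\<lambda>p. [e] @ g p) ` P))"
      using paths_union_append[OF less.prems(2), of f x ?a "\<lambda>p. [e] @ g p" y] fg(2,3) append_in_paths[OF edge] by simp
    moreover have "paths_union ?a ((\<lambda>p. [e] @ g p) ` P) = union (paths_union ?a ((\<lambda>p. [e]) ` P)) (paths_union ?b (g ` P))"
      using less.prems(2) edge fg(3) by (intro paths_union_append)
    moreover have "(\<lambda>p. [e]) ` P = {[e]}" using less.prems(2) by auto
    moreover have "union (paths_union ?a {[e]}) (paths_union ?b (g ` P)) \<in> S"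
      using S_paths_union_join[of "{[e]}" ?a ?b "g ` P" y] edge fg(3) less.prems(2) S_path[OF edge] 2 by auto
    ultimately show ?thesis
      using S_paths_union_join[of "f ` P" x ?a "(\<lambda>p. [e] @ g p) ` P" y] 1 fg(2,3) append_in_paths[OF edge] less.prems(2)
      by (simp add: image_subset_iff)
  qed
qed

lemma chains_append:
  assumes ps: "ps \<in> chains S x z n" and qs: "qs \<in> chains S z y n"
  shows "map2 (@) ps qs \<in> chains S x y n"
proof -
  have len: "length ps = Suc n" "length qs = Suc n" using assms by (simp_all add: chains_def)
  have set1: "set ps = (!) ps ` {..n}" "set qs = (!) qs ` {..n}"
    using len by (auto simp: set_conv_nth image_def less_Suc_eq_le)
  have "map2 (@) ps qs = map (\<lambda>i. ps ! i @ qs ! i) [0..<Suc n]"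
    using len by (intro nth_equalityI) (auto simp del: upt_Suc)
  then have set: "set (map2 (@) ps qs) = (\<lambda>i. ps ! i @ qs ! i) ` {..n}"
    by (simp add: atLeast0LessThan lessThan_Suc_atMost del: upt_Suc)
  have p: "ps ! i \<in> paths x z" "qs ! i \<in> paths z y" if "i \<le> n" for i
    using chains_paths assms that by auto
  have "paths_union x (set (map2 (@) ps qs)) = union (paths_union x (set ps)) (paths_union z (set qs))"
    unfolding set set1 by (rule paths_union_append) (use p in auto)
  moreover have "union (paths_union x (set ps)) (paths_union z (set qs)) \<in> S"
    by (rule S_paths_union_join) (use assms len in \<open>auto simp: chains_def\<close>)
  moreover have "map2 (@) ps qs ! i \<sqsubseteq> map2 (@) ps qs ! Suc i" if "i < n" for i
    using that len p[of i] p[of "Suc i"]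
      left_of_append[OF chain_left_of[OF ps, of i "Suc i"] chain_left_of[OF qs, of i "Suc i"], of x z y] by simp
  moreover have "set (map2 (@) ps qs) \<subseteq> paths x y" unfolding set using p append_in_paths by blast
  ultimately show ?thesis using len by (simp add: chains_def)
qed

text \<open>A union of parts is a globular subgraph of the union of the whole chain, so it belongs to \<open>S\<close> as well.\<close>

lemma chains_parts:
  assumes ps: "ps \<in> chains S x y n"
    and f: "\<And>p. p \<in> set ps \<Longrightarrow> f p \<in> paths u v" "\<And>p. p \<in> set ps \<Longrightarrow> set (awalk_verts u (f p)) \<subseteq> set (awalk_verts x p)"
      "\<And>p. p \<in> set ps \<Longrightarrow> set (f p) \<subseteq> set p"
  shows "map f ps \<in> chains S u v n"
proof -
  have len: "length ps = Suc n" and sub: "set ps \<subseteq> paths x y" and U: "paths_union x (set ps) \<in> S"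
    using ps by (auto simp: chains_def)
  have ne: "set ps \<noteq> {}" using len by auto
  have fsub: "f ` set ps \<subseteq> paths u v" using f(1) by auto
  have "subgraph (paths_union u (f ` set ps)) (paths_union x (set ps))"
    unfolding subgraph_iff[OF paths_union_subgraph[OF fsub] paths_union_subgraph[OF sub]]
    using f by (fastforce simp: paths_union_simps)
  then have "paths_union u (f ` set ps) \<in> S"
    using S_sub[OF U paths_union_globular[OF fsub]] ne by auto
  moreover have "f (ps ! i) \<sqsubseteq> f (ps ! Suc i)" if i: "i < n" for i
  proof -
    have "ps ! i \<in> set ps" "ps ! Suc i \<in> set ps" using i len by auto
    then show ?thesis
      using left_of_parts[OF _ _ chain_left_of[OF ps, of i "Suc i"] f(1) f(1) f(3) f(3)] sub i by auto
  qed
  ultimately show ?thesis using len fsub by (simp add: chains_def)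
qed

text \<open>Cutting at \<open>z\<close> is a function of the concatenated path, so that the lemma on parts applies.\<close>

lemma chains_appendD:
  assumes pq: "map2 (@) ps qs \<in> chains S x y n" and len: "length ps = Suc n" "length qs = Suc n"
    and p: "set ps \<subseteq> paths x z" and q: "set qs \<subseteq> paths z y"
  shows "ps \<in> chains S x z n" "qs \<in> chains S z y n"
proof -
  define f where "f r = (THE p. p \<in> paths x z \<and> (\<exists>q. r = p @ q))" for r
  define g where "g r = (THE q. \<exists>p\<in>paths x z. r = p @ q)" for r
  have f: "f (a @ b) = a" if a: "a \<in> paths x z" for a b
    unfolding f_def
  proof (rule the_equality)
    show "a \<in> paths x z \<and> (\<exists>q. a @ b = a @ q)" using a by blast
    fix p assume "p \<in> paths x z \<and> (\<exists>q. a @ b = p @ q)"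
    then show "p = a" using paths_append_eq[OF a] by metis
  qed
  have g: "g (a @ b) = b" if a: "a \<in> paths x z" for a b
    unfolding g_def
  proof (rule the_equality)
    show "\<exists>p\<in>paths x z. a @ b = p @ b" using a by blast
    fix q assume "\<exists>p\<in>paths x z. a @ b = p @ q"
    then show "q = b" using paths_append_eq[OF a] by metis
  qed
  have ex: "\<exists>a b. r = a @ b \<and> a \<in> paths x z \<and> b \<in> paths z y" if "r \<in> set (map2 (@) ps qs)" for r
  proof -
    obtain a b where "(a, b) \<in> set (zip ps qs)" "r = a @ b" using \<open>r \<in> _\<close> by auto
    then show ?thesis using p q set_zip_leftD[of a b ps qs] set_zip_rightD[of a b ps qs] by blast
  qed
  have fr: "f r \<in> paths x z" "set (awalk_verts x (f r)) \<subseteq> set (awalk_verts x r)" "set (f r) \<subseteq> set r"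
    and gr: "g r \<in> paths z y" "set (awalk_verts z (g r)) \<subseteq> set (awalk_verts x r)" "set (g r) \<subseteq> set r"
    if r: "r \<in> set (map2 (@) ps qs)" for r
  proof -
    obtain a b where ab: "r = a @ b" "a \<in> paths x z" "b \<in> paths z y" using ex[OF r] by blast
    show "f r \<in> paths x z" "set (awalk_verts x (f r)) \<subseteq> set (awalk_verts x r)" "set (f r) \<subseteq> set r"
      unfolding ab(1) f[OF ab(2)] append_on_path[OF ab(2,3)] using ab(2) by simp_all
    show "g r \<in> paths z y" "set (awalk_verts z (g r)) \<subseteq> set (awalk_verts x r)" "set (g r) \<subseteq> set r"
      unfolding ab(1) g[OF ab(2)] append_on_path[OF ab(2,3)] using ab(3) by simp_all
  qed
  have in_p: "ps ! i \<in> paths x z" if "i < Suc n" for i using that p len nth_mem by fastforce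
  have "map f (map2 (@) ps qs) = ps" "map g (map2 (@) ps qs) = qs"
    using len f g in_p by (auto intro!: nth_equalityI)
  moreover have "map f (map2 (@) ps qs) \<in> chains S x z n" by (rule chains_parts[OF pq fr])
  moreover have "map g (map2 (@) ps qs) \<in> chains S z y n" by (rule chains_parts[OF pq gr])
  ultimately show "ps \<in> chains S x z n" "qs \<in> chains S z y n" by simp_all
qed

lemma chains_split:
  assumes ps: "ps \<in> chains S x y n" and z: "\<And>p. p \<in> set ps \<Longrightarrow> z \<in> set (awalk_verts x p)"
  obtains qs rs where "qs \<in> chains S x z n" "rs \<in> chains S z y n" "ps = map2 (@) qs rs"
proof -
  have len: "length ps = Suc n" and sub: "set ps \<subseteq> paths x y" using ps by (auto simp: chains_def)
  have "\<exists>q r. p = q @ r \<and> q \<in> paths x z \<and> r \<in> paths z y" if "p \<in> set ps" for p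
    using paths_split_at[of p x y z] z[OF that] sub that by blast
  then obtain f g where fg: "\<And>p. p \<in> set ps \<Longrightarrow> p = f p @ g p" "\<And>p. p \<in> set ps \<Longrightarrow> f p \<in> paths x z"
    "\<And>p. p \<in> set ps \<Longrightarrow> g p \<in> paths z y" by metis
  have eq: "ps = map2 (@) (map f ps) (map g ps)"
    using fg(1) by (intro nth_equalityI) auto
  have "map f ps \<in> chains S x z n" "map g ps \<in> chains S z y n"
    using chains_appendD[of "map f ps" "map g ps" x y n z] ps len fg(2,3) unfolding eq[symmetric] by auto
  then show ?thesis using that eq by blast
qed

lemma chains_reindex:
  assumes ps: "ps \<in> chains S x y n" and \<theta>: "\<theta> \<in> Delta m n"
  shows "map (\<lambda>i. ps ! \<theta> i) [0..<Suc m] \<in> chains S x y m"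
proof -
  have len: "length ps = Suc n" and sub: "set ps \<subseteq> paths x y" and U: "paths_union x (set ps) \<in> S"
    using ps by (auto simp: chains_def)
  have le: "\<theta> i \<le> n" if "i \<le> m" for i using \<theta> that by (auto simp: Delta_def)
  have mono: "\<theta> i \<le> \<theta> j" if "i \<le> j" "j \<le> m" for i j using \<theta> that by (auto simp: Delta_def mono_on_def)
  let ?qs = "map (\<lambda>i. ps ! \<theta> i) [0..<Suc m]"
  have qsub: "set ?qs \<subseteq> set ps" using le len by (force simp: less_Suc_eq_le)
  have "subgraph (paths_union x (set ?qs)) (paths_union x (set ps))" by (rule paths_union_mono[OF qsub sub])
  moreover have "globular_sub G (paths_union x (set ?qs))"
    by (rule paths_union_globular[OF subset_trans[OF qsub sub]]) simp
  ultimately have "paths_union x (set ?qs) \<in> S" using S_sub[OF U] by blast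
  moreover have "?qs ! i \<sqsubseteq> ?qs ! Suc i" if "i < m" for i
    using that chain_left_of[OF ps mono le] by (simp del: upt_Suc)
  ultimately show ?thesis using qsub sub by (simp add: chains_def del: upt_Suc set_map) 
qed

end

section \<open>Complete diagrams exist on acyclic graphs only\<close>

context plane_map
begin

lemma globular_edge_no_loop:
  assumes gl: "globular G" and e: "e \<in> arcs (ug G)"
  shows "tail (ug G) e \<noteq> head (ug G) e"
proof -
  obtain A where A: "A \<in> faces G" "(e, True) \<in> A" using Union_faces e by fastforce
  then obtain p q where g: "globular_face G A p q" using gl e by (auto simp: globular_def)
  then obtain u v where p: "apath u p v" by (auto simp: globular_face_def)
  have "(e, True) \<in> set (path_darts p @ op_path_darts q)"
    using g A by (simp add: globular_face_def face_boundary_def)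
  then have "e \<in> set p" by (auto simp: path_darts_def op_path_darts_def)
  moreover have "apath u p v \<Longrightarrow> e \<in> set p \<Longrightarrow> tail (ug G) e \<noteq> head (ug G) e" for u p
  proof (induction p arbitrary: u)
    case (Cons d p)
    then have "apath (head (ug G) d) p v" "tail (ug G) d \<notin> set (awalk_verts (head (ug G) d) p)"
      by (auto simp: apath_Cons_iff)
    then show ?case using Cons hd_in_awalk_verts(2) by (metis set_ConsD)
  qed simp
  ultimately show ?thesis using p by blast
qed

lemma path_graph_subgraph:
  assumes "apath u p v"
  shows "subgraph (path_graph (ug G) u p) (ug G)"
proof (rule subgraphI)
  have p: "awalk u p v" using assms by (rule awalkI_apath)
  then show "verts (path_graph (ug G) u p) \<subseteq> verts (ug G)" "arcs (path_graph (ug G) u p) \<subseteq> arcs (ug G)"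
    by (auto simp: path_graph_def)
  show "compatible (ug G) (path_graph (ug G) u p)" by (simp add: path_graph_def compatible_def)
  show "wf_digraph (path_graph (ug G) u p)"
    by (rule wf_digraph.intro) (use p awalk_verts_arc1 awalk_verts_arc2 in \<open>auto simp: path_graph_def\<close>)
  show "wf_digraph (ug G)" by (rule wf_digraph_axioms)
qed

text \<open>Acyclicity has not been established at this point, so the parts of a path are shown to be paths
  directly.\<close>

lemma dpath_path_graph:
  assumes p: "apath u p v" and w: "w \<in> verts (path_graph (ug G) u p)"
  shows "\<exists>q. dpath (path_graph (ug G) u p) u q w" "\<exists>r. dpath (path_graph (ug G) u p) w r v"
proof -
  let ?A = "path_graph (ug G) u p"
  have c: "compatible (ug G) ?A" using path_graph_subgraph[OF p] by (simp add: subgraph_def)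
  obtain q r where qr: "p = q @ r" "awalk u q w" "awalk w r v"
    using awalk_decomp[OF awalkI_apath[OF p], of w] w unfolding path_graph_def by auto
  have v: "awalk_verts u p = awalk_verts u q @ tl (awalk_verts w r)"
    using awalk_verts_append[of u q r v] qr p by (auto dest: awalkI_apath)
  have "set (awalk_verts u p) = set (awalk_verts u q) \<union> set (awalk_verts w r)"
    using set_awalk_verts_append qr by blast
  then have u: "u \<in> verts ?A" "w \<in> verts ?A"
    using qr hd_in_awalk_verts(1) by (auto simp: path_graph_def)
  have "distinct (awalk_verts u p)" using p by (simp add: apath_def)
  moreover have "awalk_verts u p = butlast (awalk_verts u q) @ awalk_verts w r"
    using awalk_verts_append2[of u q r v] qr p by (auto dest: awalkI_apath)
  ultimately have "distinct (awalk_verts u q)" "distinct (awalk_verts w r)"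
    using v by (metis distinct_append)+
  then have "dpath ?A u q w" "dpath ?A w r v"
    unfolding pre_digraph.apath_def pre_digraph.awalk_def compatible_cas[OF c, symmetric]
      compatible_awalk_verts[OF c, symmetric]
    using qr u by (auto simp: path_graph_def)
  then show "\<exists>q. dpath ?A u q w" "\<exists>r. dpath ?A w r v" by blast+
qed

text \<open>A closed walk would provide an edge \<open>e\<close> from \<open>u\<close> to \<open>w \<noteq> u\<close> and a path back from \<open>w\<close> to \<open>u\<close>.
  Completeness makes their join a globular graph, but every vertex of this join is a source.\<close>

lemma complete_diagram_acyclic:
  assumes gl: "globular G" and S: "complete_diagram G (ug G, S)" and closed: "awalk u p u"
  shows "p = []"
proof (rule ccontr)
  assume "p \<noteq> []"
  then obtain e p' where p: "p = e # p'" by (cases p) auto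
  define w where "w = head (ug G) e"
  have e: "e \<in> arcs (ug G)" "tail (ug G) e = u" and p': "awalk w p' u"
    using closed p by (auto simp: awalk_Cons_iff w_def)
  have uw: "u \<noteq> w" using globular_edge_no_loop[OF gl e(1)] e(2) w_def by simp
  obtain q where q: "apath w q u" using apath_awalk_to_apath[OF p'] by blast
  have ep: "apath u [e] w" using e uw by (simp add: apath_Cons_iff apath_Nil_iff w_def)
  let ?A = "path_graph (ug G) u [e]" and ?B = "path_graph (ug G) w q"
  let ?C = "union ?A ?B"
  have globS: "globular (induced G A)" if "A \<in> S" for A
    using S that unfolding complete_diagram_def pasting_diagram_def globular_sub_def by blast
  have unique: "\<exists>!v. is_source A v" "\<exists>!v. is_target A v" if "A \<in> S" "arcs A \<noteq> {}" for A
    using globS[OF that(1)] that(2) by (auto simp: globular_def induced_def st_graph_def)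
  have AB: "?A \<in> S" "?B \<in> S"
    using S ep q unfolding complete_diagram_def pasting_diagram_def path_graphs_def by blast+
  have "q \<noteq> []" using q uw by (auto simp: apath_Nil_iff)
  then have ne: "arcs ?A \<noteq> {}" "arcs ?B \<noteq> {}" by (simp_all add: path_graph_def)
  have "is_target ?A w" using dpath_path_graph(2)[OF ep]
    by (auto simp: is_target_def path_graph_def w_def)
  moreover have "is_source ?B w" using dpath_path_graph(1)[OF q] hd_in_awalk_verts(2)[OF q]
    by (simp add: is_source_def) (simp add: path_graph_def)
  ultimately have "tgt ?A = src ?B"
    using unique(2)[OF AB(1) ne(1)] unique(1)[OF AB(2) ne(2)] the1_equality
    unfolding tgt_def src_def by metis
  then have C: "?C \<in> S" using S AB unfolding complete_diagram_def by blast
  have "subgraph ?C (ug G)"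
    by (rule subgraph_union) (rule path_graph_subgraph[OF ep] path_graph_subgraph[OF q])+
  then interpret C: wf_digraph ?C by (simp add: subgraph_def)
  have sub: "subgraph ?A ?C" "subgraph ?B ?C"
    using path_graph_subgraph[OF ep] path_graph_subgraph[OF q] \<open>subgraph ?C (ug G)\<close>
    by (auto simp: subgraph_def union_def compatible_def)
  have walkA: "\<exists>r. C.awalk u r a" if "a \<in> verts ?A" for a
    using dpath_path_graph(1)[OF ep that] C.subgraph_apath_imp_apath[OF _ sub(1)] C.awalkI_apath by blast
  have walkB: "\<exists>r. C.awalk w r b" if "b \<in> verts ?B" for b
    using dpath_path_graph(1)[OF q that] C.subgraph_apath_imp_apath[OF _ sub(2)] C.awalkI_apath by blast
  have ends: "w \<in> verts ?A" "u \<in> verts ?B"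
    using q w_def by (auto simp: path_graph_def apath_def)
  have src: "is_source ?C v" if "v \<in> verts ?C" "\<exists>r. C.awalk v r u" "\<exists>r. C.awalk v r w" for v
  proof -
    have "\<exists>r. C.awalk v r b" if "b \<in> verts ?C" for b
      using that walkA[of b] walkB[of b] \<open>\<exists>r. C.awalk v r u\<close> \<open>\<exists>r. C.awalk v r w\<close> C.awalk_appendI
      by (auto simp: union_def) blast+
    then show ?thesis using that(1) C.apath_awalk_to_apath unfolding is_source_def by blast
  qed
  have "u \<in> verts ?C" "w \<in> verts ?C" using ends by (auto simp: union_def)
  then have "is_source ?C u" "is_source ?C w"
    using src[of u] src[of w] walkA[OF ends(1)] walkB[OF ends(2)] C.awalk_Nil_iff by blast+
  moreover have "\<exists>!v. is_source ?C v" using unique(1)[OF C] ne by (simp add: union_def)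
  ultimately show False using uw by blast
qed

lemma complete_family_if_complete:
  assumes "globular G" "complete_diagram G (ug G, S)"
  shows "complete_family G S"
proof -
  have "acyclic_plane G"
  proof (rule acyclic_plane.intro[OF plane_map_axioms], rule acyclic_plane_axioms.intro)
    show "st_graph G" if "arcs (ug G) \<noteq> {}" using assms(1) that by (auto simp: globular_def)
  qed (rule complete_diagram_acyclic[OF assms])
  then show ?thesis using assms(2) by (intro complete_family.intro complete_family_axioms.intro)
qed

end

section \<open>Nerves of pasting diagrams\<close>

definition chain_sset :: "(nat \<Rightarrow> 'a list set) \<Rightarrow> 'a list sset" where
  "chain_sset N = \<lparr>simplices = N, act = (\<lambda>m n \<theta> ps. map (\<lambda>i. ps ! \<theta> i) [0..<Suc m])\<rparr>"

lemma simplices_chain_sset [simp]: "simplices (chain_sset N) = N"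
  and act_chain_sset: "act (chain_sset N) m n \<theta> ps = map (\<lambda>i. ps ! \<theta> i) [0..<Suc m]"
  by (simp_all add: chain_sset_def)

lemma simplicial_set_chain_sset:
  assumes len: "\<And>n ps. ps \<in> N n \<Longrightarrow> length ps = Suc n"
    and reindex: "\<And>m n \<theta> ps. \<theta> \<in> Delta m n \<Longrightarrow> ps \<in> N n \<Longrightarrow> map (\<lambda>i. ps ! \<theta> i) [0..<Suc m] \<in> N m"
  shows "simplicial_set (chain_sset N)"
  unfolding simplicial_set_def
proof (intro conjI allI ballI)
  show "act (chain_sset N) m n \<theta> \<in> simplices (chain_sset N) n \<rightarrow> simplices (chain_sset N) m"
    if "\<theta> \<in> Delta m n" for m n \<theta>
    using reindex[OF that] by (auto simp: act_chain_sset simp del: upt_Suc)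
  show "act (chain_sset N) n n (\<lambda>i\<in>{..n}. i) ps = ps" if "ps \<in> simplices (chain_sset N) n" for n ps
    using len[of ps n] that by (intro nth_equalityI) (auto simp: act_chain_sset simp del: upt_Suc)
  show "act (chain_sset N) k n (compose {..k} \<theta> \<eta>) ps =
      act (chain_sset N) k m \<eta> (act (chain_sset N) m n \<theta> ps)"
    if "\<eta> \<in> Delta k m" "\<theta> \<in> Delta m n" for k m n \<eta> \<theta> and ps :: "'a list"
  proof -
    have "\<eta> i < Suc m" if "i < Suc k" for i
      using \<open>\<eta> \<in> Delta k m\<close> that by (auto simp: Delta_def PiE_iff less_Suc_eq_le)
    then show ?thesis
      by (intro nth_equalityI) (auto simp: act_chain_sset compose_def less_Suc_eq_le simp del: upt_Suc)
  qed
qed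

context acyclic_plane
begin

lemma simplices_diagram_nerve:
  "simplices (diagram_nerve G (between (ug G) x y, \<A>)) n = {ps. length ps = Suc n \<and> set ps \<subseteq> paths x y \<and>
    (\<forall>i<n. ps ! i \<sqsubseteq> ps ! Suc i) \<and>
    (\<exists>A\<in>\<A>. \<forall>i<n. \<exists>\<gamma>. witness G (between (ug G) x y) (ps ! i) (ps ! Suc i) \<gamma> \<and> subgraph \<gamma> A)}"
proof -
  have "(\<forall>i<n. path_le G (between (ug G) x y) (ps ! i) (ps ! Suc i)) \<longleftrightarrow> (\<forall>i<n. ps ! i \<sqsubseteq> ps ! Suc i)"
    if "length ps = Suc n" "set ps \<subseteq> paths x y" for ps
  proof -
    have "ps ! i \<in> paths x y" if "i \<le> n" for i using that \<open>length ps = Suc n\<close> \<open>set ps \<subseteq> paths x y\<close> by auto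
    then show ?thesis using path_le_iff by simp
  qed
  then show ?thesis
    by (auto simp: diagram_nerve_def graph_nerve_def nerve_def st_paths_between)
qed

lemma diagram_nerve_eq:
  assumes "simplices (diagram_nerve G (H, \<A>)) = N"
  shows "diagram_nerve G (H, \<A>) = chain_sset N"
  using assms by (auto simp: diagram_nerve_def chain_sset_def graph_nerve_def nerve_def)

text \<open>Consecutive members of the chain differ only inside the witness for their relation.\<close>

lemma witnessed_chain_common:
  assumes "\<forall>i<n. \<exists>\<gamma>. witness G (between (ug G) x y) (ps ! i) (ps ! Suc i) \<gamma> \<and> subgraph \<gamma> A"
    "length ps = Suc n" "p \<in> set ps" "q \<in> set ps" "e \<in> set p" "e \<notin> arcs A"
  shows "e \<in> set q"
proof -
  have "i \<le> n \<Longrightarrow> e \<in> set (ps ! i) \<longleftrightarrow> e \<in> set (ps ! 0)" for i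
  proof (induction i)
    case (Suc i)
    then obtain \<gamma> where "witness G (between (ug G) x y) (ps ! i) (ps ! Suc i) \<gamma>" "subgraph \<gamma> A"
      using assms(1) by (meson Suc_le_lessD)
    moreover have "e \<notin> arcs \<gamma>" using assms(6) \<open>subgraph \<gamma> A\<close> by (auto simp: subgraph_def)
    ultimately show ?case using Suc witness_left_of(2) by auto
  qed simp
  moreover obtain i j where "i \<le> n" "p = ps ! i" "j \<le> n" "q = ps ! j"
    using assms(2-4) by (auto simp: in_set_conv_nth less_Suc_eq_le)
  ultimately show ?thesis using assms(5) by blast
qed

lemma chain_witnesses:
  assumes ps: "length ps = Suc n" "set ps \<subseteq> paths x y" "\<forall>i<n. ps ! i \<sqsubseteq> ps ! Suc i"
    and A: "subgraph (paths_union x (set ps)) A"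
  shows "\<forall>i<n. \<exists>\<gamma>. witness G (between (ug G) x y) (ps ! i) (ps ! Suc i) \<gamma> \<and> subgraph \<gamma> A"
proof (intro allI impI)
  fix i assume i: "i < n"
  then have in_ps: "{ps ! i, ps ! Suc i} \<subseteq> set ps" using ps(1) by auto
  have "witness G (between (ug G) x y) (ps ! i) (ps ! Suc i) (paths_union x {ps ! i, ps ! Suc i})"
    by (rule left_of_witness) (use in_ps ps i in auto)
  moreover have "subgraph (paths_union x {ps ! i, ps ! Suc i}) A"
    using subgraph_trans[OF paths_union_mono[OF in_ps ps(2)] A] .
  ultimately show "\<exists>\<gamma>. witness G (between (ug G) x y) (ps ! i) (ps ! Suc i) \<gamma> \<and> subgraph \<gamma> A" by blast
qed

end

context complete_family
begin

lemma diagram_nerve_restriction: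
  "diagram_nerve G (restriction (ug G, S) x y) = chain_sset (chains S x y)"
  unfolding restriction_def split
proof (rule diagram_nerve_eq, rule ext, rule set_eqI, rule iffI)
  fix n ps
  let ?H = "between (ug G) x y"
  assume "ps \<in> simplices (diagram_nerve G (?H, {A \<in> S. subgraph A ?H})) n"
  then obtain A where ps: "length ps = Suc n" "set ps \<subseteq> paths x y" "\<forall>i<n. ps ! i \<sqsubseteq> ps ! Suc i"
    and A: "A \<in> S" "\<forall>i<n. \<exists>\<gamma>. witness G ?H (ps ! i) (ps ! Suc i) \<gamma> \<and> subgraph \<gamma> A"
    unfolding simplices_diagram_nerve by blast
  have "paths_union x (set ps) \<in> S"
  proof (rule S_paths_union[OF A(1) ps(2)])
    show "set ps \<noteq> {}" using ps(1) by auto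
  qed (rule witnessed_chain_common[OF A(2) ps(1)])
  then show "ps \<in> chains S x y n" using ps by (simp add: chains_def)
next
  fix n ps
  let ?H = "between (ug G) x y"
  assume "ps \<in> chains S x y n"
  then have ps: "length ps = Suc n" "set ps \<subseteq> paths x y" "\<forall>i<n. ps ! i \<sqsubseteq> ps ! Suc i"
    and S: "paths_union x (set ps) \<in> S" by (simp_all add: chains_def)
  have sub: "subgraph (paths_union x (set ps)) ?H"
    unfolding between_conv by (rule paths_union_mono[OF ps(2) order_refl])
  have self: "subgraph (paths_union x (set ps)) (paths_union x (set ps))"
    by (rule paths_union_mono[OF order_refl ps(2)])
  show "ps \<in> simplices (diagram_nerve G (?H, {A \<in> S. subgraph A ?H})) n"
    unfolding simplices_diagram_nerve using ps S sub chain_witnesses[OF ps self] by blast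
qed

lemma simplicial_set_chains: "simplicial_set (chain_sset (chains S x y))"
  using chains_length chains_reindex by (intro simplicial_set_chain_sset)

end

context acyclic_plane
begin

lemma between_vertex_iff: "z \<in> verts (between (ug G) x y) \<longleftrightarrow> paths x z \<noteq> {} \<and> paths z y \<noteq> {}"
proof
  assume "z \<in> verts (between (ug G) x y)"
  then show "paths x z \<noteq> {} \<and> paths z y \<noteq> {}"
    using paths_union_vertexE[OF order_refl] unfolding between_conv by blast
next
  assume "paths x z \<noteq> {} \<and> paths z y \<noteq> {}"
  then obtain p q where pq: "p \<in> paths x z" "q \<in> paths z y" by blast
  show "z \<in> verts (between (ug G) x y)"
    unfolding between_conv
    by (rule dpath_paths_union(3)[OF order_refl append_in_paths[OF pq] refl pq])
qed

lemma between_subgraph: "subgraph (between (ug G) x y) (ug G)"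
  unfolding between_conv by (rule paths_union_subgraph[OF order_refl])

lemma between_ends:
  assumes "paths x y \<noteq> {}"
  shows "src (between (ug G) x y) = x" "tgt (between (ug G) x y) = y"
  using paths_union_ends[OF order_refl assms] unfolding between_conv by auto

lemma path_graph_subgraph_eq: "subgraph H (ug G) \<Longrightarrow> path_graph H x p = path_graph (ug G) x p"
  using compatible_awalk_verts[of "ug G" H] by (simp add: path_graph_def subgraph_def compatible_def)

lemma between_between:
  assumes z: "z \<in> verts (between (ug G) x y)"
  shows "between (between (ug G) x y) x z = between (ug G) x z"
    "between (between (ug G) x y) z y = between (ug G) z y"
proof -
  let ?H = "between (ug G) x y"
  obtain a b where ab: "a \<in> paths x z" "b \<in> paths z y" using z unfolding between_vertex_iff by blast
  have "set p \<subseteq> arcs ?H" if "p \<in> paths x z \<or> p \<in> paths z y" for p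
    using append_in_paths[of p x z b y] append_in_paths[of a x z p y] ab that
    unfolding between_conv paths_union_simps by fastforce
  moreover have "x \<in> verts ?H"
    using ends_on_path(1)[OF append_in_paths[OF ab]] append_in_paths[OF ab]
    unfolding between_conv paths_union_simps by blast
  ultimately have "dpath ?H x p z \<longleftrightarrow> p \<in> paths x z" "dpath ?H z p y \<longleftrightarrow> p \<in> paths z y" for p
    using z unfolding dpath_subgraph_iff[OF between_subgraph] by auto
  then show "between ?H x z = between (ug G) x z" "between ?H z y = between (ug G) z y"
    unfolding between_def[of ?H] between_def[of "ug G" x z] between_def[of "ug G" z y]
      path_graph_subgraph_eq[OF between_subgraph] dpath_iff
    using subgraph_fields[OF between_subgraph[of x y]] by (simp_all add: pre_digraph.Union_def)
qed

text \<open>The first edge that does not end before \<open>z\<close> starts after \<open>z\<close>; as the path was still before \<open>z\<close> there, the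
  edge starts at \<open>z\<close>.\<close>

lemma passes_through:
  assumes "p \<in> paths u y" "paths u z \<noteq> {}" "paths z y \<noteq> {}"
    "\<And>e. e \<in> set p \<Longrightarrow> paths (head (ug G) e) z \<noteq> {} \<or> paths z (tail (ug G) e) \<noteq> {}"
  shows "z \<in> set (awalk_verts u p)"
  using assms
proof (induction p arbitrary: u)
  case Nil
  then have "u = y" by simp
  then have "u = z" using Nil.prems(2,3) paths_antisym by blast
  then show ?case by simp
next
  case (Cons e p)
  then have e: "tail (ug G) e = u" "p \<in> paths (head (ug G) e) y" by (auto simp: Cons_in_paths)
  show ?case
  proof (cases "paths (head (ug G) e) z = {}")
    case True
    then have "paths z u \<noteq> {}" using Cons.prems(4)[of e] e by simp
    then have "u = z" using Cons.prems(2) paths_antisym by blast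
    then show ?thesis using e by simp
  next
    case False
    have "z \<in> set (awalk_verts (head (ug G) e) p)"
      by (rule Cons.IH[OF e(2) False Cons.prems(3)]) (use Cons.prems(4) in simp)
    then show ?thesis by simp
  qed
qed

lemma between_arc_ends:
  assumes "e \<in> arcs (between (ug G) x z)"
  shows "paths x (tail (ug G) e) \<noteq> {}" "paths (head (ug G) e) z \<noteq> {}"
proof -
  obtain p where "p \<in> paths x z" "e \<in> set p" using assms by (auto simp: between_conv paths_union_simps)
  then show "paths x (tail (ug G) e) \<noteq> {}" "paths (head (ug G) e) z \<noteq> {}" using edge_split by blast+
qed

text \<open>For a complete diagram, these are the simplices that the operation \<open>\<odot>\<close> adds.\<close>

definition composites :: "('v, 'e) pre_digraph set \<Rightarrow> 'v \<Rightarrow> 'v \<Rightarrow> nat \<Rightarrow> 'e list list set" where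
  "composites T x y n = {map2 (@) ps qs | z ps qs. z \<noteq> x \<and> z \<noteq> y \<and>
    ps \<in> chains T x z n \<and> qs \<in> chains T z y n}"

end

locale complete_pair = S: complete_family G S + T: complete_family G T
  for G :: "('v, 'e) plane" and S T +
  assumes incl: "S \<subseteq> T"
begin

text \<open>The restriction of a diagram from \<open>x\<close> to \<open>y\<close> has the same restrictions from \<open>x\<close> to \<open>z\<close> and from \<open>z\<close> to \<open>y\<close> as
  the whole diagram.\<close>

lemma joins_at_conv:
  assumes z: "z \<in> verts (between (ug G) x y)"
  shows "C \<in> joins_at G (between (ug G) x y, {A \<in> T. subgraph A (between (ug G) x y)}) z \<longleftrightarrow>
    C \<in> path_graphs (union (between (ug G) x z) (between (ug G) z y)) \<or>
    globular_sub G C \<and> (\<exists>A\<in>T. \<exists>B\<in>T. subgraph A (between (ug G) x z) \<and> subgraph B (between (ug G) z y) \<and>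
      wide A (between (ug G) x z) \<and> wide B (between (ug G) z y) \<and> subgraph C (union A B))"
proof -
  obtain a b where ab: "a \<in> S.paths x z" "b \<in> S.paths z y" using z unfolding S.between_vertex_iff by blast
  have ne: "S.paths x y \<noteq> {}" using S.append_in_paths[OF ab] by blast
  have "set p \<subseteq> arcs (between (ug G) x y)" "set (S.awalk_verts x p) \<subseteq> verts (between (ug G) x y)"
    if "p \<in> S.paths x z" for p
    using S.append_in_paths[OF that ab(2)] S.append_on_path[OF that ab(2)]
    unfolding S.between_conv S.paths_union_simps by fastforce+
  then have "verts (between (ug G) x z) \<subseteq> verts (between (ug G) x y)"
    "arcs (between (ug G) x z) \<subseteq> arcs (between (ug G) x y)"
    unfolding S.between_conv[of x z] S.paths_union_simps by blast+
  then have l: "subgraph (between (ug G) x z) (between (ug G) x y)"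
    using S.subgraph_iff[OF S.between_subgraph S.between_subgraph] by blast
  have "set p \<subseteq> arcs (between (ug G) x y)" "set (S.awalk_verts z p) \<subseteq> verts (between (ug G) x y)"
    if "p \<in> S.paths z y" for p
    using S.append_in_paths[OF ab(1) that] S.append_on_path[OF ab(1) that]
    unfolding S.between_conv S.paths_union_simps by fastforce+
  then have "verts (between (ug G) z y) \<subseteq> verts (between (ug G) x y)"
    "arcs (between (ug G) z y) \<subseteq> arcs (between (ug G) x y)"
    unfolding S.between_conv[of z y] S.paths_union_simps by blast+
  then have r: "subgraph (between (ug G) z y) (between (ug G) x y)"
    using S.subgraph_iff[OF S.between_subgraph S.between_subgraph] by blast
  show ?thesis
    unfolding joins_at_def restriction_def Let_def split S.between_ends[OF ne] S.between_between[OF z]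
    using subgraph_trans[OF _ l] subgraph_trans[OF _ r] by auto
qed

text \<open>The witnesses of a chain may lie in a join at \<open>z\<close> without the paths passing through \<open>z\<close>. In that case,
  the paths leave the join along an edge. This edge is common to all of them, so the chain can be cut at
  one of its ends, or else it consists of copies of this single edge.\<close>

lemma odot_nerve:
  "diagram_nerve G (odot G (restriction (ug G, S) x y) (restriction (ug G, T) x y)) =
    chain_sset (\<lambda>n. S.chains S x y n \<union> S.composites T x y n)"
proof -
  let ?H = "between (ug G) x y"
  let ?J = "\<lambda>z. joins_at G (?H, {A \<in> T. subgraph A ?H}) z"
  let ?A = "{A \<in> S. subgraph A ?H} \<union> (\<Union>z\<in>verts ?H - {src ?H, tgt ?H}. ?J z)"
  have S_nerve: "simplices (diagram_nerve G (?H, {A \<in> S. subgraph A ?H})) n = S.chains S x y n" for n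
    using arg_cong[OF S.diagram_nerve_restriction[of x y], of simplices]
    unfolding restriction_def split by simp
  have "simplices (diagram_nerve G (?H, ?A)) = (\<lambda>n. S.chains S x y n \<union> S.composites T x y n)"
  proof (rule ext, rule set_eqI, rule iffI)
    fix n ps
    assume "ps \<in> simplices (diagram_nerve G (?H, ?A)) n"
    then obtain A where ps: "length ps = Suc n" "set ps \<subseteq> S.paths x y" "\<forall>i<n. S.left_of (ps ! i) (ps ! Suc i)"
      and A: "A \<in> ?A" "\<forall>i<n. \<exists>\<gamma>. witness G ?H (ps ! i) (ps ! Suc i) \<gamma> \<and> subgraph \<gamma> A"
      unfolding S.simplices_diagram_nerve by blast
    note common = S.witnessed_chain_common[OF A(2) ps(1)]
    have ps_ne: "set ps \<noteq> {}" using ps(1) by auto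
    then have "S.paths x y \<noteq> {}" using ps(2) by auto
    note ends = S.between_ends[OF this]
    show "ps \<in> S.chains S x y n \<union> S.composites T x y n"
    proof (cases "A \<in> {A \<in> S. subgraph A ?H}")
      case True
      then have "ps \<in> simplices (diagram_nerve G (?H, {A \<in> S. subgraph A ?H})) n"
        unfolding S.simplices_diagram_nerve using ps A(2) by blast
      then show ?thesis unfolding S_nerve by blast
    next
      case False
      then obtain z where z: "z \<in> verts ?H" "z \<noteq> x" "z \<noteq> y" and J: "A \<in> ?J z"
        using A(1) ends by auto
      let ?L = "between (ug G) x z" and ?R = "between (ug G) z y"
      have zp: "S.paths x z \<noteq> {}" "S.paths z y \<noteq> {}" using z(1) unfolding S.between_vertex_iff by auto
      note zends = S.between_ends[OF zp(1)] S.between_ends[OF zp(2)]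
      have LR: "subgraph (union ?L ?R) (ug G)" by (rule subgraph_union[OF S.between_subgraph S.between_subgraph])
      have AT: "A \<in> T \<and> arcs A \<subseteq> arcs ?L \<union> arcs ?R"
        using J unfolding joins_at_conv[OF z(1)]
      proof (elim disjE conjE bexE)
        assume "A \<in> path_graphs (union ?L ?R)"
        then obtain u p v where p: "dpath (union ?L ?R) u p v" "A = path_graph (union ?L ?R) u p"
          unfolding path_graphs_def by blast
        then have "p \<in> S.paths u v" "set p \<subseteq> arcs (union ?L ?R)" unfolding S.dpath_subgraph_iff[OF LR] by auto
        moreover have "A = S.paths_union u {p}"
          using p(2) S.path_graph_subgraph_eq[OF LR] S.path_graph_conv by metis
        ultimately show ?thesis using T.S_path by (auto simp: union_def S.paths_union_simps)
      next
        fix A' B' assume *: "A' \<in> T" "B' \<in> T" "globular_sub G A" "subgraph A' ?L" "subgraph B' ?R"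
          "wide A' ?L" "wide B' ?R" "subgraph A (union A' B')"
        then have "union A' B' \<in> T" using T.S_join zends by (simp add: wide_def)
        then have "A \<in> T" using T.S_sub * by blast
        moreover have "arcs A \<subseteq> arcs A' \<union> arcs B'" using *(8) by (auto simp: subgraph_def union_def)
        ultimately show ?thesis using *(4,5) by (auto simp: subgraph_def)
      qed
      have "S.paths_union x (set ps) \<in> T"
        using T.S_paths_union[of A "set ps" x y] AT ps(2) ps_ne common by blast
      then have psT: "ps \<in> S.chains T x y n" using ps by (simp add: S.chains_def)
      have through: "ps \<in> S.composites T x y n" if v: "v \<noteq> x" "v \<noteq> y" "\<forall>p\<in>set ps. v \<in> set (S.awalk_verts x p)" for v
      proof -
        obtain qs rs where "qs \<in> S.chains T x v n" "rs \<in> S.chains T v y n" "ps = map2 (@) qs rs"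
          using T.chains_split[OF psT, of v] v(3) by blast
        then show ?thesis using v by (auto simp: S.composites_def)
      qed
      show ?thesis
      proof (cases "\<forall>p\<in>set ps. set p \<subseteq> arcs A")
        case True
        \<comment> \<open>all edges lie in the join at \<open>z\<close>, so all paths pass through \<open>z\<close>\<close>
        have "z \<in> set (S.awalk_verts x p)" if p: "p \<in> set ps" for p
        proof (rule S.passes_through[OF _ zp])
          show "p \<in> S.paths x y" using p ps(2) by blast
          fix e assume "e \<in> set p"
          then have "e \<in> arcs ?L \<or> e \<in> arcs ?R" using True p AT by blast
          then show "S.paths (head (ug G) e) z \<noteq> {} \<or> S.paths z (tail (ug G) e) \<noteq> {}"
            using S.between_arc_ends by blast
        qed
        then show ?thesis using through[OF z(2,3)] by blast
      next
        case False
        \<comment> \<open>an edge outside the join is common to all paths, and so are its ends\<close>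
        then obtain p0 e where e: "p0 \<in> set ps" "e \<in> set p0" "e \<notin> arcs A" by blast
        have all: "e \<in> set p" if "p \<in> set ps" for p using common[OF e(1) that e(2,3)] .
        show ?thesis
        proof (cases "tail (ug G) e = x \<and> head (ug G) e = y")
          case True
          have "p = [e]" if p: "p \<in> set ps" for p
          proof -
            have "p \<in> S.paths x y" using p ps(2) by blast
            then obtain q r where "p = q @ e # r" "q \<in> S.paths x x" "r \<in> S.paths y y"
              using S.edge_split[of p x y e] all[OF p] True by metis
            then show ?thesis using S.paths_refl by (auto split: if_splits)
          qed
          then have "set ps \<subseteq> {[e]}" by blast
          then have "set ps = {[e]}" using ps_ne by (simp add: subset_singleton_iff)
          then have "S.paths_union x (set ps) \<in> S" using S.S_path[of "[e]" x y] ps(2) by simp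
          then show ?thesis using ps by (simp add: S.chains_def)
        next
          case ends_e: False
          have on: "tail (ug G) e \<in> set (S.awalk_verts x p)" "head (ug G) e \<in> set (S.awalk_verts x p)"
            if p: "p \<in> set ps" for p
            using all[OF p] p ps(2) S.awalk_verts_arc1[of e p x] S.awalk_verts_arc2[of x p y e]
            by (auto simp: S.paths_def)
          obtain q r where qr: "q \<in> S.paths x (tail (ug G) e)" "r \<in> S.paths (head (ug G) e) y"
            using S.edge_split[of p0 x y e] e ps(2) by blast
          have "e \<in> arcs (ug G)" using e ps(2) S.paths_arcs by blast
          then have "S.rank x \<le> S.rank (tail (ug G) e)" "S.rank (tail (ug G) e) < S.rank (head (ug G) e)"
            "S.rank (head (ug G) e) \<le> S.rank y"
            using S.paths_rank[OF qr(1)] S.paths_rank[OF qr(2)] S.rank_less by auto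
          then have "tail (ug G) e \<noteq> y" "head (ug G) e \<noteq> x" by auto
          then show ?thesis using through[of "tail (ug G) e"] through[of "head (ug G) e"] on ends_e by blast
        qed
      qed
    qed
  next
    fix n ps
    assume "ps \<in> S.chains S x y n \<union> S.composites T x y n"
    then show "ps \<in> simplices (diagram_nerve G (?H, ?A)) n"
    proof
      assume "ps \<in> S.chains S x y n"
      then show ?thesis unfolding S_nerve[symmetric] S.simplices_diagram_nerve by blast
    next
      assume "ps \<in> S.composites T x y n"
      then obtain z qs rs where z: "z \<noteq> x" "z \<noteq> y" and qs: "qs \<in> S.chains T x z n" and rs: "rs \<in> S.chains T z y n"
        and ps: "ps = map2 (@) qs rs" by (auto simp: S.composites_def)
      let ?P = "S.paths_union x (set qs)" and ?Q = "S.paths_union z (set rs)"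
      have q: "set qs \<subseteq> S.paths x z" "set qs \<noteq> {}" "?P \<in> T" "length qs = Suc n"
        using qs by (auto simp: S.chains_def)
      have r: "set rs \<subseteq> S.paths z y" "set rs \<noteq> {}" "?Q \<in> T" "length rs = Suc n"
        using rs by (auto simp: S.chains_def)
      have ne: "S.paths x z \<noteq> {}" "S.paths z y \<noteq> {}" using q r by auto
      then have zH: "z \<in> verts ?H" unfolding S.between_vertex_iff by blast
      have "S.paths x y \<noteq> {}" using ne S.append_in_paths by blast
      note ends = S.between_ends[OF this]
      have psT: "ps \<in> S.chains T x y n" unfolding ps by (rule T.chains_append[OF qs rs])
      then have ps': "length ps = Suc n" "set ps \<subseteq> S.paths x y" "\<forall>i<n. S.left_of (ps ! i) (ps ! Suc i)"
        by (simp_all add: S.chains_def)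
      have PQ: "subgraph ?P (between (ug G) x z)" "subgraph ?Q (between (ug G) z y)"
        unfolding S.between_conv by (rule S.paths_union_mono[OF q(1) order_refl], rule S.paths_union_mono[OF r(1) order_refl])
      have wide: "wide ?P (between (ug G) x z)" "wide ?Q (between (ug G) z y)"
        unfolding wide_def using S.between_ends[OF ne(1)] S.between_ends[OF ne(2)]
          S.paths_union_ends[OF q(1,2)] S.paths_union_ends[OF r(1,2)] by auto
      have sub: "subgraph (union ?P ?Q) (ug G)"
        by (rule subgraph_union[OF S.paths_union_subgraph[OF q(1)] S.paths_union_subgraph[OF r(1)]])
      have "union ?P ?Q \<in> T" by (rule T.S_paths_union_join[OF q(1,2) r(1,2) q(3) r(3)])
      then have "globular_sub G (union ?P ?Q)"
        using T.complete unfolding complete_diagram_def pasting_diagram_def by blast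
      moreover have "subgraph (union ?P ?Q) (union ?P ?Q)" using S.subgraph_iff[OF sub sub] by blast
      ultimately have "union ?P ?Q \<in> ?J z" unfolding joins_at_conv[OF zH] using q(3) r(3) PQ wide by blast
      then have A: "union ?P ?Q \<in> ?A" using zH z ends by blast
      have "subgraph (S.paths_union x (set ps)) (union ?P ?Q)"
      proof -
        have "p \<in> set ps \<Longrightarrow> set (S.awalk_verts x p) \<subseteq> verts (union ?P ?Q) \<and> set p \<subseteq> arcs (union ?P ?Q)" for p
        proof -
          assume "p \<in> set ps"
          then obtain a b where ab: "(a, b) \<in> set (zip qs rs)" "p = a @ b" unfolding ps by auto
          then have in_set: "a \<in> set qs" "b \<in> set rs" using set_zip_leftD set_zip_rightD by metis+
          then have "set (S.awalk_verts x p) = set (S.awalk_verts x a) \<union> set (S.awalk_verts z b)"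
            unfolding ab(2) using q(1) r(1) by (intro S.append_on_path) blast+
          then show ?thesis using in_set ab(2) by (auto simp: union_def S.paths_union_simps)
        qed
        then show ?thesis
          unfolding S.subgraph_iff[OF S.paths_union_subgraph[OF ps'(2)] sub] S.paths_union_simps by blast
      qed
      from S.chain_witnesses[OF ps' this] show ?thesis
        unfolding S.simplices_diagram_nerve using ps' A by blast
    qed
  qed
  then have "diagram_nerve G (?H, ?A) = chain_sset (\<lambda>n. S.chains S x y n \<union> S.composites T x y n)"
    by (rule S.diagram_nerve_eq)
  then show ?thesis unfolding odot_def restriction_def split .
qed

end

section \<open>The simplicial category of a complete diagram\<close>

context complete_family
begin

lemma CC_simps [simp]:
  "objs (CC G (ug G, S)) = verts (ug G)"
  "shom (CC G (ug G, S)) x y = chain_sset (chains S x y)"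
  "sid (CC G (ug G, S)) x = [[]]"
  "scomp (CC G (ug G, S)) x y z n ps qs = map2 (@) ps qs"
  by (simp_all add: CC_def diagram_nerve_restriction)

lemma chains_identity:
  assumes "x \<in> verts (ug G)"
  shows "chains S x x n = {replicate (Suc n) []}"
proof -
  have "ps = replicate (Suc n) []" if "ps \<in> chains S x x n" for ps
    using that assms by (intro replicate_eqI) (auto simp: chains_def paths_refl)
  moreover have "replicate (Suc n) [] \<in> chains S x x n"
  proof -
    have "set (replicate (Suc n) []) = {[] :: 'e list}" by (simp only: set_replicate)
    then show ?thesis using S_path[of "[]" x x] assms left_of_refl unfolding chains_def
      by (simp del: replicate_Suc set_replicate_Suc)
  qed
  ultimately show ?thesis by blast
qed

lemma sid_deg_CC: "sid_deg (CC G (ug G, S)) x n = replicate (Suc n) []"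
  by (intro nth_equalityI) (simp_all add: sid_deg_def act_chain_sset less_Suc_eq_le del: upt_Suc replicate_Suc)

lemma map2_append_Nil:
  "length ps = Suc n \<Longrightarrow> map2 (@) (replicate (Suc n) []) ps = ps"
  "length ps = Suc n \<Longrightarrow> map2 (@) ps (replicate (Suc n) []) = ps"
  by (intro nth_equalityI; simp del: replicate_Suc)+

lemma map2_append_assoc:
  "map2 (@) (map2 (@) ps qs) rs = map2 (@) ps (map2 (@) qs rs)"
  by (intro nth_equalityI) auto

lemma reindex_append:
  assumes "\<theta> \<in> Delta m n" "length ps = Suc n" "length qs = Suc n"
  shows "map (\<lambda>i. map2 (@) ps qs ! \<theta> i) [0..<Suc m] =
    map2 (@) (map (\<lambda>i. ps ! \<theta> i) [0..<Suc m]) (map (\<lambda>i. qs ! \<theta> i) [0..<Suc m])"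
proof -
  have "\<theta> i < Suc n" if "i < Suc m" for i using assms(1) that by (auto simp: Delta_def PiE_iff less_Suc_eq_le)
  then show ?thesis using assms(2,3) by (intro nth_equalityI) (simp_all del: upt_Suc)
qed

lemma simplicial_category_CC: "simplicial_category (CC G (ug G, S))"
  unfolding simplicial_category_def CC_simps simplices_chain_sset act_chain_sset sid_deg_CC
proof (intro conjI ballI allI)
  show "simplicial_set (chain_sset (chains S a b))" for a b by (rule simplicial_set_chains)
  show "[[]] \<in> chains S a a 0" if "a \<in> verts (ug G)" for a using chains_identity[OF that, of 0] by simp
qed (auto simp: chains_append map2_append_Nil map2_append_assoc reindex_append chains_length
      simp del: upt_Suc replicate_Suc)

end

section \<open>Lifting functors by induction on the distance of two vertices\<close>

lemma sset_mapD:
  assumes "sset_map X Y f"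
  shows "x \<in> simplices X n \<Longrightarrow> f n x \<in> simplices Y n"
    "\<theta> \<in> Delta m n \<Longrightarrow> x \<in> simplices X n \<Longrightarrow> f m (act X m n \<theta> x) = act Y m n \<theta> (f n x)"
    "simplicial_set X" "simplicial_set Y"
  using assms unfolding sset_map_def by blast+

lemma simplicial_set_act:
  "simplicial_set X \<Longrightarrow> \<theta> \<in> Delta m n \<Longrightarrow> x \<in> simplices X n \<Longrightarrow> act X m n \<theta> x \<in> simplices X m"
  unfolding simplicial_set_def by blast

lemma sset_mapI:
  assumes "simplicial_set X" "simplicial_set Y"
    "\<And>n x. x \<in> simplices X n \<Longrightarrow> f n x \<in> simplices Y n"
    "\<And>n x. x \<notin> simplices X n \<Longrightarrow> f n x = undefined"
    "\<And>m n \<theta> x. \<theta> \<in> Delta m n \<Longrightarrow> x \<in> simplices X n \<Longrightarrow> f m (act X m n \<theta> x) = act Y m n \<theta> (f n x)"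
  shows "sset_map X Y f"
  using assms by (auto simp: sset_map_def PiE_iff extensional_def)

lemma sset_llpE:
  assumes llp: "sset_llp K K' i X Y f" and u: "sset_map K X u" and v: "sset_map K' Y v"
    and comm: "\<And>n k. k \<in> simplices K n \<Longrightarrow> f n (u n k) = v n (i n k)"
  obtains h where "sset_map K' X h" "\<And>n k. k \<in> simplices K n \<Longrightarrow> h n (i n k) = u n k"
    "\<And>n k. k \<in> simplices K' n \<Longrightarrow> f n (h n k) = v n k"
proof -
  have "\<forall>n. \<forall>k\<in>simplices K n. f n (u n k) = v n (i n k)" using comm by simp
  then obtain h where h: "sset_map K' X h" "\<forall>n. \<forall>k\<in>simplices K n. h n (i n k) = u n k"
    "\<forall>n. \<forall>k\<in>simplices K' n. f n (h n k) = v n k"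
    using llp[unfolded sset_llp_def, THEN spec, THEN spec, THEN mp, OF u, THEN mp, OF v] by auto
  show ?thesis by (rule that[OF h(1)]) (use h in simp_all)
qed

lemma simplicial_categoryD:
  assumes "simplicial_category A"
  shows "a \<in> objs A \<Longrightarrow> b \<in> objs A \<Longrightarrow> simplicial_set (shom A a b)"
    "a \<in> objs A \<Longrightarrow> sid A a \<in> simplices (shom A a a) 0"
    "a \<in> objs A \<Longrightarrow> b \<in> objs A \<Longrightarrow> c \<in> objs A \<Longrightarrow> f \<in> simplices (shom A a b) n \<Longrightarrow> g \<in> simplices (shom A b c) n \<Longrightarrow>
      scomp A a b c n f g \<in> simplices (shom A a c) n"
    "a \<in> objs A \<Longrightarrow> b \<in> objs A \<Longrightarrow> c \<in> objs A \<Longrightarrow> f \<in> simplices (shom A a b) n \<Longrightarrow> g \<in> simplices (shom A b c) n \<Longrightarrow>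
      \<theta> \<in> Delta m n \<Longrightarrow> act (shom A a c) m n \<theta> (scomp A a b c n f g) =
        scomp A a b c m (act (shom A a b) m n \<theta> f) (act (shom A b c) m n \<theta> g)"
    "a \<in> objs A \<Longrightarrow> b \<in> objs A \<Longrightarrow> f \<in> simplices (shom A a b) n \<Longrightarrow> scomp A a a b n (sid_deg A a n) f = f"
    "a \<in> objs A \<Longrightarrow> b \<in> objs A \<Longrightarrow> f \<in> simplices (shom A a b) n \<Longrightarrow> scomp A a b b n f (sid_deg A b n) = f"
    "a \<in> objs A \<Longrightarrow> b \<in> objs A \<Longrightarrow> c \<in> objs A \<Longrightarrow> d \<in> objs A \<Longrightarrow> f \<in> simplices (shom A a b) n \<Longrightarrow>
      g \<in> simplices (shom A b c) n \<Longrightarrow> h \<in> simplices (shom A c d) n \<Longrightarrow>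
        scomp A a c d n (scomp A a b c n f g) h = scomp A a b d n f (scomp A b c d n g h)"
  using assms unfolding simplicial_category_def by simp_all

lemma simplicial_functorD:
  assumes "simplicial_functor A B F"
  shows "simplicial_category A" "simplicial_category B"
    "a \<in> objs A \<Longrightarrow> fobj F a \<in> objs B"
    "a \<in> objs A \<Longrightarrow> b \<in> objs A \<Longrightarrow> sset_map (shom A a b) (shom B (fobj F a) (fobj F b)) (fhom F a b)"
    "a \<in> objs A \<Longrightarrow> fhom F a a 0 (sid A a) = sid B (fobj F a)"
    "a \<in> objs A \<Longrightarrow> b \<in> objs A \<Longrightarrow> c \<in> objs A \<Longrightarrow> f \<in> simplices (shom A a b) n \<Longrightarrow> g \<in> simplices (shom A b c) n \<Longrightarrow>
        fhom F a c n (scomp A a b c n f g) =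
        scomp B (fobj F a) (fobj F b) (fobj F c) n (fhom F a b n f) (fhom F b c n g)"
  using assms unfolding simplicial_functor_def by auto

lemma constant_Delta: "(\<lambda>i\<in>{..n}. 0) \<in> Delta n 0"
  by (auto simp: Delta_def mono_on_def)

lemma functor_sid_deg:
  assumes F: "simplicial_functor A B F" and a: "a \<in> objs A"
  shows "fhom F a a n (sid_deg A a n) = sid_deg B (fobj F a) n"
  unfolding sid_deg_def
  using sset_mapD(2)[OF simplicial_functorD(4)[OF F a a] constant_Delta
      simplicial_categoryD(2)[OF simplicial_functorD(1)[OF F] a]] simplicial_functorD(5)[OF F a] by simp

text \<open>A square from the inclusion of the categories of \<open>\<Sigma>\<close> and \<open>\<Pi>\<close> to \<open>F\<close>, whose diagonal is to be found.\<close>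

locale lifting_problem = complete_pair G S T
  for G :: "('v, 'e) plane" and S T +
  fixes A :: "('o, 'u) scat" and B :: "('p, 'w) scat" and F U V
  assumes F: "simplicial_functor A B F"
    and U: "simplicial_functor (CC G (ug G, S)) A U"
    and V: "simplicial_functor (CC G (ug G, T)) B V"
    and square: "comp_eq (CC G (ug G, S)) F U V (CC_incl G (ug G, S))"
begin

abbreviation "W \<equiv> verts (ug G)"
abbreviation "ob \<equiv> fobj U"
abbreviation "X x y \<equiv> shom A (ob x) (ob y)"
abbreviation "Y x y \<equiv> shom B (fobj F (ob x)) (fobj F (ob y))"
abbreviation "\<phi> x y \<equiv> fhom F (ob x) (ob y)"
abbreviation "cmp x y z \<equiv> scomp A (ob x) (ob y) (ob z)"
abbreviation "gap x y \<equiv> S.rank y - S.rank x"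

lemma A: "simplicial_category A" and B: "simplicial_category B"
  using simplicial_functorD[OF F] by auto

lemma ob_in: "x \<in> W \<Longrightarrow> ob x \<in> objs A"
  using simplicial_functorD(3)[OF U] by simp

lemma obV: "x \<in> W \<Longrightarrow> fobj V x = fobj F (ob x)"
  using square by (simp add: comp_eq_def CC_incl_def sfun_id_def)

lemma U_map: "x \<in> W \<Longrightarrow> y \<in> W \<Longrightarrow> sset_map (chain_sset (S.chains S x y)) (X x y) (fhom U x y)"
  using simplicial_functorD(4)[OF U] by simp

lemma V_map: "x \<in> W \<Longrightarrow> y \<in> W \<Longrightarrow> sset_map (chain_sset (S.chains T x y)) (Y x y) (fhom V x y)"
  using simplicial_functorD(4)[OF V] by (simp add: obV)

lemma square_hom:
  "x \<in> W \<Longrightarrow> y \<in> W \<Longrightarrow> s \<in> S.chains S x y n \<Longrightarrow> \<phi> x y n (fhom U x y n s) = fhom V x y n s"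
  using square by (simp add: comp_eq_def CC_incl_def sfun_id_def sset_incl_def)

lemma U_comp:
  "x \<in> W \<Longrightarrow> y \<in> W \<Longrightarrow> z \<in> W \<Longrightarrow> p \<in> S.chains S x z n \<Longrightarrow> q \<in> S.chains S z y n \<Longrightarrow>
    fhom U x y n (map2 (@) p q) = cmp x z y n (fhom U x z n p) (fhom U z y n q)"
  using simplicial_functorD(6)[OF U, of x z y] by simp

lemma V_comp:
  "x \<in> W \<Longrightarrow> y \<in> W \<Longrightarrow> z \<in> W \<Longrightarrow> p \<in> S.chains T x z n \<Longrightarrow> q \<in> S.chains T z y n \<Longrightarrow>
    fhom V x y n (map2 (@) p q) = scomp B (fobj F (ob x)) (fobj F (ob z)) (fobj F (ob y)) n (fhom V x z n p) (fhom V z y n q)"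
  using simplicial_functorD(6)[OF V, of x z y] by (simp add: obV)

lemma chains_verts: "ps \<in> S.chains T x y n \<Longrightarrow> x \<in> W \<and> y \<in> W"
  using S.chains_paths[of ps T x y n 0] S.paths_verts by blast

lemma chains_dist:
  assumes "ps \<in> S.chains T x z n" "qs \<in> S.chains T z y n"
  shows "gap x z \<le> gap x y" "gap z y \<le> gap x y" "z \<noteq> y \<Longrightarrow> gap x z < gap x y" "z \<noteq> x \<Longrightarrow> gap z y < gap x y"
proof -
  have p: "ps ! 0 \<in> S.paths x z" "qs ! 0 \<in> S.paths z y"
    using S.chains_paths assms by blast+
  have "S.rank x \<le> S.rank z" "S.rank z \<le> S.rank y" using S.paths_rank[OF p(1)] S.paths_rank[OF p(2)] by auto
  moreover have "z \<noteq> y \<Longrightarrow> S.rank z < S.rank y" "z \<noteq> x \<Longrightarrow> S.rank x < S.rank z"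
    using S.paths_rank_less[OF p(1)] S.paths_rank_less[OF p(2)] by auto
  ultimately show "gap x z \<le> gap x y" "gap z y \<le> gap x y" "z \<noteq> y \<Longrightarrow> gap x z < gap x y" "z \<noteq> x \<Longrightarrow> gap z y < gap x y"
    by linarith+
qed

text \<open>\<open>lifts x y g\<close> says that \<open>g\<close> is a diagonal of the square of mapping spaces from \<open>x\<close> to \<open>y\<close>; a family \<open>h\<close>
  of diagonals is a functor if it is multiplicative.\<close>

definition lifts :: "'v \<Rightarrow> 'v \<Rightarrow> ('e list list, 'u) smap \<Rightarrow> bool" where
  "lifts x y g \<longleftrightarrow> sset_map (chain_sset (S.chains T x y)) (X x y) g \<and>
    (\<forall>n. \<forall>s\<in>S.chains T x y n. \<phi> x y n (g n s) = fhom V x y n s) \<and>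
    (\<forall>n. \<forall>s\<in>S.chains S x y n. g n s = fhom U x y n s)"

definition multiplicative :: "('v \<Rightarrow> 'v \<Rightarrow> ('e list list, 'u) smap) \<Rightarrow> 'v \<Rightarrow> 'v \<Rightarrow> bool" where
  "multiplicative h x y \<longleftrightarrow> (\<forall>z n. \<forall>p\<in>S.chains T x z n. \<forall>q\<in>S.chains T z y n.
    h x y n (map2 (@) p q) = cmp x z y n (h x z n p) (h z y n q))"

definition lifts_below :: "nat \<Rightarrow> ('v \<Rightarrow> 'v \<Rightarrow> ('e list list, 'u) smap) \<Rightarrow> bool" where
  "lifts_below N h \<longleftrightarrow> (\<forall>x\<in>W. \<forall>y\<in>W. gap x y < N \<longrightarrow> lifts x y (h x y) \<and> multiplicative h x y)"

text \<open>For \<open>x\<close> and \<open>y\<close> at distance \<open>N\<close>, the values of a lift on \<open>N(\<Sigma>\<^sub>x\<^sub>y \<odot> \<Pi>\<^sub>x\<^sub>y)\<close> are determined by the functor \<open>U\<close>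
  and by the lifts at smaller distances. The relation \<open>forced\<close> records these values; that it is a function
  remains to be shown.\<close>

definition forced :: "('v \<Rightarrow> 'v \<Rightarrow> ('e list list, 'u) smap) \<Rightarrow> 'v \<Rightarrow> 'v \<Rightarrow> nat \<Rightarrow> 'e list list \<Rightarrow> 'u \<Rightarrow> bool" where
  "forced h x y n s r \<longleftrightarrow> s \<in> S.chains S x y n \<and> r = fhom U x y n s \<or>
    (\<exists>z p q. z \<noteq> x \<and> z \<noteq> y \<and> p \<in> S.chains T x z n \<and> q \<in> S.chains T z y n \<and> s = map2 (@) p q \<and>
      r = cmp x z y n (h x z n p) (h z y n q))"

lemma lifts_in: "lifts x y g \<Longrightarrow> s \<in> S.chains T x y n \<Longrightarrow> g n s \<in> simplices (X x y) n"
  unfolding lifts_def using sset_mapD(1) by fastforce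

lemma lifts_act:
  "lifts x y g \<Longrightarrow> s \<in> S.chains T x y n \<Longrightarrow> \<theta> \<in> Delta m n \<Longrightarrow>
    g m (map (\<lambda>i. s ! \<theta> i) [0..<Suc m]) = act (X x y) m n \<theta> (g n s)"
  unfolding lifts_def using sset_mapD(2)[of "chain_sset (S.chains T x y)" "X x y" g \<theta> m n s]
  by (simp add: act_chain_sset del: upt_Suc)

text \<open>Each path of the chain is cut at \<open>z'\<close> and at \<open>z\<close>; the parts in between form the chain \<open>m\<close>.\<close>

lemma splittings_refine:
  assumes p: "p \<in> S.chains T x z n" "q \<in> S.chains T z y n" and p': "p' \<in> S.chains T x z' n" "q' \<in> S.chains T z' y n"
    and eq: "map2 (@) p q = map2 (@) p' q'" and le: "S.paths z' z \<noteq> {}"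
  obtains m where "m \<in> S.chains T z' z n" "p = map2 (@) p' m" "q' = map2 (@) m q"
proof -
  have len: "length p = Suc n" "length q = Suc n" "length p' = Suc n" "length q' = Suc n"
    using p p' by (simp_all add: S.chains_def)
  have "\<exists>m\<in>S.paths z' z. p ! i = p' ! i @ m \<and> q' ! i = m @ q ! i" if i: "i < Suc n" for i
  proof -
    have pi: "p ! i \<in> S.paths x z" "p' ! i \<in> S.paths x z'" using S.chains_paths p p' i by (simp_all add: less_Suc_eq_le)
    have "p ! i @ q ! i = p' ! i @ q' ! i" using arg_cong[OF eq, of "\<lambda>s. s ! i"] len i by simp
    then obtain m where "p ! i = p' ! i @ m \<and> m @ q ! i = q' ! i \<or> p ! i @ m = p' ! i \<and> q ! i = m @ q' ! i"
      by (auto simp: append_eq_append_conv2)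
    then show ?thesis
    proof (elim disjE conjE)
      assume m: "p ! i = p' ! i @ m" "m @ q ! i = q' ! i"
      have "p' ! i @ m \<in> S.paths x z" using pi m by simp
      then obtain w where "p' ! i \<in> S.paths x w" "m \<in> S.paths w z" by (rule S.paths_appendE)
      then have "m \<in> S.paths z' z" using S.paths_ends_unique pi(2) by metis
      then show ?thesis using m by auto
    next
      assume m: "p ! i @ m = p' ! i" "q ! i = m @ q' ! i"
      have "p ! i @ m \<in> S.paths x z'" using pi m by simp
      then obtain w where "p ! i \<in> S.paths x w" "m \<in> S.paths w z'" by (rule S.paths_appendE)
      then have mz: "m \<in> S.paths z z'" using S.paths_ends_unique pi(1) by metis
      then have "z = z'" using le S.paths_antisym by blast
      then have "m = []" "[] \<in> S.paths z' z" using mz S.paths_refl S.paths_verts(1)[OF mz] by (auto split: if_splits)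
      then show ?thesis using m by (intro bexI[of _ "[]"]) auto
    qed
  qed
  then obtain m where m: "\<And>i. i < Suc n \<Longrightarrow> m i \<in> S.paths z' z"
    "\<And>i. i < Suc n \<Longrightarrow> p ! i = p' ! i @ m i \<and> q' ! i = m i @ q ! i" by metis
  let ?m = "map m [0..<Suc n]"
  have eqs: "p = map2 (@) p' ?m" "q' = map2 (@) ?m q"
    using m(2) len by (auto intro!: nth_equalityI simp del: upt_Suc)
  have "set p' \<subseteq> S.paths x z'" using p'(1) by (simp add: S.chains_def)
  moreover have "set ?m \<subseteq> S.paths z' z" using m(1) by (auto simp del: upt_Suc)
  ultimately have "?m \<in> S.chains T z' z n"
    using T.chains_appendD(2)[of p' ?m x z n z'] p(1) eqs(1) len by simp
  then show ?thesis using that eqs by blast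
qed

context
  fixes N h x y
  assumes below: "lifts_below N h" and x: "x \<in> W" and y: "y \<in> W" and N: "gap x y \<le> N"
begin

lemma below_lifts: "u \<in> W \<Longrightarrow> v \<in> W \<Longrightarrow> gap u v < N \<Longrightarrow> lifts u v (h u v)"
  and below_mult: "gap u v < N \<Longrightarrow> p \<in> S.chains T u z n \<Longrightarrow> q \<in> S.chains T z v n \<Longrightarrow>
    h u v n (map2 (@) p q) = cmp u z v n (h u z n p) (h z v n q)"
  using below chains_verts unfolding lifts_below_def multiplicative_def by blast+

lemma split_lifts:
  assumes "z \<noteq> x" "z \<noteq> y" "p \<in> S.chains T x z n" "q \<in> S.chains T z y n"
  shows "z \<in> W" "gap x z < N" "gap z y < N" "lifts x z (h x z)" "lifts z y (h z y)"
proof -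
  show "z \<in> W" using chains_verts assms by blast
  show d: "gap x z < N" "gap z y < N" using chains_dist(3,4)[OF assms(3,4)] assms(1,2) N by linarith+
  show "lifts x z (h x z)" "lifts z y (h z y)" using below_lifts x y \<open>z \<in> W\<close> d by auto
qed

text \<open>Both values are the composite of three elements, up to associativity.\<close>

lemma forced_splittings:
  assumes "z \<noteq> x" "z \<noteq> y" "p \<in> S.chains T x z n" "q \<in> S.chains T z y n"
    and "z' \<noteq> x" "z' \<noteq> y" "p' \<in> S.chains T x z' n" "q' \<in> S.chains T z' y n"
    and eq: "map2 (@) p q = map2 (@) p' q'" and le: "S.paths z' z \<noteq> {}"
  shows "cmp x z y n (h x z n p) (h z y n q) = cmp x z' y n (h x z' n p') (h z' y n q')"
proof -
  note l = split_lifts[OF assms(1-4)] and l' = split_lifts[OF assms(5-8)]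
  obtain m where m: "m \<in> S.chains T z' z n" "p = map2 (@) p' m" "q' = map2 (@) m q"
    using splittings_refine[OF assms(3,4,7,8) eq le] .
  have "gap z' z \<le> gap x z" using chains_dist(2)[OF assms(7) m(1)] .
  then have "lifts z' z (h z' z)" using below_lifts l l' by simp
  then have in_X: "h x z' n p' \<in> simplices (X x z') n" "h z' z n m \<in> simplices (X z' z) n" "h z y n q \<in> simplices (X z y) n"
    using lifts_in l(5) l'(4) m(1) assms(4,7) by blast+
  have "h x z n p = cmp x z' z n (h x z' n p') (h z' z n m)"
    unfolding m(2) by (rule below_mult[OF l(2) assms(7) m(1)])
  moreover have "h z' y n q' = cmp z' z y n (h z' z n m) (h z y n q)"
    unfolding m(3) by (rule below_mult[OF l'(3) m(1) assms(4)])
  ultimately show ?thesis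
    using simplicial_categoryD(7)[OF A ob_in[OF x] ob_in[OF l'(1)] ob_in[OF l(1)] ob_in[OF y] in_X] by simp
qed

text \<open>The parts of a chain for \<open>S\<close> are chains for \<open>S\<close>, where the lifts agree with the functor \<open>U\<close>.\<close>

lemma forced_chain:
  assumes "z \<noteq> x" "z \<noteq> y" "p \<in> S.chains T x z n" "q \<in> S.chains T z y n" and s: "map2 (@) p q \<in> S.chains S x y n"
  shows "fhom U x y n (map2 (@) p q) = cmp x z y n (h x z n p) (h z y n q)"
proof -
  note l = split_lifts[OF assms(1-4)]
  have pq: "p \<in> S.chains S x z n" "q \<in> S.chains S z y n"
    using S.chains_appendD[OF s] assms(3,4) by (auto simp: S.chains_def)
  then have "h x z n p = fhom U x z n p" "h z y n q = fhom U z y n q"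
    using l(4,5) by (auto simp: lifts_def)
  then show ?thesis using U_comp[OF x y l(1) pq] by simp
qed

lemma forced_unique:
  assumes "forced h x y n s r" "forced h x y n s r'"
  shows "r = r'"
proof -
  have splits: "cmp x z y n (h x z n p) (h z y n q) = cmp x z' y n (h x z' n p') (h z' y n q')"
    if "z \<noteq> x" "z \<noteq> y" "p \<in> S.chains T x z n" "q \<in> S.chains T z y n"
      "z' \<noteq> x" "z' \<noteq> y" "p' \<in> S.chains T x z' n" "q' \<in> S.chains T z' y n" "map2 (@) p q = map2 (@) p' q'"
    for z p q z' p' q'
  proof -
    have ends: "p ! 0 \<in> S.paths x z" "p' ! 0 \<in> S.paths x z'"
      using S.chains_paths that by blast+
    have "length p = Suc n" "length q = Suc n" "length p' = Suc n" "length q' = Suc n"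
      using that by (simp_all add: S.chains_def)
    then have "p ! 0 @ q ! 0 = p' ! 0 @ q' ! 0" using arg_cong[OF that(9), of "\<lambda>s. s ! 0"] by simp
    then obtain m where "p ! 0 = p' ! 0 @ m \<or> p ! 0 @ m = p' ! 0"
      by (auto simp: append_eq_append_conv2)
    then consider "S.paths z' z \<noteq> {}" | "S.paths z z' \<noteq> {}"
      using ends S.paths_ends_unique by (metis S.paths_appendE empty_iff)
    then show ?thesis
    proof cases
      case 1
      show ?thesis by (rule forced_splittings[OF that 1])
    next
      case 2
      show ?thesis by (rule forced_splittings[OF that(5-8) that(1-4) that(9)[symmetric] 2, symmetric])
    qed
  qed
  have chain: "r1 = r2" if s: "s \<in> S.chains S x y n" "r1 = fhom U x y n s" and r2: "forced h x y n s r2" for r1 r2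
    using r2 unfolding forced_def
  proof (elim disjE conjE exE)
    fix z p q assume "z \<noteq> x" "z \<noteq> y" "p \<in> S.chains T x z n" "q \<in> S.chains T z y n" "s = map2 (@) p q"
      "r2 = cmp x z y n (h x z n p) (h z y n q)"
    then show "r1 = r2" using forced_chain[of z p n q] s by simp
  qed (use s in simp)
  show ?thesis using assms(1) unfolding forced_def
  proof (elim disjE conjE exE)
    fix z p q assume *: "z \<noteq> x" "z \<noteq> y" "p \<in> S.chains T x z n" "q \<in> S.chains T z y n" "s = map2 (@) p q"
      "r = cmp x z y n (h x z n p) (h z y n q)"
    show "r = r'" using assms(2) unfolding forced_def
    proof (elim disjE conjE exE)
      fix z' p' q' assume **: "z' \<noteq> x" "z' \<noteq> y" "p' \<in> S.chains T x z' n" "q' \<in> S.chains T z' y n"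
        "s = map2 (@) p' q'" "r' = cmp x z' y n (h x z' n p') (h z' y n q')"
      then show "r = r'" using splits[OF *(1-4) **(1-4)] *(5,6) by simp
    qed (use chain assms(1) in metis)
  qed (use chain assms(2) in metis)
qed

lemma forced_in: "forced h x y n s r \<Longrightarrow> r \<in> simplices (X x y) n"
  unfolding forced_def
proof (elim disjE conjE exE)
  show "r \<in> simplices (X x y) n" if "s \<in> S.chains S x y n" "r = fhom U x y n s"
    using sset_mapD(1)[OF U_map[OF x y], of s n] that by simp
  fix z p q assume *: "z \<noteq> x" "z \<noteq> y" "p \<in> S.chains T x z n" "q \<in> S.chains T z y n"
    "r = cmp x z y n (h x z n p) (h z y n q)"
  note l = split_lifts[OF *(1-4)]
  show "r \<in> simplices (X x y) n"
    unfolding *(5) by (rule simplicial_categoryD(3)[OF A ob_in[OF x] ob_in[OF l(1)] ob_in[OF y]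
        lifts_in[OF l(4) *(3)] lifts_in[OF l(5) *(4)]])
qed

lemma forced_act:
  assumes "forced h x y n s r" "\<theta> \<in> Delta m n"
  shows "forced h x y m (map (\<lambda>i. s ! \<theta> i) [0..<Suc m]) (act (X x y) m n \<theta> r)"
  using assms(1) unfolding forced_def[of h x y n]
proof (elim disjE conjE exE)
  assume s: "s \<in> S.chains S x y n" "r = fhom U x y n s"
  have "fhom U x y m (map (\<lambda>i. s ! \<theta> i) [0..<Suc m]) = act (X x y) m n \<theta> r"
    using sset_mapD(2)[OF U_map[OF x y] assms(2), of s] s by (simp add: act_chain_sset del: upt_Suc)
  then show ?thesis unfolding forced_def using S.chains_reindex[OF s(1) assms(2)] by metis
next
  fix z p q assume *: "z \<noteq> x" "z \<noteq> y" "p \<in> S.chains T x z n" "q \<in> S.chains T z y n"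
    "s = map2 (@) p q" "r = cmp x z y n (h x z n p) (h z y n q)"
  note l = split_lifts[OF *(1-4)]
  have "map (\<lambda>i. s ! \<theta> i) [0..<Suc m] =
      map2 (@) (map (\<lambda>i. p ! \<theta> i) [0..<Suc m]) (map (\<lambda>i. q ! \<theta> i) [0..<Suc m])"
    unfolding *(5) using S.reindex_append[OF assms(2)] S.chains_length *(3,4) by metis
  moreover have "act (X x y) m n \<theta> r = cmp x z y m (h x z m (map (\<lambda>i. p ! \<theta> i) [0..<Suc m])) (h z y m (map (\<lambda>i. q ! \<theta> i) [0..<Suc m]))"
    unfolding *(6) lifts_act[OF l(4) *(3) assms(2)] lifts_act[OF l(5) *(4) assms(2)]
    by (rule simplicial_categoryD(4)[OF A ob_in[OF x] ob_in[OF l(1)] ob_in[OF y]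
        lifts_in[OF l(4) *(3)] lifts_in[OF l(5) *(4)] assms(2)])
  ultimately show ?thesis
    unfolding forced_def using *(1,2) T.chains_reindex[OF *(3) assms(2)] T.chains_reindex[OF *(4) assms(2)] by blast
qed

lemma forced_image: "forced h x y n s r \<Longrightarrow> \<phi> x y n r = fhom V x y n s"
  unfolding forced_def
proof (elim disjE conjE exE)
  show "\<phi> x y n r = fhom V x y n s" if "s \<in> S.chains S x y n" "r = fhom U x y n s"
    using square_hom[OF x y] that by simp
  fix z p q assume *: "z \<noteq> x" "z \<noteq> y" "p \<in> S.chains T x z n" "q \<in> S.chains T z y n"
    "s = map2 (@) p q" "r = cmp x z y n (h x z n p) (h z y n q)"
  note l = split_lifts[OF *(1-4)]
  have "\<phi> x z n (h x z n p) = fhom V x z n p" "\<phi> z y n (h z y n q) = fhom V z y n q"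
    using l(4,5) *(3,4) by (auto simp: lifts_def)
  then show "\<phi> x y n r = fhom V x y n s"
    unfolding *(5,6) V_comp[OF x y l(1) *(3,4)]
    using simplicial_functorD(6)[OF F ob_in[OF x] ob_in[OF l(1)] ob_in[OF y] lifts_in[OF l(4) *(3)] lifts_in[OF l(5) *(4)]] by simp
qed

text \<open>The forced values form a simplicial map, and any diagonal of the resulting square of simplicial sets
  continues the family of lifts.\<close>

lemma lift_exists:
  assumes llp: "sset_llp (chain_sset (\<lambda>n. S.chains S x y n \<union> S.composites T x y n)) (chain_sset (S.chains T x y))
      (sset_incl (chain_sset (\<lambda>n. S.chains S x y n \<union> S.composites T x y n))) (X x y) (Y x y) (\<phi> x y)"
    and O: "simplicial_set (chain_sset (\<lambda>n. S.chains S x y n \<union> S.composites T x y n))"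
  obtains g where "lifts x y g" "\<And>n s r. forced h x y n s r \<Longrightarrow> g n s = r"
proof -
  let ?O = "\<lambda>n. S.chains S x y n \<union> S.composites T x y n"
  define k where "k n s = (if s \<in> ?O n then THE r. forced h x y n s r else undefined)" for n s
  have ex: "\<exists>r. forced h x y n s r" if "s \<in> ?O n" for n s
    using that by (auto simp: forced_def S.composites_def)
  have kI: "k n s = r" if "s \<in> ?O n" "forced h x y n s r" for n s r
    unfolding k_def using that forced_unique by (auto intro: the_equality)
  have k: "forced h x y n s (k n s)" if "s \<in> ?O n" for n s
    using ex[OF that] kI[OF that] by metis
  have O_act: "map (\<lambda>i. s ! \<theta> i) [0..<Suc m] \<in> ?O m" if "\<theta> \<in> Delta m n" "s \<in> ?O n" for m n \<theta> s
    using simplicial_set_act[OF O that(1), of s] that(2) by (simp add: act_chain_sset del: upt_Suc)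
  have k_map: "sset_map (chain_sset ?O) (X x y) k"
  proof (rule sset_mapI[OF O])
    show "simplicial_set (X x y)" by (rule simplicial_categoryD(1)[OF A ob_in[OF x] ob_in[OF y]])
    show "k n s \<in> simplices (X x y) n" if "s \<in> simplices (chain_sset ?O) n" for n s
      using forced_in[OF k[of s n]] that by simp
    show "k n s = undefined" if "s \<notin> simplices (chain_sset ?O) n" for n s
      using that by (simp add: k_def)
    show "k m (act (chain_sset ?O) m n \<theta> s) = act (X x y) m n \<theta> (k n s)"
      if "\<theta> \<in> Delta m n" "s \<in> simplices (chain_sset ?O) n" for m n \<theta> s
      using kI[OF O_act forced_act[OF k]] that unfolding act_chain_sset by simp
  qed
  have "\<phi> x y n (k n s) = fhom V x y n (sset_incl (chain_sset ?O) n s)" if "s \<in> simplices (chain_sset ?O) n" for n s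
    using forced_image[OF k[of s n]] that by (simp add: sset_incl_def)
  from sset_llpE[OF llp k_map V_map[OF x y] this]
  obtain g where g: "sset_map (chain_sset (S.chains T x y)) (X x y) g"
    "\<And>n s. s \<in> simplices (chain_sset ?O) n \<Longrightarrow> g n (sset_incl (chain_sset ?O) n s) = k n s"
    "\<And>n s. s \<in> simplices (chain_sset (S.chains T x y)) n \<Longrightarrow> \<phi> x y n (g n s) = fhom V x y n s"
    by blast
  have g_forced: "g n s = r" if "forced h x y n s r" for n s r
  proof -
    have "s \<in> ?O n" using that by (auto simp: forced_def S.composites_def)
    then show ?thesis using g(2)[of s n] kI that by (simp add: sset_incl_def)
  qed
  have "lifts x y g" unfolding lifts_def
    using g(1,3) g_forced by (simp add: forced_def)
  then show ?thesis using that g_forced by blast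
qed

end

end

context lifting_problem
begin

text \<open>The trivial paths belong to every diagram, so the lift is already known there. This yields
  multiplicativity for composition with trivial paths.\<close>

lemma lifts_identity:
  assumes x: "x \<in> W" and g: "lifts x x g" and s: "s \<in> S.chains T x x n"
  shows "s = replicate (Suc n) []" "g n s = sid_deg A (ob x) n"
proof -
  show s': "s = replicate (Suc n) []" using s T.chains_identity[OF x] by simp
  then have "s \<in> S.chains S x x n" using S.chains_identity[OF x] by simp
  then have "g n s = fhom U x x n s" using g by (simp add: lifts_def)
  also have "\<dots> = fhom U x x n (sid_deg (CC G (ug G, S)) x n)" unfolding s' S.sid_deg_CC ..
  also have "\<dots> = sid_deg A (ob x) n" by (rule functor_sid_deg[OF U]) (simp add: x)
  finally show "g n s = sid_deg A (ob x) n" .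
qed

lemma lifts_below_Suc:
  assumes below: "lifts_below N h"
    and llp: "\<And>x y. x \<in> W \<Longrightarrow> y \<in> W \<Longrightarrow>
      sset_llp (chain_sset (\<lambda>n. S.chains S x y n \<union> S.composites T x y n)) (chain_sset (S.chains T x y))
        (sset_incl (chain_sset (\<lambda>n. S.chains S x y n \<union> S.composites T x y n))) (X x y) (Y x y) (\<phi> x y)"
    and O: "\<And>x y. x \<in> W \<Longrightarrow> y \<in> W \<Longrightarrow> simplicial_set (chain_sset (\<lambda>n. S.chains S x y n \<union> S.composites T x y n))"
  shows "\<exists>h'. lifts_below (Suc N) h'"
proof -
  define g where "g x y = (SOME g. lifts x y g \<and> (\<forall>n s r. forced h x y n s r \<longrightarrow> g n s = r))" for x y
  have g: "lifts x y (g x y)" "forced h x y n s r \<Longrightarrow> g x y n s = r"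
    if xy: "x \<in> W" "y \<in> W" "gap x y = N" for x y n s r
  proof -
    have "\<exists>g. lifts x y g \<and> (\<forall>n s r. forced h x y n s r \<longrightarrow> g n s = r)"
      using lift_exists[OF below xy(1,2) eq_imp_le[OF xy(3)] llp[OF xy(1,2)] O[OF xy(1,2)]] by metis
    from someI_ex[OF this] show "lifts x y (g x y)" "forced h x y n s r \<Longrightarrow> g x y n s = r"
      unfolding g_def by auto
  qed
  define h' where "h' x y = (if gap x y = N then g x y else h x y)" for x y
  have lift: "lifts x y (h' x y)" if "x \<in> W" "y \<in> W" "gap x y < Suc N" for x y
    using that g(1) below_lifts[OF below that(1,2) _ that(1,2), of] below unfolding h'_def lifts_below_def
    by (cases "gap x y = N") auto
  have "multiplicative h' x y" if xy: "x \<in> W" "y \<in> W" "gap x y < Suc N" for x y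
    unfolding multiplicative_def
  proof (intro allI ballI)
    fix z n p q assume p: "p \<in> S.chains T x z n" and q: "q \<in> S.chains T z y n"
    have len: "length p = Suc n" "length q = Suc n" using p q by (simp_all add: S.chains_def)
    show "h' x y n (map2 (@) p q) = cmp x z y n (h' x z n p) (h' z y n q)"
    proof (cases "z = x \<or> z = y")
      case True
      then show ?thesis
      proof
        assume z: "z = x"
        have l: "lifts x x (h' x x)" by (rule lift) (use xy in auto)
        have "h' x x n p = sid_deg A (ob x) n" "map2 (@) p q = q"
          using lifts_identity[OF xy(1) l] p z S.map2_append_Nil(1)[OF len(2)] by blast+
        then show ?thesis
          using simplicial_categoryD(5)[OF A ob_in[OF xy(1)] ob_in[OF xy(2)] lifts_in[OF lift[OF xy]]] q z by simp
      next
        assume z: "z = y"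
        have l: "lifts y y (h' y y)" by (rule lift) (use xy in auto)
        have "h' y y n q = sid_deg A (ob y) n" "map2 (@) p q = p"
          using lifts_identity[OF xy(2) l] q z S.map2_append_Nil(2)[OF len(1)] by blast+
        then show ?thesis
          using simplicial_categoryD(6)[OF A ob_in[OF xy(1)] ob_in[OF xy(2)] lifts_in[OF lift[OF xy]]] p z by simp
      qed
    next
      case False
      have gaps: "gap x z < N" "gap z y < N" using chains_dist(3,4)[OF p q] False xy(3) by auto
      then have h': "h' x z = h x z" "h' z y = h z y" by (simp_all add: h'_def)
      show ?thesis
      proof (cases "gap x y = N")
        case True
        have "forced h x y n (map2 (@) p q) (cmp x z y n (h x z n p) (h z y n q))"
          unfolding forced_def using p q False by blast
        from g(2)[OF xy(1,2) True this] show ?thesis unfolding h' using True by (simp add: h'_def)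
      next
        case no: False
        then have "multiplicative h x y" using below xy unfolding lifts_below_def by simp
        then have "h x y n (map2 (@) p q) = cmp x z y n (h x z n p) (h z y n q)"
          unfolding multiplicative_def using p q by blast
        then show ?thesis unfolding h' using no by (simp add: h'_def)
      qed
    qed
  qed
  then show ?thesis using lift unfolding lifts_below_def by blast
qed

text \<open>Ranks are bounded by the number of vertices, so the induction over distances ends.\<close>

lemma lift_functor:
  assumes llp: "\<And>x y. x \<in> W \<Longrightarrow> y \<in> W \<Longrightarrow>
      sset_llp (chain_sset (\<lambda>n. S.chains S x y n \<union> S.composites T x y n)) (chain_sset (S.chains T x y))
        (sset_incl (chain_sset (\<lambda>n. S.chains S x y n \<union> S.composites T x y n))) (X x y) (Y x y) (\<phi> x y)"
    and O: "\<And>x y. x \<in> W \<Longrightarrow> y \<in> W \<Longrightarrow> simplicial_set (chain_sset (\<lambda>n. S.chains S x y n \<union> S.composites T x y n))"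
  shows "\<exists>H. simplicial_functor (CC G (ug G, T)) A H \<and>
    comp_eq (CC G (ug G, S)) H (CC_incl G (ug G, S)) U (sfun_id (CC G (ug G, S))) \<and>
    comp_eq (CC G (ug G, T)) F H V (sfun_id (CC G (ug G, T)))"
proof -
  have "\<exists>h. lifts_below N h" for N
  proof (induction N)
    case (Suc N)
    then show ?case using lifts_below_Suc[OF _ llp O] by blast
  qed (simp add: lifts_below_def)
  then obtain h where h: "lifts_below (Suc (card W)) h" by blast
  have "S.rank y \<le> card W" for y
    unfolding S.rank_def by (rule card_mono) auto
  then have gap: "gap x y < Suc (card W)" for x y by (meson diff_le_self le_imp_less_Suc le_trans)
  have lift: "lifts x y (h x y)" and mult: "multiplicative h x y" if "x \<in> W" "y \<in> W" for x y
    using h that gap unfolding lifts_below_def by blast+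
  let ?H = "\<lparr>fobj = ob, fhom = h\<rparr>"
  have "simplicial_functor (CC G (ug G, T)) A ?H"
    unfolding simplicial_functor_def
  proof (intro conjI ballI allI)
    show "simplicial_category (CC G (ug G, T))" by (rule T.simplicial_category_CC)
    show "simplicial_category A" by (rule A)
    show "fobj ?H \<in> objs (CC G (ug G, T)) \<rightarrow> objs A" using ob_in by simp
    show "sset_map (shom (CC G (ug G, T)) a b) (shom A (fobj ?H a) (fobj ?H b)) (fhom ?H a b)"
      if "a \<in> objs (CC G (ug G, T))" "b \<in> objs (CC G (ug G, T))" for a b
      using lift[of a b] that by (simp add: lifts_def)
    show "fhom ?H a a 0 (sid (CC G (ug G, T)) a) = sid A (fobj ?H a)" if "a \<in> objs (CC G (ug G, T))" for a
    proof -
      have a: "a \<in> W" using that by simp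
      have "[[]] \<in> S.chains S a a 0" using S.chains_identity[OF a, of 0] by simp
      then have "h a a 0 [[]] = fhom U a a 0 [[]]" using lift[OF a a] by (simp add: lifts_def)
      also have "\<dots> = sid A (ob a)" using simplicial_functorD(5)[OF U, of a] a by simp
      finally show ?thesis by simp
    qed
    show "fhom ?H a c n (scomp (CC G (ug G, T)) a b c n f g) =
        scomp A (fobj ?H a) (fobj ?H b) (fobj ?H c) n (fhom ?H a b n f) (fhom ?H b c n g)"
      if "a \<in> objs (CC G (ug G, T))" "c \<in> objs (CC G (ug G, T))"
        "f \<in> simplices (shom (CC G (ug G, T)) a b) n" "g \<in> simplices (shom (CC G (ug G, T)) b c) n" for a b c n f g
      using mult[of a c] that unfolding multiplicative_def by simp
  qed
  moreover have "comp_eq (CC G (ug G, S)) ?H (CC_incl G (ug G, S)) U (sfun_id (CC G (ug G, S)))"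
    using lift by (simp add: comp_eq_def CC_incl_def sfun_id_def sset_incl_def lifts_def)
  moreover have "comp_eq (CC G (ug G, T)) F ?H V (sfun_id (CC G (ug G, T)))"
    using lift obV by (simp add: comp_eq_def sfun_id_def sset_incl_def lifts_def)
  ultimately show ?thesis by blast
qed

end

context complete_pair
begin

lemma composites_subset: "S.composites T x y n \<subseteq> S.chains T x y n"
  unfolding S.composites_def using T.chains_append by blast

lemma simplicial_set_odot: "simplicial_set (chain_sset (\<lambda>n. S.chains S x y n \<union> S.composites T x y n))"
proof (rule simplicial_set_chain_sset)
  show "length ps = Suc n" if "ps \<in> S.chains S x y n \<union> S.composites T x y n" for n ps
    using that composites_subset S.chains_length by blast
  show "map (\<lambda>i. ps ! \<theta> i) [0..<Suc m] \<in> S.chains S x y m \<union> S.composites T x y m"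
    if \<theta>: "\<theta> \<in> Delta m n" and ps: "ps \<in> S.chains S x y n \<union> S.composites T x y n" for m n \<theta> ps
    using ps
  proof
    assume "ps \<in> S.chains S x y n"
    then show ?thesis using S.chains_reindex \<theta> by blast
  next
    assume "ps \<in> S.composites T x y n"
    then obtain z p q where pq: "z \<noteq> x" "z \<noteq> y" "p \<in> S.chains T x z n" "q \<in> S.chains T z y n" "ps = map2 (@) p q"
      unfolding S.composites_def by blast
    then show ?thesis
      using T.chains_reindex[OF pq(3) \<theta>] T.chains_reindex[OF pq(4) \<theta>]
        S.reindex_append[OF \<theta> S.chains_length[OF pq(3)] S.chains_length[OF pq(4)]]
      unfolding S.composites_def by blast
  qed
qed

lemma sset_map_odot_incl:
  "sset_map (chain_sset (\<lambda>n. S.chains S x y n \<union> S.composites T x y n)) (chain_sset (S.chains T x y))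
    (sset_incl (chain_sset (\<lambda>n. S.chains S x y n \<union> S.composites T x y n)))"
proof (rule sset_mapI[OF simplicial_set_odot T.simplicial_set_chains])
  let ?O = "chain_sset (\<lambda>n. S.chains S x y n \<union> S.composites T x y n)"
  show "sset_incl ?O n s \<in> simplices (chain_sset (S.chains T x y)) n" if "s \<in> simplices ?O n" for n s
    using that subsetD[OF S.chains_mono[OF incl]] subsetD[OF composites_subset] by (auto simp: sset_incl_def)
  show "sset_incl ?O n s = undefined" if "s \<notin> simplices ?O n" for n s
    using that by (simp add: sset_incl_def)
  show "sset_incl ?O m (act ?O m n \<theta> s) = act (chain_sset (S.chains T x y)) m n \<theta> (sset_incl ?O n s)"
    if "\<theta> \<in> Delta m n" "s \<in> simplices ?O n" for m n \<theta> s
    using simplicial_set_act[OF simplicial_set_odot that] that(2)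
    by (simp add: sset_incl_def act_chain_sset del: upt_Suc)
qed

end

section \<open>A simplicial category with one prescribed mapping space\<close>

text \<open>Given a map \<open>k\<close> from a simplicial set of chains from \<open>x\<close> to \<open>y\<close>, containing all composites, to a
  simplicial set \<open>Z\<close>, the mapping space from \<open>x\<close> to \<open>y\<close> in the category of a complete diagram is
  replaced by \<open>Z\<close>, so that \<open>k\<close> becomes a functor. There is no way to compose elements of \<open>Z\<close> with paths
  that end in \<open>x\<close> or start at \<open>y\<close>, so all mapping spaces that would receive such composites become
  points. The injection \<open>j\<close> moves chains to the type of the simplices of \<open>Z\<close>.\<close>

locale prescribed = complete_family G T for G :: "('v, 'e) plane" and T +
  fixes x y :: 'v and j :: "'e list list \<Rightarrow> 'u" and Z :: "'u sset" and N :: "nat \<Rightarrow> 'e list list set"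
    and k :: "('e list list, 'u) smap"
  assumes xy: "x \<noteq> y" "paths x y \<noteq> {}"
    and inj: "inj_on j {ps. \<exists>a b n. ps \<in> chains T a b n}"
    and k_map: "sset_map (chain_sset N) Z k"
    and composites_N: "\<And>n. composites T x y n \<subseteq> N n"
begin

abbreviation le :: "'v \<Rightarrow> 'v \<Rightarrow> bool" where "le a b \<equiv> paths a b \<noteq> {}"

lemma le_trans: "le a b \<Longrightarrow> le b c \<Longrightarrow> le a c"
  using append_in_paths by blast

lemma le_antisym: "le a b \<Longrightarrow> le b a \<Longrightarrow> a = b"
  using paths_antisym by blast

definition unj :: "'u \<Rightarrow> 'e list list" where
  "unj = inv_into {ps. \<exists>a b n. ps \<in> chains T a b n} j"

lemma unj: "ps \<in> chains T a b n \<Longrightarrow> unj (j ps) = ps"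
  unfolding unj_def by (rule inv_into_f_f[OF inj]) blast

text \<open>The pairs of vertices that enclose \<open>x\<close> and \<open>y\<close>, the pair \<open>(x, y)\<close> included: elements of \<open>Z\<close> can be composed to
  elements of their mapping spaces.\<close>

definition above :: "'v \<Rightarrow> 'v \<Rightarrow> bool" where
  "above a c \<longleftrightarrow> le a x \<and> le y c"

lemma above_le: "above a c \<Longrightarrow> le a c"
  unfolding above_def using le_trans xy(2) by blast

lemma above_xy: "above x y"
  using xy paths_verts unfolding above_def by (auto simp: paths_refl)

lemma above_left: "above a b \<Longrightarrow> le b c \<Longrightarrow> above a c"
  and above_right: "le a b \<Longrightarrow> above b c \<Longrightarrow> above a c"
  unfolding above_def using le_trans by blast+

lemma not_above_same: "\<not> above a a"
  unfolding above_def using le_trans le_antisym xy by blast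

definition hom :: "'v \<Rightarrow> 'v \<Rightarrow> 'u sset" where
  "hom a c = (if a = x \<and> c = y then Z
    else if above a c then \<lparr>simplices = (\<lambda>_. {j []}), act = (\<lambda>_ _ _ _. j [])\<rparr>
    else \<lparr>simplices = (\<lambda>n. j ` chains T a c n),
      act = (\<lambda>m n \<theta> r. j (map (\<lambda>i. unj r ! \<theta> i) [0..<Suc m]))\<rparr>)"

definition comp :: "'v \<Rightarrow> 'v \<Rightarrow> 'v \<Rightarrow> nat \<Rightarrow> 'u \<Rightarrow> 'u \<Rightarrow> 'u" where
  "comp a b c n p q = (if a = x \<and> c = y then
      if b = x then q else if b = y then p else k n (map2 (@) (unj p) (unj q))
    else if above a c then j [] else j (map2 (@) (unj p) (unj q)))"

definition cat :: "('v, 'u) scat" where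
  "cat = \<lparr>objs = verts (ug G), shom = hom, sid = (\<lambda>_. j [[]]), scomp = comp\<rparr>"

lemma hom_xy [simp]: "hom x y = Z"
  by (simp add: hom_def)

lemma hom_above: "above a c \<Longrightarrow> \<not> (a = x \<and> c = y) \<Longrightarrow> p \<in> simplices (hom a c) n \<longleftrightarrow> p = j []"
  by (auto simp: hom_def)

lemma hom_paths: "\<not> above a c \<Longrightarrow> p \<in> simplices (hom a c) n \<longleftrightarrow> (\<exists>ps\<in>chains T a c n. p = j ps)"
  using above_xy by (auto simp: hom_def)

lemma act_above: "above a c \<Longrightarrow> \<not> (a = x \<and> c = y) \<Longrightarrow> act (hom a c) m n \<theta> p = j []"
  by (auto simp: hom_def)

lemma act_paths:
  "\<not> above a c \<Longrightarrow> ps \<in> chains T a c n \<Longrightarrow> act (hom a c) m n \<theta> (j ps) = j (map (\<lambda>i. ps ! \<theta> i) [0..<Suc m])"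
  using above_xy unj by (auto simp: hom_def simp del: upt_Suc)

lemma chains_le: "ps \<in> chains T a c n \<Longrightarrow> le a c"
  using chains_paths by blast

lemma hom_le: "p \<in> simplices (hom a c) n \<Longrightarrow> le a c"
  using above_le chains_le hom_paths by metis

lemma Z_sset: "simplicial_set Z"
  using sset_mapD(4)[OF k_map] .

lemma hom_sset: "simplicial_set (hom a c)"
proof (cases "a = x \<and> c = y")
  case True
  then show ?thesis using Z_sset by simp
next
  case not_xy: False
  show ?thesis
  proof (cases "above a c")
    case True
    then show ?thesis using not_xy by (auto simp: simplicial_set_def hom_def)
  next
    case False
    show ?thesis unfolding simplicial_set_def
    proof (intro conjI allI ballI)
      fix m n \<theta> assume \<theta>: "\<theta> \<in> Delta m n"
      show "act (hom a c) m n \<theta> \<in> simplices (hom a c) n \<rightarrow> simplices (hom a c) m"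
      proof
        fix p assume "p \<in> simplices (hom a c) n"
        then obtain ps where ps: "ps \<in> chains T a c n" "p = j ps" unfolding hom_paths[OF False] by blast
        show "act (hom a c) m n \<theta> p \<in> simplices (hom a c) m"
          unfolding ps(2) act_paths[OF False ps(1)] hom_paths[OF False] using chains_reindex[OF ps(1) \<theta>] by blast
      qed
    next
      fix n p assume "p \<in> simplices (hom a c) n"
      then obtain ps where ps: "ps \<in> chains T a c n" "p = j ps" unfolding hom_paths[OF False] by blast
      have "map (\<lambda>i. ps ! (\<lambda>i\<in>{..n}. i) i) [0..<Suc n] = ps"
        using chains_length[OF ps(1)] by (intro nth_equalityI) (auto simp del: upt_Suc)
      then show "act (hom a c) n n (\<lambda>i\<in>{..n}. i) p = p"
        using ps act_paths[OF False ps(1)] by simp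
    next
      fix l m n \<eta> \<theta> p assume \<eta>: "\<eta> \<in> Delta l m" and \<theta>: "\<theta> \<in> Delta m n" and "p \<in> simplices (hom a c) n"
      then obtain ps where ps: "ps \<in> chains T a c n" "p = j ps" unfolding hom_paths[OF False] by blast
      have "\<eta> i < Suc m" if "i < Suc l" for i
        using \<eta> that by (auto simp: Delta_def PiE_iff less_Suc_eq_le)
      then have "map (\<lambda>i. ps ! compose {..l} \<theta> \<eta> i) [0..<Suc l] =
          map (\<lambda>i. map (\<lambda>i. ps ! \<theta> i) [0..<Suc m] ! \<eta> i) [0..<Suc l]"
        by (intro nth_equalityI) (auto simp: compose_def less_Suc_eq_le simp del: upt_Suc)
      then show "act (hom a c) l n (compose {..l} \<theta> \<eta>) p = act (hom a c) l m \<eta> (act (hom a c) m n \<theta> p)"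
        unfolding ps(2) act_paths[OF False ps(1)] act_paths[OF False chains_reindex[OF ps(1) \<theta>]]
        by (rule arg_cong)
    qed
  qed
qed

text \<open>The vertex \<open>b\<close> lies strictly between \<open>x\<close> and \<open>y\<close>, so neither of the two mapping spaces has been replaced.\<close>

lemma proper_middle:
  assumes "p \<in> simplices (hom x b) n" "q \<in> simplices (hom b y) n" "b \<noteq> x" "b \<noteq> y"
  obtains ps qs where "ps \<in> chains T x b n" "qs \<in> chains T b y n" "p = j ps" "q = j qs"
    "\<not> above x b" "\<not> above b y" "map2 (@) ps qs \<in> composites T x y n"
proof -
  have "le x b" "le b y" using hom_le assms by blast+
  then have na: "\<not> above x b" "\<not> above b y" unfolding above_def using le_antisym assms by blast+
  then obtain ps qs where pq: "ps \<in> chains T x b n" "qs \<in> chains T b y n" "p = j ps" "q = j qs"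
    using assms hom_paths by blast
  then have "map2 (@) ps qs \<in> composites T x y n" using assms unfolding composites_def by blast
  then show ?thesis using that pq na by blast
qed

lemma low_middle:
  assumes "p \<in> simplices (hom a b) n" "q \<in> simplices (hom b c) n" "\<not> above a c"
  obtains ps qs where "ps \<in> chains T a b n" "qs \<in> chains T b c n" "p = j ps" "q = j qs"
    "\<not> above a b" "\<not> above b c" "map2 (@) ps qs \<in> chains T a c n"
proof -
  have "le a b" "le b c" using hom_le assms by blast+
  then have na: "\<not> above a b" "\<not> above b c" using above_left above_right assms(3) by blast+
  then obtain ps qs where pq: "ps \<in> chains T a b n" "qs \<in> chains T b c n" "p = j ps" "q = j qs"
    using assms hom_paths by blast
  then show ?thesis using that na chains_append by blast
qed

lemma comp_xy_left [simp]: "comp x x y n p q = q"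
  and comp_xy_right [simp]: "comp x y y n p q = p"
  using xy by (simp_all add: comp_def)

lemma comp_xy: "b \<noteq> x \<Longrightarrow> b \<noteq> y \<Longrightarrow> ps \<in> chains T x b n \<Longrightarrow> qs \<in> chains T b y n \<Longrightarrow>
    comp x b y n (j ps) (j qs) = k n (map2 (@) ps qs)"
  by (simp add: comp_def unj)

lemma comp_above: "above a c \<Longrightarrow> \<not> (a = x \<and> c = y) \<Longrightarrow> comp a b c n p q = j []"
  by (auto simp: comp_def)

lemma comp_paths: "\<not> above a c \<Longrightarrow> ps \<in> chains T a b n \<Longrightarrow> qs \<in> chains T b c n \<Longrightarrow>
    comp a b c n (j ps) (j qs) = j (map2 (@) ps qs)"
  using above_xy by (auto simp: comp_def unj)

lemma comp_in:
  assumes "p \<in> simplices (hom a b) n" "q \<in> simplices (hom b c) n"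
  shows "comp a b c n p q \<in> simplices (hom a c) n"
proof (cases "a = x \<and> c = y")
  case True
  show ?thesis
  proof (cases "b = x \<or> b = y")
    case False
    then obtain ps qs where "ps \<in> chains T x b n" "qs \<in> chains T b y n" "p = j ps" "q = j qs"
      "map2 (@) ps qs \<in> composites T x y n" using proper_middle assms True by metis
    then show ?thesis using True False comp_xy subsetD[OF composites_N] sset_mapD(1)[OF k_map] by auto
  qed (use True assms in auto)
next
  case not_xy: False
  show ?thesis
  proof (cases "above a c")
    case True
    then show ?thesis using not_xy by (simp add: comp_above hom_above)
  next
    case False
    then obtain ps qs where "ps \<in> chains T a b n" "qs \<in> chains T b c n" "p = j ps" "q = j qs"
      "map2 (@) ps qs \<in> chains T a c n" using low_middle[OF assms] by metis
    then show ?thesis using comp_paths[OF False] hom_paths[OF False] by auto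
  qed
qed

lemma comp_act:
  assumes "p \<in> simplices (hom a b) n" "q \<in> simplices (hom b c) n" "\<theta> \<in> Delta m n"
  shows "act (hom a c) m n \<theta> (comp a b c n p q) =
    comp a b c m (act (hom a b) m n \<theta> p) (act (hom b c) m n \<theta> q)"
proof (cases "a = x \<and> c = y")
  case True
  show ?thesis
  proof (cases "b = x \<or> b = y")
    case False
    then obtain ps qs where pq: "ps \<in> chains T x b n" "qs \<in> chains T b y n" "p = j ps" "q = j qs"
      "\<not> above x b" "\<not> above b y" "map2 (@) ps qs \<in> composites T x y n"
      using proper_middle assms(1,2) True by metis
    have "act Z m n \<theta> (k n (map2 (@) ps qs)) = k m (map (\<lambda>i. map2 (@) ps qs ! \<theta> i) [0..<Suc m])"
      using sset_mapD(2)[OF k_map assms(3), of "map2 (@) ps qs"] subsetD[OF composites_N pq(7)]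
      by (simp add: act_chain_sset del: upt_Suc)
    moreover have "comp x b y n (j ps) (j qs) = k n (map2 (@) ps qs)"
      "comp x b y m (j (map (\<lambda>i. ps ! \<theta> i) [0..<Suc m])) (j (map (\<lambda>i. qs ! \<theta> i) [0..<Suc m])) =
        k m (map2 (@) (map (\<lambda>i. ps ! \<theta> i) [0..<Suc m]) (map (\<lambda>i. qs ! \<theta> i) [0..<Suc m]))"
      using False by (blast intro: comp_xy pq(1,2) chains_reindex[OF pq(1) assms(3)] chains_reindex[OF pq(2) assms(3)])+
    moreover have "a = x" "c = y" using True by auto
    ultimately show ?thesis
      unfolding pq(3,4) reindex_append[OF assms(3) chains_length[OF pq(1)] chains_length[OF pq(2)], symmetric]
      by (simp only: hom_xy act_paths[OF pq(5,1)] act_paths[OF pq(6,2)])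
  qed (use True in auto)
next
  case not_xy: False
  show ?thesis
  proof (cases "above a c")
    case True
    then show ?thesis using not_xy by (simp add: comp_above act_above)
  next
    case False
    then obtain ps qs where pq: "ps \<in> chains T a b n" "qs \<in> chains T b c n" "p = j ps" "q = j qs"
      "\<not> above a b" "\<not> above b c" "map2 (@) ps qs \<in> chains T a c n" using low_middle[OF assms(1,2)] by metis
    show ?thesis
      unfolding pq(3,4) comp_paths[OF False pq(1,2)] act_paths[OF False pq(7)] act_paths[OF pq(5,1)] act_paths[OF pq(6,2)]
        comp_paths[OF False chains_reindex[OF pq(1) assms(3)] chains_reindex[OF pq(2) assms(3)]]
        reindex_append[OF assms(3) chains_length[OF pq(1)] chains_length[OF pq(2)]] ..
  qed
qed

lemma sid_in: "a \<in> verts (ug G) \<Longrightarrow> j [[]] \<in> simplices (hom a a) 0"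
  using chains_identity[of a 0] hom_paths[OF not_above_same] by auto

lemma sid_deg_cat:
  assumes "a \<in> verts (ug G)"
  shows "sid_deg cat a n = j (replicate (Suc n) [])"
proof -
  have "[[]] \<in> chains T a a 0" using chains_identity[OF assms, of 0] by simp
  then have "sid_deg cat a n = j (map (\<lambda>i. [[]] ! (\<lambda>i\<in>{..n}. 0) i) [0..<Suc n])"
    using act_paths[OF not_above_same] by (simp add: sid_deg_def cat_def del: upt_Suc)
  also have "map (\<lambda>i. [[]] ! (\<lambda>i\<in>{..n}. 0) i) [0..<Suc n] = (replicate (Suc n) [] :: 'e list list)"
    by (intro nth_equalityI) (simp_all add: less_Suc_eq_le del: upt_Suc replicate_Suc)
  finally show ?thesis .
qed

lemma hom_same: "p \<in> simplices (hom a a) n \<Longrightarrow> a \<in> verts (ug G) \<Longrightarrow> p = j (replicate (Suc n) [])"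
  using hom_paths[OF not_above_same] chains_identity by auto

lemma comp_identity_left:
  assumes "a \<in> verts (ug G)" "p \<in> simplices (hom a c) n"
  shows "comp a a c n (j (replicate (Suc n) [])) p = p"
proof (cases "above a c")
  case True
  then show ?thesis
    using assms by (cases "a = x \<and> c = y") (auto simp: comp_above hom_above)
next
  case False
  then obtain ps where ps: "ps \<in> chains T a c n" "p = j ps" using assms hom_paths by blast
  have r: "replicate (Suc n) [] \<in> chains T a a n" using chains_identity[OF assms(1)] by blast
  show ?thesis
    unfolding ps(2) comp_paths[OF False r ps(1)] map2_append_Nil(1)[OF chains_length[OF ps(1)]] ..
qed

lemma comp_identity_right:
  assumes "c \<in> verts (ug G)" "p \<in> simplices (hom a c) n"
  shows "comp a c c n p (j (replicate (Suc n) [])) = p"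
proof (cases "above a c")
  case True
  then show ?thesis
    using assms by (cases "a = x \<and> c = y") (auto simp: comp_above hom_above)
next
  case False
  then obtain ps where ps: "ps \<in> chains T a c n" "p = j ps" using assms hom_paths by blast
  have r: "replicate (Suc n) [] \<in> chains T c c n" using chains_identity[OF assms(1)] by blast
  show ?thesis
    unfolding ps(2) comp_paths[OF False ps(1) r] map2_append_Nil(2)[OF chains_length[OF ps(1)]] ..
qed

lemma comp_assoc:
  assumes v: "a \<in> verts (ug G)" "b \<in> verts (ug G)" "c \<in> verts (ug G)" "d \<in> verts (ug G)"
    and f: "f \<in> simplices (hom a b) n" and g: "g \<in> simplices (hom b c) n" and h: "h \<in> simplices (hom c d) n"
  shows "comp a c d n (comp a b c n f g) h = comp a b d n f (comp b c d n g h)"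
proof (cases "b = a \<or> c = d")
  case True
  then show ?thesis
  proof
    assume b: "b = a"
    then have f': "f = j (replicate (Suc n) [])" using hom_same f v by blast
    have "comp a b c n f g = g" "comp a b d n f (comp b c d n g h) = comp b c d n g h"
      unfolding f' b using comp_identity_left[OF v(1)] g comp_in[OF g h] b by auto
    then show ?thesis using b by simp
  next
    assume c: "c = d"
    then have h': "h = j (replicate (Suc n) [])" using hom_same h v by blast
    have "comp b c d n g h = g" "comp a c d n (comp a b c n f g) h = comp a b c n f g"
      unfolding h' using comp_identity_right[OF v(4)] g comp_in[OF f g] c by auto
    then show ?thesis using c by simp
  qed
next
  case bc: False
  note le = hom_le[OF f] hom_le[OF g] hom_le[OF h]
  note fg = comp_in[OF f g] and gh = comp_in[OF g h]
  show ?thesis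
  proof (cases "a = x \<and> d = y")
    case ad: True
    have "c \<noteq> x" using le le_antisym bc ad by blast
    have "b \<noteq> y" using le le_antisym bc ad by blast
    obtain ps hs where ps: "ps \<in> chains T x c n" "hs \<in> chains T c y n" "comp a b c n f g = j ps" "h = j hs"
      "\<not> above x c" using proper_middle[of "comp a b c n f g" c n h] fg h ad bc \<open>c \<noteq> x\<close> by metis
    obtain fs qs where qs: "fs \<in> chains T x b n" "qs \<in> chains T b y n" "f = j fs" "comp b c d n g h = j qs"
      "\<not> above b y" using proper_middle[of f b n "comp b c d n g h"] f gh ad bc \<open>b \<noteq> y\<close> by metis
    obtain fs' gs where gs: "fs' \<in> chains T x b n" "gs \<in> chains T b c n" "f = j fs'" "g = j gs"
      using low_middle[of f x b n g c] f g ad ps(5) by metis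
    have ax: "a = x" "d = y" using ad by auto
    have "j ps = j (map2 (@) fs gs)"
      using ps(3) unfolding qs(3) gs(4) ax comp_paths[OF ps(5) qs(1) gs(2)] by (rule sym)
    from arg_cong[OF this, of unj] have ps': "ps = map2 (@) fs gs"
      unfolding unj[OF ps(1)] unj[OF chains_append[OF qs(1) gs(2)]] .
    have "j qs = j (map2 (@) gs hs)"
      using qs(4) unfolding gs(4) ps(4) ax comp_paths[OF qs(5) gs(2) ps(2)] by (rule sym)
    from arg_cong[OF this, of unj] have qs': "qs = map2 (@) gs hs"
      unfolding unj[OF qs(2)] unj[OF chains_append[OF gs(2) ps(2)]] .
    have "c \<noteq> y" "b \<noteq> x" using bc ad by auto
    have "comp a c d n (j ps) (j hs) = k n (map2 (@) ps hs)"
      using comp_xy[OF \<open>c \<noteq> x\<close> \<open>c \<noteq> y\<close> ps(1,2)] ad by metis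
    moreover have "comp a b d n (j fs) (j qs) = k n (map2 (@) fs qs)"
      using comp_xy[OF \<open>b \<noteq> x\<close> \<open>b \<noteq> y\<close> qs(1,2)] ad by metis
    moreover have "comp a c d n (comp a b c n f g) h = comp a c d n (j ps) (j hs)"
      by (simp only: ps(3,4))
    moreover have "comp a b d n f (comp b c d n g h) = comp a b d n f (j qs)"
      by (simp only: qs(4))
    ultimately show ?thesis unfolding qs(3) unfolding ps' qs' by (simp only: map2_append_assoc)
  next
    case not_xy: False
    show ?thesis
    proof (cases "above a d")
      case True
      then show ?thesis using not_xy by (simp add: comp_above)
    next
      case False
      have na: "\<not> above a c" "\<not> above b d" using False above_left above_right le by blast+
      obtain fs gs where gs: "fs \<in> chains T a b n" "gs \<in> chains T b c n" "f = j fs" "g = j gs"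
        "map2 (@) fs gs \<in> chains T a c n" using low_middle[OF f g na(1)] by metis
      obtain gs' hs where hs: "hs \<in> chains T c d n" "h = j hs" using low_middle[OF g h na(2)] by metis
      have "comp a c d n (comp a b c n f g) h = j (map2 (@) (map2 (@) fs gs) hs)"
        unfolding gs(3,4) hs(2) comp_paths[OF na(1) gs(1,2)] comp_paths[OF False gs(5) hs(1)] ..
      moreover have "comp a b d n f (comp b c d n g h) = j (map2 (@) fs (map2 (@) gs hs))"
        unfolding gs(3,4) hs(2) comp_paths[OF na(2) gs(2) hs(1)] comp_paths[OF False gs(1) chains_append[OF gs(2) hs(1)]] ..
      ultimately show ?thesis by (simp only: map2_append_assoc)
    qed
  qed
qed

lemma cat_simps [simp]:
  "objs cat = verts (ug G)" "shom cat = hom" "sid cat a = j [[]]" "scomp cat = comp"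
  by (simp_all add: cat_def)

lemma simplicial_category_cat: "simplicial_category cat"
  unfolding simplicial_category_def cat_simps
proof (intro conjI ballI allI)
  show "simplicial_set (hom a b)" for a b by (rule hom_sset)
  show "j [[]] \<in> simplices (hom a a) 0" if "a \<in> verts (ug G)" for a by (rule sid_in[OF that])
qed (simp_all add: comp_in comp_act sid_deg_cat comp_identity_left comp_identity_right comp_assoc del: replicate_Suc)

text \<open>The functor to this category from that of any complete subdiagram whose chains from \<open>x\<close> to \<open>y\<close> lie
  in the domain of \<open>k\<close>.\<close>

definition into :: "('v, 'e) pre_digraph set \<Rightarrow> ('v, 'e list list, 'v, 'u) sfun" where
  "into S = \<lparr>fobj = (\<lambda>a. a), fhom = (\<lambda>a c n. \<lambda>s\<in>chains S a c n.
    if a = x \<and> c = y then k n s else if above a c then j [] else j s)\<rparr>"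

lemma into_simps:
  "fobj (into S) a = a"
  "s \<in> chains S x y n \<Longrightarrow> fhom (into S) x y n s = k n s"
  "above a c \<Longrightarrow> \<not> (a = x \<and> c = y) \<Longrightarrow> s \<in> chains S a c n \<Longrightarrow> fhom (into S) a c n s = j []"
  "\<not> above a c \<Longrightarrow> s \<in> chains S a c n \<Longrightarrow> fhom (into S) a c n s = j s"
  using above_xy by (auto simp: into_def)

lemma functor_into:
  assumes S: "complete_family G S" "S \<subseteq> T" and N: "\<And>n. chains S x y n \<subseteq> N n"
  shows "simplicial_functor (CC G (ug G, S)) cat (into S)"
proof -
  interpret S: complete_family G S by (rule S(1))
  have sub: "s \<in> chains T a c n" if "s \<in> chains S a c n" for s a c n
    using chains_mono[OF S(2)] that by blast
  show ?thesis
    unfolding simplicial_functor_def S.CC_simps cat_simps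
  proof (intro conjI ballI allI)
    show "simplicial_category (CC G (ug G, S))" by (rule S.simplicial_category_CC)
    show "simplicial_category cat" by (rule simplicial_category_cat)
    show "fobj (into S) \<in> verts (ug G) \<rightarrow> verts (ug G)" by (simp add: into_def)
    show "fhom (into S) a a 0 [[]] = j [[]]" if "a \<in> verts (ug G)" for a
      using that not_above_same[of a] xy(1) S.chains_identity[OF that, of 0] by (auto simp: into_def)
    show "sset_map (chain_sset (chains S a c)) (hom (fobj (into S) a) (fobj (into S) c)) (fhom (into S) a c)" for a c
      unfolding into_def sfun.simps
    proof (rule sset_mapI[OF S.simplicial_set_chains hom_sset], goal_cases)
      case (1 n s)
      then have s: "s \<in> chains S a c n" by simp
      consider "a = x \<and> c = y" | "\<not> (a = x \<and> c = y)" "above a c" | "\<not> (a = x \<and> c = y)" "\<not> above a c" by blast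
      then show ?case
      proof cases
        assume "a = x \<and> c = y"
        then show ?case using s N sset_mapD(1)[OF k_map] by auto
      qed (use s sub[OF s] hom_above hom_paths in auto)
    next
      case (2 n s)
      then show ?case by simp
    next
      case (3 m n \<theta> s)
      then have s: "s \<in> chains S a c n" by simp
      have r: "map (\<lambda>i. s ! \<theta> i) [0..<Suc m] \<in> chains S a c m" by (rule S.chains_reindex[OF s 3(1)])
      consider "a = x \<and> c = y" | "\<not> (a = x \<and> c = y)" "above a c" | "\<not> (a = x \<and> c = y)" "\<not> above a c" by blast
      then show ?case
      proof cases
        assume ac: "a = x \<and> c = y"
        have "s \<in> N n" using s N ac by blast
        then show ?case using ac s r sset_mapD(2)[OF k_map 3(1), of s]
          by (simp add: act_chain_sset del: upt_Suc)
      next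
        assume "\<not> (a = x \<and> c = y)" "above a c"
        then show ?case using s r act_above by (auto simp: act_chain_sset simp del: upt_Suc)
      next
        assume ac: "\<not> (a = x \<and> c = y)" "\<not> above a c"
        then show ?case using s r act_paths[OF ac(2) sub[OF s]] by (auto simp: act_chain_sset simp del: upt_Suc)
      qed
    qed
    show "fhom (into S) a c n (map2 (@) p q) = comp (fobj (into S) a) (fobj (into S) b) (fobj (into S) c) n
        (fhom (into S) a b n p) (fhom (into S) b c n q)"
      if "a \<in> verts (ug G)" "b \<in> verts (ug G)" "c \<in> verts (ug G)"
        "p \<in> simplices (chain_sset (chains S a b)) n" "q \<in> simplices (chain_sset (chains S b c)) n" for a b c n p q
    proof -
      have p: "p \<in> chains S a b n" and q: "q \<in> chains S b c n" using that by simp_all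
      note pq = S.chains_append[OF p q]
      note le = chains_le[OF sub[OF p]] chains_le[OF sub[OF q]]
      show ?thesis
      proof (cases "a = x \<and> c = y")
        case True
        consider "b = x" | "b = y" | "b \<noteq> x" "b \<noteq> y" by blast
        then show ?thesis
        proof cases
          case 1
          then have "p = replicate (Suc n) []" using p S.chains_identity that(1) True by auto
          then have "map2 (@) p q = q" using S.map2_append_Nil(1)[OF chains_length[OF q]] by simp
          then show ?thesis using True 1 q by (simp add: into_def)
        next
          case 2
          then have "q = replicate (Suc n) []" using q S.chains_identity that(2) True by auto
          then have "map2 (@) p q = p" using S.map2_append_Nil(2)[OF chains_length[OF p]] by simp
          then show ?thesis using True 2 p by (simp add: into_def)
        next
          case 3
          have na: "\<not> above x b" "\<not> above b y"
            unfolding above_def using le le_antisym 3 True by blast+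
          have ac: "a = x" "c = y" using True by auto
          show ?thesis
            unfolding into_simps(1) ac using p q pq unfolding ac
            by (simp add: into_simps na comp_xy[OF 3 sub sub])
        qed
      next
        case not_xy: False
        show ?thesis
        proof (cases "above a c")
          case True
          then show ?thesis using not_xy pq by (auto simp: into_def comp_above)
        next
          case False
          then have na: "\<not> above a b" "\<not> above b c" using above_left above_right le by blast+
          show ?thesis
            unfolding into_simps(1) into_simps(4)[OF False pq] into_simps(4)[OF na(1) p] into_simps(4)[OF na(2) q]
              comp_paths[OF False sub[OF p] sub[OF q]] ..
        qed
      qed
    qed
  qed
qed

end

section \<open>Comparison of the two lifting properties\<close>

text \<open>Transport of a simplicial category along an injection of its objects.\<close>

definition relabel :: "('a \<Rightarrow> 'o) \<Rightarrow> ('a, 'u) scat \<Rightarrow> ('o, 'u) scat" where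
  "relabel \<iota> A = \<lparr>objs = \<iota> ` objs A,
    shom = (\<lambda>a b. shom A (inv_into (objs A) \<iota> a) (inv_into (objs A) \<iota> b)),
    sid = (\<lambda>a. sid A (inv_into (objs A) \<iota> a)),
    scomp = (\<lambda>a b c. scomp A (inv_into (objs A) \<iota> a) (inv_into (objs A) \<iota> b) (inv_into (objs A) \<iota> c))\<rparr>"

definition relabel_fun :: "('a \<Rightarrow> 'o) \<Rightarrow> 'a set \<Rightarrow> ('a, 'u, 'a, 'w) sfun \<Rightarrow> ('o, 'u, 'o, 'w) sfun" where
  "relabel_fun \<iota> V F = \<lparr>fobj = (\<lambda>a. a), fhom = (\<lambda>a b. fhom F (inv_into V \<iota> a) (inv_into V \<iota> b))\<rparr>"

lemma relabel_simps:
  assumes "inj_on \<iota> (objs A)"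
  shows "objs (relabel \<iota> A) = \<iota> ` objs A"
    "a \<in> objs A \<Longrightarrow> b \<in> objs A \<Longrightarrow> shom (relabel \<iota> A) (\<iota> a) (\<iota> b) = shom A a b"
    "a \<in> objs A \<Longrightarrow> sid (relabel \<iota> A) (\<iota> a) = sid A a"
    "a \<in> objs A \<Longrightarrow> b \<in> objs A \<Longrightarrow> c \<in> objs A \<Longrightarrow> scomp (relabel \<iota> A) (\<iota> a) (\<iota> b) (\<iota> c) = scomp A a b c"
    "a \<in> objs A \<Longrightarrow> sid_deg (relabel \<iota> A) (\<iota> a) n = sid_deg A a n"
  using inv_into_f_f[OF assms] by (simp_all add: relabel_def sid_deg_def)

lemma simplicial_category_relabel:
  assumes inj: "inj_on \<iota> (objs A)" and A: "simplicial_category A"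
  shows "simplicial_category (relabel \<iota> A)"
  unfolding simplicial_category_def relabel_simps(1)[OF inj]
  by (auto simp: relabel_simps[OF inj] simplicial_categoryD[OF A])

lemma functor_into_relabel:
  assumes inj: "inj_on \<iota> (objs A)" and U: "simplicial_functor C A U"
  shows "simplicial_functor C (relabel \<iota> A) \<lparr>fobj = (\<lambda>c. \<iota> (fobj U c)), fhom = fhom U\<rparr>"
  using simplicial_category_relabel[OF inj] simplicial_functorD[OF U]
  by (auto simp: simplicial_functor_def relabel_simps[OF inj])

lemma functor_relabel_fun:
  assumes inj: "inj_on \<iota> (objs A)" and F: "simplicial_functor A B F"
    and B: "objs B = objs A" and id: "\<And>a. a \<in> objs A \<Longrightarrow> fobj F a = a"
  shows "simplicial_functor (relabel \<iota> A) (relabel \<iota> B) (relabel_fun \<iota> (objs A) F)"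
proof -
  have injB: "inj_on \<iota> (objs B)" using inj B by simp
  note rA = relabel_simps[OF inj] and rB = relabel_simps[OF injB, unfolded B]
  have hom: "fhom (relabel_fun \<iota> (objs A) F) (\<iota> a) (\<iota> b) = fhom F a b" if "a \<in> objs A" "b \<in> objs A" for a b
    using inv_into_f_f[OF inj] that by (simp add: relabel_fun_def)
  have obj: "fobj (relabel_fun \<iota> (objs A) F) a = a" for a by (simp add: relabel_fun_def)
  show ?thesis
    unfolding simplicial_functor_def obj rA(1)
    using simplicial_category_relabel[OF inj] simplicial_category_relabel[OF injB] simplicial_functorD[OF F]
    by (auto simp: rA rB hom id)
qed

lemma sset_map_incl_self: "simplicial_set K \<Longrightarrow> sset_map K K (sset_incl K)"
  by (rule sset_mapI) (auto simp: sset_incl_def simplicial_set_act)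

lemma sset_iso_incl_self: "simplicial_set K \<Longrightarrow> sset_iso K K (sset_incl K)"
  unfolding sset_iso_def using sset_map_incl_self[of K] by (auto simp: sset_incl_def intro!: exI[of _ "sset_incl K"])

lemma countable_inj_into_infinite:
  assumes "countable A" "infinite (UNIV :: 'b set)"
  obtains j :: "'a \<Rightarrow> 'b" where "inj_on j A"
proof -
  obtain f :: "nat \<Rightarrow> 'b" where f: "inj f" using infinite_countable_subset[OF assms(2)] by blast
  have "inj_on (f \<circ> to_nat_on A) A"
    by (rule comp_inj_on[OF inj_on_to_nat_on[OF assms(1)]]) (rule inj_on_subset[OF f subset_UNIV])
  then show ?thesis by (rule that)
qed

context complete_pair
begin

text \<open>The paths of a finite graph involve finitely many edges, hence all chains fit into any infinite type.\<close>

lemma countable_chains: "countable {ps. \<exists>a b n. ps \<in> S.chains T a b n}"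
proof (rule countable_subset)
  show "{ps. \<exists>a b n. ps \<in> S.chains T a b n} \<subseteq> lists (lists (arcs (ug G)))"
    using S.paths_arcs by (fastforce simp: S.chains_def lists_eq_set)
  show "countable (lists (lists (arcs (ug G))))"
    by (intro countable_lists countable_finite) simp
qed

text \<open>The only path from \<open>x\<close> to itself is the trivial one, which belongs to both diagrams; and without paths
  there are no chains.\<close>

lemma odot_trivial:
  assumes x: "x \<in> verts (ug G)" and triv: "x = y \<or> S.paths x y = {}"
  shows "(\<lambda>n. S.chains S x y n \<union> S.composites T x y n) = S.chains T x y"
proof
  fix n
  show "S.chains S x y n \<union> S.composites T x y n = S.chains T x y n"
  proof (cases "x = y")
    case True
    then show ?thesis
      using composites_subset[of x y n] S.chains_identity[OF x] T.chains_identity[OF x] by blast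
  next
    case False
    then have "S.chains T x y n = {}" using triv S.chains_paths by blast
    then show ?thesis using composites_subset[of x y n] S.chains_mono[OF incl, of x y n] by blast
  qed
qed

text \<open>A lifting problem for the mapping spaces from \<open>x\<close> to \<open>y\<close> becomes one for categories, by prescribing
  these mapping spaces.\<close>

lemma mapping_space_llp:
  fixes R :: "'u sset_class" and X Y :: "'u sset"
  assumes universe: "infinite (UNIV :: 'u set)" "infinite (UNIV :: 'o set)"
    and R_maps: "\<And>X Y f. (X, Y, f) \<in> R \<Longrightarrow> sset_map X Y f"
    and R_isos: "\<And>X Y f. sset_iso X Y f \<Longrightarrow> (X, Y, f) \<in> R"
    and llp: "\<And>(A :: ('o, 'u) scat) (B :: ('o, 'u) scat) F. local_functor R A B F \<Longrightarrow>
      scat_llp (CC G (ug G, S)) (CC G (ug G, T)) (CC_incl G (ug G, S)) A B F"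
    and x: "x \<in> verts (ug G)" and y: "y \<in> verts (ug G)" and f: "(X, Y, f) \<in> R"
  shows "sset_llp (chain_sset (\<lambda>n. S.chains S x y n \<union> S.composites T x y n)) (chain_sset (S.chains T x y))
    (sset_incl (chain_sset (\<lambda>n. S.chains S x y n \<union> S.composites T x y n))) X Y f"
  unfolding sset_llp_def
proof (intro allI impI)
  fix u v
  let ?O = "\<lambda>n. S.chains S x y n \<union> S.composites T x y n"
  assume u: "sset_map (chain_sset ?O) X u" and v: "sset_map (chain_sset (S.chains T x y)) Y v"
    and "\<forall>n. \<forall>s\<in>simplices (chain_sset ?O) n. f n (u n s) = v n (sset_incl (chain_sset ?O) n s)"
  then have fuv: "f n (u n s) = v n s" if "s \<in> ?O n" for n s
    using that by (simp add: sset_incl_def)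
  have "\<exists>h. sset_map (chain_sset (S.chains T x y)) X h \<and> (\<forall>n. \<forall>s\<in>?O n. h n s = u n s) \<and>
      (\<forall>n. \<forall>s\<in>S.chains T x y n. f n (h n s) = v n s)"
  proof (cases "x = y \<or> S.paths x y = {}")
    case True
    note O = odot_trivial[OF x True]
    have "s \<in> ?O n" if "s \<in> S.chains T x y n" for n s using fun_cong[OF O, of n] that by simp
    then show ?thesis using u[unfolded O] fuv by (intro exI[of _ u] conjI allI ballI) simp_all
  next
    case False
    obtain j :: "'e list list \<Rightarrow> 'u" where j: "inj_on j {ps. \<exists>a b n. ps \<in> S.chains T a b n}"
      using countable_inj_into_infinite[OF countable_chains universe(1)] by blast
    obtain \<iota> :: "'v \<Rightarrow> 'o" where \<iota>: "inj_on \<iota> (verts (ug G))"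
      using countable_inj_into_infinite[OF countable_finite[OF S.finite_verts] universe(2)] by blast
    interpret A: prescribed G T x y j X ?O u
      by unfold_locales (use False j u in auto)
    interpret B: prescribed G T x y j Y "S.chains T x y" v
      by unfold_locales (use False j v composites_subset in auto)
    have hom_eq: "B.hom a c = A.hom a c" if "\<not> (a = x \<and> c = y)" for a c
      unfolding A.hom_def B.hom_def if_not_P[OF that] ..
    \<comment> \<open>the two categories differ only in their mapping spaces from \<open>x\<close> to \<open>y\<close>, where \<open>F\<close> is \<open>f\<close>\<close>
    define F where "F = \<lparr>fobj = (\<lambda>a :: 'v. a), fhom = (\<lambda>a c. if a = x \<and> c = y then f else sset_incl (A.hom a c))\<rparr>"
    have F_simps: "fobj F a = a" "fhom F x y = f"
      "\<not> (a = x \<and> c = y) \<Longrightarrow> p \<in> simplices (A.hom a c) n \<Longrightarrow> fhom F a c n p = p" for a c n p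
      by (auto simp: F_def sset_incl_def)
    have F_map: "sset_map (A.hom a c) (B.hom a c) (fhom F a c)" for a c
      using R_maps[OF f] sset_map_incl_self[OF A.hom_sset] hom_eq by (auto simp: F_def)
    have F_comp: "fhom F a c n (A.comp a b c n p q) = B.comp a b c n (fhom F a b n p) (fhom F b c n q)"
      if pq: "p \<in> simplices (A.hom a b) n" "q \<in> simplices (A.hom b c) n" for a b c n p q
    proof (cases "a = x \<and> c = y")
      case ac: True
      show ?thesis
      proof (cases "b = x \<or> b = y")
        case True
        then show ?thesis using ac by (auto simp: F_simps)
      next
        case b: False
        then obtain ps qs where *: "ps \<in> S.chains T x b n" "qs \<in> S.chains T b y n" "p = j ps" "q = j qs"
          "map2 (@) ps qs \<in> S.composites T x y n"
          using A.proper_middle pq ac by metis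
        have "fhom F x b n p = p" "fhom F b y n q = q" using F_simps(3) pq b ac by auto
        then show ?thesis
          using ac b *(3-5) A.comp_xy[OF _ _ *(1,2)] B.comp_xy[OF _ _ *(1,2)] fuv F_simps(2) by simp
      qed
    next
      case ac: False
      have in_hom: "A.comp a b c n p q \<in> simplices (A.hom a c) n" using A.comp_in pq by blast
      show ?thesis
      proof (cases "A.above a c")
        case True
        then show ?thesis using F_simps(3)[OF ac in_hom] ac by (simp add: A.comp_above B.comp_above)
      next
        case na: False
        have "\<not> A.above a b" "\<not> A.above b c" using A.low_middle[OF pq na] by metis+
        then have nab: "\<not> (a = x \<and> b = y)" "\<not> (b = x \<and> c = y)" using A.above_xy by auto
        show ?thesis
          unfolding F_simps(3)[OF ac in_hom] F_simps(3)[OF nab(1) pq(1)] F_simps(3)[OF nab(2) pq(2)]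
          unfolding A.comp_def B.comp_def if_not_P[OF ac] ..
      qed
    qed
    have F: "simplicial_functor A.cat B.cat F"
      unfolding simplicial_functor_def A.cat_simps B.cat_simps
    proof (intro conjI ballI allI)
      show "simplicial_category A.cat" "simplicial_category B.cat"
        by (rule A.simplicial_category_cat, rule B.simplicial_category_cat)
      show "fobj F \<in> verts (ug G) \<rightarrow> verts (ug G)" by (simp add: F_simps)
      show "sset_map (A.hom a c) (B.hom (fobj F a) (fobj F c)) (fhom F a c)" for a c
        unfolding F_simps(1) by (rule F_map)
      show "fhom F a a 0 (j [[]]) = j [[]]" if "a \<in> verts (ug G)" for a
        using A.sid_in[OF that] False F_simps(3)[of a a] by auto
      show "fhom F a c n (A.comp a b c n p q) =
          B.comp (fobj F a) (fobj F b) (fobj F c) n (fhom F a b n p) (fhom F b c n q)"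
        if "p \<in> simplices (A.hom a b) n" "q \<in> simplices (A.hom b c) n" for a b c n p q
        unfolding F_simps(1) by (rule F_comp[OF that])
    qed
    let ?A = "relabel \<iota> A.cat" and ?B = "relabel \<iota> B.cat" and ?F = "relabel_fun \<iota> (verts (ug G)) F"
    have \<iota>': "inj_on \<iota> (objs A.cat)" "inj_on \<iota> (objs B.cat)" using \<iota> by simp_all
    note rA = relabel_simps[OF \<iota>'(1), unfolded A.cat_simps] and rB = relabel_simps[OF \<iota>'(2), unfolded B.cat_simps]
    have F_hom: "fhom ?F (\<iota> a) (\<iota> c) = fhom F a c" if "a \<in> verts (ug G)" "c \<in> verts (ug G)" for a c
      using inv_into_f_f[OF \<iota>] that by (simp add: relabel_fun_def)
    have F_obj: "fobj ?F a = a" for a by (simp add: relabel_fun_def)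
    have "simplicial_functor ?A ?B ?F"
      using functor_relabel_fun[OF \<iota>'(1) F] by (simp add: F_simps)
    moreover have "(A.hom a c, B.hom a c, fhom F a c) \<in> R" for a c
    proof (cases "a = x \<and> c = y")
      case True
      then show ?thesis using f by (simp add: F_simps)
    next
      case False
      then have "fhom F a c = sset_incl (A.hom a c)" by (auto simp: F_def)
      then show ?thesis using R_isos[OF sset_iso_incl_self[OF A.hom_sset]] hom_eq[OF False] by simp
    qed
    ultimately have "local_functor R ?A ?B ?F"
      unfolding local_functor_def F_obj rA(1) by (auto simp: rA rB F_hom)
    from llp[OF this] have lift: "scat_llp (CC G (ug G, S)) (CC G (ug G, T)) (CC_incl G (ug G, S)) ?A ?B ?F" .
    define U where "U = \<lparr>fobj = (\<lambda>c. \<iota> (fobj (A.into S) c)), fhom = fhom (A.into S)\<rparr>"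
    define V where "V = \<lparr>fobj = (\<lambda>c. \<iota> (fobj (B.into T) c)), fhom = fhom (B.into T)\<rparr>"
    have U: "simplicial_functor (CC G (ug G, S)) ?A U" unfolding U_def
      by (rule functor_into_relabel[OF \<iota>'(1) A.functor_into[OF S.complete_family_axioms incl]]) blast
    have V: "simplicial_functor (CC G (ug G, T)) ?B V" unfolding V_def
      by (rule functor_into_relabel[OF \<iota>'(2) B.functor_into[OF T.complete_family_axioms order_refl]]) blast
    have FU: "fhom F a c n (fhom (A.into S) a c n s) = fhom (B.into T) a c n s" if s: "s \<in> S.chains S a c n" for a c n s
    proof -
      have sT: "s \<in> S.chains T a c n" using s S.chains_mono[OF incl] by blast
      consider "a = x \<and> c = y" | "\<not> (a = x \<and> c = y)" "A.above a c" | "\<not> (a = x \<and> c = y)" "\<not> A.above a c" by blast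
      then show ?thesis
      proof cases
        case 1
        then show ?thesis using s sT fuv by (simp add: A.into_simps B.into_simps F_simps)
      next
        case 2
        then show ?thesis using s sT A.hom_above[OF 2(2,1)] F_simps(3)[OF 2(1)] by (simp add: A.into_simps B.into_simps)
      next
        case 3
        have "j s \<in> simplices (A.hom a c) n" using A.hom_paths[OF 3(2)] sT by blast
        then show ?thesis using F_simps(3)[OF 3(1)] A.into_simps(4)[OF 3(2) s] B.into_simps(4)[OF 3(2) sT] by simp
      qed
    qed
    have "comp_eq (CC G (ug G, S)) ?F U V (CC_incl G (ug G, S))"
      unfolding comp_eq_def F_obj
      by (auto simp: U_def V_def CC_incl_def sfun_id_def sset_incl_def A.into_simps(1) B.into_simps(1) F_hom FU)
    then obtain H where H: "simplicial_functor (CC G (ug G, T)) ?A H"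
      and HU: "comp_eq (CC G (ug G, S)) H (CC_incl G (ug G, S)) U (sfun_id (CC G (ug G, S)))"
      and HV: "comp_eq (CC G (ug G, T)) ?F H V (sfun_id (CC G (ug G, T)))"
      using lift U V unfolding scat_llp_def by blast
    have H_obj: "fobj H a = \<iota> a" if "a \<in> verts (ug G)" for a
      using HU that by (simp add: comp_eq_def CC_incl_def sfun_id_def U_def A.into_simps)
    have H_map: "sset_map (chain_sset (S.chains T a c)) (A.hom a c) (fhom H a c)"
      if "a \<in> verts (ug G)" "c \<in> verts (ug G)" for a c
      using simplicial_functorD(4)[OF H, of a c] that by (simp add: H_obj rA)
    have H_S: "fhom H x y n s = u n s" if "s \<in> S.chains S x y n" for n s
      using HU that x y by (simp add: comp_eq_def CC_incl_def sfun_id_def sset_incl_def U_def A.into_simps)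
    have H_V: "fhom F a c n (fhom H a c n s) = fhom (B.into T) a c n s"
      if "a \<in> verts (ug G)" "c \<in> verts (ug G)" "s \<in> S.chains T a c n" for a c n s
      using HV that by (simp add: comp_eq_def sfun_id_def sset_incl_def V_def H_obj F_hom)
    \<comment> \<open>elsewhere \<open>F\<close> is injective, so the lift is forced; hence it agrees with \<open>u\<close> on composites\<close>
    have H_low: "fhom H a c n s = j s"
      if a: "a \<in> verts (ug G)" "c \<in> verts (ug G)" "s \<in> S.chains T a c n" and na: "\<not> A.above a c" for a c n s
    proof -
      have "fhom H a c n s \<in> simplices (A.hom a c) n" using sset_mapD(1)[OF H_map[OF a(1,2)], of s n] a(3) by simp
      moreover have "\<not> (a = x \<and> c = y)" using na A.above_xy by auto
      ultimately show ?thesis using H_V[OF a] F_simps(3) B.into_simps(4)[OF na a(3)] by simp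
    qed
    have H_comp: "fhom H x y n s = u n s" if s: "s \<in> S.composites T x y n" for n s
    proof -
      obtain z ps qs where z: "z \<noteq> x" "z \<noteq> y" and pq: "ps \<in> S.chains T x z n" "qs \<in> S.chains T z y n"
        and s_eq: "s = map2 (@) ps qs" using s unfolding S.composites_def by blast
      have zW: "z \<in> verts (ug G)" using S.chains_paths[OF pq(1), of 0] S.paths_verts(2) by blast
      have "A.le x z" "A.le z y" using A.chains_le pq by blast+
      then have na: "\<not> A.above x z" "\<not> A.above z y" unfolding A.above_def using A.le_antisym z by blast+
      have "fhom H x y n s = A.comp x z y n (fhom H x z n ps) (fhom H z y n qs)"
        unfolding s_eq using simplicial_functorD(6)[OF H, of x z y ps n qs] x y zW pq by (simp add: H_obj rA)
      also have "\<dots> = u n s"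
        unfolding H_low[OF x zW pq(1) na(1)] H_low[OF zW y pq(2) na(2)] A.comp_xy[OF z pq] s_eq ..
      finally show ?thesis .
    qed
    have "f n (fhom H x y n s) = v n s" if "s \<in> S.chains T x y n" for n s
      using H_V[OF x y that] that by (simp add: F_simps B.into_simps)
    then show ?thesis using H_map[OF x y] H_S H_comp by auto
  qed
  then obtain h where h: "sset_map (chain_sset (S.chains T x y)) X h" "\<And>n s. s \<in> ?O n \<Longrightarrow> h n s = u n s"
    "\<And>n s. s \<in> S.chains T x y n \<Longrightarrow> f n (h n s) = v n s" by blast
  then show "\<exists>h. sset_map (chain_sset (S.chains T x y)) X h \<and>
      (\<forall>n. \<forall>s\<in>simplices (chain_sset ?O) n. h n (sset_incl (chain_sset ?O) n s) = u n s) \<and>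
      (\<forall>n. \<forall>s\<in>simplices (chain_sset (S.chains T x y)) n. f n (h n s) = v n s)"
    by (intro exI[of _ h]) (simp add: sset_incl_def)
qed

end

theorem theoremB:
  fixes G :: "('v, 'e) plane"
    and S T :: "('v, 'e) pre_digraph set"
    and R :: "'u sset_class"
  assumes universe: "infinite (UNIV :: 'u set)" "infinite (UNIV :: 'o set)"
    and R_maps: "\<And>X Y f. (X, Y, f) \<in> R \<Longrightarrow> sset_map X Y f"
    and R_isos: "\<And>X Y f. sset_iso X Y f \<Longrightarrow> (X, Y, f) \<in> R"
    and G: "globular_graph G"
    and S: "complete_diagram G (ug G, S)"
    and T: "complete_diagram G (ug G, T)"
    and incl: "S \<subseteq> T"
  shows
    "(\<forall>(A :: ('o, 'u) scat) (B :: ('o, 'u) scat) F.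
        local_functor R A B F \<longrightarrow> scat_llp (CC G (ug G, S)) (CC G (ug G, T)) (CC_incl G (ug G, S)) A B F)
     \<longleftrightarrow>
     (\<forall>x\<in>verts (ug G). \<forall>y\<in>verts (ug G).
        llp_class R
          (diagram_nerve G (odot G (restriction (ug G, S) x y) (restriction (ug G, T) x y)))
          (diagram_nerve G (restriction (ug G, T) x y))
          (sset_incl (diagram_nerve G (odot G (restriction (ug G, S) x y) (restriction (ug G, T) x y)))))"
    (is "?L \<longleftrightarrow> ?R")
proof -
  interpret plane_map G using G by unfold_locales (simp add: globular_graph_def)
  have gl: "globular G" using G by (simp add: globular_graph_def)
  interpret P: complete_pair G S T
    by (intro complete_pair.intro complete_pair_axioms.intro complete_family_if_complete[OF gl] S T incl)
  show ?thesis
  proof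
    assume L: ?L
    show ?R
      unfolding P.odot_nerve P.T.diagram_nerve_restriction llp_class_def
    proof (intro ballI conjI)
      fix x y assume xy: "x \<in> verts (ug G)" "y \<in> verts (ug G)"
      show "sset_map (chain_sset (\<lambda>n. P.S.chains S x y n \<union> P.S.composites T x y n)) (chain_sset (P.S.chains T x y))
          (sset_incl (chain_sset (\<lambda>n. P.S.chains S x y n \<union> P.S.composites T x y n)))"
        by (rule P.sset_map_odot_incl)
      fix m assume m: "m \<in> R"
      obtain X Y f where "m = (X, Y, f)" by (cases m)
      with m show "case m of (X, Y, f) \<Rightarrow>
          sset_llp (chain_sset (\<lambda>n. P.S.chains S x y n \<union> P.S.composites T x y n)) (chain_sset (P.S.chains T x y))
            (sset_incl (chain_sset (\<lambda>n. P.S.chains S x y n \<union> P.S.composites T x y n))) X Y f"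
        using P.mapping_space_llp[OF universe R_maps R_isos _ xy] L by simp
    qed
  next
    assume R: ?R
    show ?L
    proof (intro allI impI)
      fix A B :: "('o, 'u) scat" and F assume loc: "local_functor R A B F"
      show "scat_llp (CC G (ug G, S)) (CC G (ug G, T)) (CC_incl G (ug G, S)) A B F"
        unfolding scat_llp_def
      proof (intro allI impI)
        fix U V assume U: "simplicial_functor (CC G (ug G, S)) A U" and V: "simplicial_functor (CC G (ug G, T)) B V"
          and sq: "comp_eq (CC G (ug G, S)) F U V (CC_incl G (ug G, S))"
        interpret L: lifting_problem G S T A B F U V
          by unfold_locales (use loc U V sq in \<open>simp_all add: local_functor_def\<close>)
        show "\<exists>H. simplicial_functor (CC G (ug G, T)) A H \<and>
            comp_eq (CC G (ug G, S)) H (CC_incl G (ug G, S)) U (sfun_id (CC G (ug G, S))) \<and>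
            comp_eq (CC G (ug G, T)) F H V (sfun_id (CC G (ug G, T)))"
        proof (rule L.lift_functor[OF _ P.simplicial_set_odot])
          fix x y assume xy: "x \<in> verts (ug G)" "y \<in> verts (ug G)"
          have "(L.X x y, L.Y x y, L.\<phi> x y) \<in> R"
            using loc L.ob_in xy by (simp add: local_functor_def)
          then show "sset_llp (chain_sset (\<lambda>n. P.S.chains S x y n \<union> P.S.composites T x y n)) (chain_sset (P.S.chains T x y))
              (sset_incl (chain_sset (\<lambda>n. P.S.chains S x y n \<union> P.S.composites T x y n))) (L.X x y) (L.Y x y) (L.\<phi> x y)"
            using R xy unfolding P.odot_nerve P.T.diagram_nerve_restriction llp_class_def by blast
        qed
      qed
    qed
  qed
qed

end
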